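(* The kernel of $p_{b}:M(\mathrm{odd})/N1\to\mathbb{Z}/2[[x]]$ is $N2a$, and the kernel of $p_{a}:M(\mathrm{odd})/N1\to\mathbb{Z}/2[[x]]$ is $N2b$.
   Context: For even $k\ge 0$, $M_{k}$ is the set of $f\in\mathbb{Z}/2[[x]]$ for which there is a modular form of weight $k$ for $\Gamma_{0}(5)$ whose expansion at infinity (in $x=e^{2\pi i z}$) lies in $\mathbb{Z}[[x]]$ and reduces mod $2$ to $f$; $M=\bigcup_{m}M_{4m}$ and $M(\mathrm{odd})=M\cap x\,\mathbb{Z}/2[[x^{2}]]$. Let $F=\sum_{n\ \mathrm{odd},\,n>0}x^{n^{2}}$, $G=F(x^{5})$; $N1$ is the $\mathbb{Z}/2[G^{2}]$-submodule generated by $G$ (it lies in $M(\mathrm{odd})$). Define $J_{1}=F$, $J_{3}=F^{8}/G$, $J_{7}=F^{2}G$, $J_{9}=F^{4}G$, and $J_{k+10}=G^{2}J_{k}$. $N2a$ (resp. $N2b$) is the $\mathbb{Z}/2[G^{4}]$-submodule of $M(\mathrm{odd})/N1$ with basis the images of $J_{1},J_{3},J_{7},J_{9}$ (resp. $J_{11},J_{13},J_{17},J_{19}$). $\chi$ is the Dirichlet character modulo $20$ taking $1,3,7,9$ to $1$ and $11,13,17,19$ to $-1$; $p_{a}(\sum c_{n}x^{n})=\sum_{\chi(n)=1}c_{n}x^{n}$ and $p_{b}(\sum c_{n}x^{n})=\sum_{\chi(n)=-1}c_{n}x^{n}$. These maps kill $N1$, hence are defined on $M(\mathrm{odd})/N1$.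 *)

theory Defs
  imports "HOL-Analysis.Analysis" "HOL-Library.Z2"
    "HOL-Computational_Algebra.Formal_Power_Series"
    "HOL-Computational_Algebra.Polynomial"
begin

definition upper_half_plane :: "complex set" where
  "upper_half_plane = {z. Im z > 0}"

text \<open>Matrices (a,b,c,d) stand for [[a,b],[c,d]].\<close>
definition SL2Z :: "(int \<times> int \<times> int \<times> int) set" where
  "SL2Z = {(a,b,c,d). a*d - b*c = 1}"

definition Gamma0_5 :: "(int \<times> int \<times> int \<times> int) set" where
  "Gamma0_5 = {(a,b,c,d). a*d - b*c = 1 \<and> (5::int) dvd c}"

text \<open>Modular form of weight k for Gamma_0(5): holomorphic on the upper half plane,
  weight-k invariance under Gamma_0(5), and holomorphic at every cusp, i.e. for every
  gamma in SL2(Z) the slashed function (f|_k gamma)(z) = (cz+d)^(-k) f(gamma z)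
  is bounded on Im z >= 1.\<close>
definition modular_form_Gamma0_5 :: "nat \<Rightarrow> (complex \<Rightarrow> complex) \<Rightarrow> bool" where
  "modular_form_Gamma0_5 k f \<longleftrightarrow>
     f holomorphic_on upper_half_plane \<and>
     (\<forall>(a,b,c,d)\<in>Gamma0_5. \<forall>z\<in>upper_half_plane.
        f ((of_int a * z + of_int b) / (of_int c * z + of_int d))
          = (of_int c * z + of_int d) ^ k * f z) \<and>
     (\<forall>(a,b,c,d)\<in>SL2Z. \<exists>B. \<forall>z. Im z \<ge> 1 \<longrightarrow>
        norm (f ((of_int a * z + of_int b) / (of_int c * z + of_int d)))
          \<le> B * norm (of_int c * z + of_int d) ^ k)"

definition int_expansion :: "(complex \<Rightarrow> complex) \<Rightarrow> (nat \<Rightarrow> int) \<Rightarrow> bool" where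
  "int_expansion f a \<longleftrightarrow>
     (\<forall>z\<in>upper_half_plane.
        (\<lambda>n. of_int (a n) * exp (2 * pi * \<i> * of_nat n * z)) sums f z)"

definition Mk :: "nat \<Rightarrow> bit fps set" where
  "Mk k = {Abs_fps (\<lambda>n. of_int (a n)) | f a. modular_form_Gamma0_5 k f \<and> int_expansion f a}"

definition Mall :: "bit fps set" where
  "Mall = (\<Union>m. Mk (4*m))"

definition Modd :: "bit fps set" where
  "Modd = {g \<in> Mall. \<forall>n. even n \<longrightarrow> fps_nth g n = 0}"

definition Fser :: "bit fps" where
  "Fser = Abs_fps (\<lambda>m. if \<exists>n::nat. odd n \<and> m = n^2 then 1 else 0)"

definition Gser :: "bit fps" where
  "Gser = Abs_fps (\<lambda>m. if \<exists>n::nat. odd n \<and> m = 5 * n^2 then 1 else 0)"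

definition J1 :: "bit fps" where "J1 = Fser"
definition J3 :: "bit fps" where "J3 = Fser ^ 8 / Gser"
definition J7 :: "bit fps" where "J7 = Fser ^ 2 * Gser"
definition J9 :: "bit fps" where "J9 = Fser ^ 4 * Gser"
definition J11 :: "bit fps" where "J11 = Gser ^ 2 * J1"
definition J13 :: "bit fps" where "J13 = Gser ^ 2 * J3"
definition J17 :: "bit fps" where "J17 = Gser ^ 2 * J7"
definition J19 :: "bit fps" where "J19 = Gser ^ 2 * J9"

definition poly_subst :: "bit poly \<Rightarrow> bit fps \<Rightarrow> bit fps" where
  "poly_subst p g = (\<Sum>i\<le>degree p. fps_const (coeff p i) * g ^ i)"

definition N1 :: "bit fps set" where
  "N1 = {poly_subst p (Gser ^ 2) * Gser | p. True}"

definition N2a_lift :: "bit fps set" where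
  "N2a_lift = {poly_subst p1 (Gser^4) * J1 + poly_subst p3 (Gser^4) * J3
             + poly_subst p7 (Gser^4) * J7 + poly_subst p9 (Gser^4) * J9 | p1 p3 p7 p9. True}"

definition N2b_lift :: "bit fps set" where
  "N2b_lift = {poly_subst p1 (Gser^4) * J11 + poly_subst p3 (Gser^4) * J13
             + poly_subst p7 (Gser^4) * J17 + poly_subst p9 (Gser^4) * J19 | p1 p3 p7 p9. True}"

definition p_a :: "bit fps \<Rightarrow> bit fps" where
  "p_a f = Abs_fps (\<lambda>n. if n mod 20 \<in> {1,3,7,9} then fps_nth f n else 0)"

definition p_b :: "bit fps \<Rightarrow> bit fps" where
  "p_b f = Abs_fps (\<lambda>n. if n mod 20 \<in> {11,13,17,19} then fps_nth f n else 0)"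

end

theory Submission
  imports Defs "HOL-Complex_Analysis.Complex_Analysis"
begin

text \<open>
Write \<open>P(q)\<close> for the Euler product and put \<open>a = P(q)^5 / P(q^5)\<close>, \<open>c = q P(q^5)^5 / P(q)\<close>. The squares and the product of
these two functions are modular forms of weight 4 on \<open>\<Gamma>\<^sub>0(5)\<close>, \<open>c\<close> has no zeros away from the cusp at infinity, and by a
maximum principle for a norm to level 1 a form of weight \<open>4m\<close> vanishing to order greater than \<open>2m\<close> at infinity is zero. Hence
the forms of weight \<open>4m\<close> with integral expansion are the integral combinations of the \<open>a^(2m - i) c^i\<close>. The logarithmic
derivative of \<open>c / a = q (P(q^5) / P(q))^6\<close> has weight 2 and is congruent to 1 modulo 2; comparing its square with
\<open>a^2\<close>, \<open>a c\<close>, \<open>c^2\<close> gives \<open>a + c = 1\<close> modulo 2, so that \<open>M\<close> is the polynomial ring in \<open>c\<close> over \<open>\<int>/2\<close>. There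
\<open>F = a^5 c\<close>, \<open>G = a c^5\<close> and \<open>(F + G)^6 = F G\<close>.

Since \<open>q dc/dq = F + G = c + c^2\<close>, the odd part of \<open>M\<close> is \<open>(F + G) \<int>/2[c^2]\<close>, which is spanned over \<open>\<int>/2[G^2]\<close> by \<open>G\<close>,
\<open>J1\<close>, \<open>J3\<close>, \<open>J7\<close>, \<open>J9\<close> and \<open>F^5\<close>. Decompose \<open>F = E + U + V\<close> by exponents congruent to 0, 1, 4 modulo 5. The relation
between \<open>F\<close> and \<open>G\<close> yields \<open>U V = (E + G)^2\<close> and \<open>U^5 + V^5 = G\<close>, and these identities turn the vanishing of two residue
classes of exponents modulo 5 into the vanishing of three of the six coefficients. Splitting also by exponents
modulo 4 gives both kernels.
\<close>

section \<open>The theta product and the eta function\<close>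

text \<open>\<open>\<Gamma>\<^sub>0(5)\<close> has index 6 in the modular group, so a nonzero form
  of weight 4m has 2m zeros in all, and the power 2m of \<open>c\<close> has all of them at
  infinity: division by it turns the bound on the order into a statement about bounded invariant
  functions. Alone, \<open>a\<close> and \<open>c\<close> are modular only up to a sign, which
  disappears in monomials of even degree; for these the square of eta suffices, a function of weight
  1 whose inversion formula contains no square root. \<open>a^5 c\<close> and \<open>a c^5\<close>
  are the discriminant form at z and at 5z, whence their role for \<open>F\<close> and
  \<open>G\<close>. The obstacle is the generator \<open>F^5\<close>: M(odd) has six generators over
  \<open>\<int>/2[G\<^sup>2]\<close>, but N1, N2a and N2b account for only five of them, so the
  projections must be shown to detect the sixth. Frobenius splits \<open>F^2\<close>,
  \<open>F^4\<close> and \<open>F^8\<close> into pure powers of \<open>E\<close>, \<open>U\<close>,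
  \<open>V\<close>, hence each class modulo 5 gives an equation with few unknowns. The classes
  modulo 4 explain the ring \<open>\<int>/2[G^4]\<close>: multiplication by \<open>G\<^sup>2\<close>
  adds 10 to the exponents modulo 20 and so interchanges the two values of the character.\<close>

definition qpoch :: "complex \<Rightarrow> complex \<Rightarrow> complex" where
  "qpoch x q = (\<Prod>n. 1 - x * q ^ n)"

lemma qpoch_convergent:
  fixes x q :: complex
  assumes "norm q < 1"
  shows "convergent_prod (\<lambda>n. 1 - x * q ^ n)"
proof -
  have "summable (\<lambda>n. norm (- x * q ^ n))"
    using assms by (simp add: norm_mult norm_power summable_mult summable_geometric)
  then have "abs_convergent_prod (\<lambda>n. 1 + (- x * q ^ n))"
    by (subst abs_convergent_prod_conv_summable) simp
  then show ?thesis
    using abs_convergent_prod_imp_convergent_prod by fastforce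
qed

lemma qpoch_LIMSEQ:
  assumes "norm q < 1"
  shows "(\<lambda>N. \<Prod>n<N. 1 - x * q ^ n) \<longlonglongrightarrow> qpoch x q"
proof -
  have "(\<lambda>N. \<Prod>n\<le>N. 1 - x * q ^ n) \<longlonglongrightarrow> qpoch x q"
    unfolding qpoch_def by (intro convergent_prod_LIMSEQ qpoch_convergent assms)
  then show ?thesis
    by (simp add: LIMSEQ_lessThan_iff_atMost)
qed

lemma qpoch_eq_0_iff:
  assumes "norm q < 1"
  shows "qpoch x q = 0 \<longleftrightarrow> (\<exists>n. x * q ^ n = 1)"
  using convergent_prod_has_prod[OF qpoch_convergent[OF assms, of x]]
  unfolding qpoch_def by (subst has_prod_eq_0_iff) (auto intro: sym)

lemma qpoch_rec:
  assumes "norm q < 1"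
  shows "qpoch x q = (1 - x) * qpoch (x * q) q"
proof -
  have "(\<lambda>N. (1 - x) * (\<Prod>n<N. 1 - (x * q) * q ^ n)) \<longlonglongrightarrow> (1 - x) * qpoch (x * q) q"
    by (intro tendsto_intros qpoch_LIMSEQ assms)
  moreover have "(1 - x) * (\<Prod>n<N. 1 - (x * q) * q ^ n) = (\<Prod>n<Suc N. 1 - x * q ^ n)" for N
    by (subst prod.lessThan_Suc_shift) (simp add: mult_ac)
  ultimately have "(\<lambda>N. \<Prod>n<Suc N. 1 - x * q ^ n) \<longlonglongrightarrow> (1 - x) * qpoch (x * q) q"
    by simp
  moreover have "(\<lambda>N. \<Prod>n<Suc N. 1 - x * q ^ n) \<longlonglongrightarrow> qpoch x q"
    using LIMSEQ_Suc[OF qpoch_LIMSEQ[OF assms]] .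
  ultimately show ?thesis
    using LIMSEQ_unique by blast
qed

text \<open>On a compact set \<open>X\<close> is bounded and the norm of \<open>Q\<close> stays
  below some r < 1, so a geometric series dominates the factors. Both arguments may vary, which
  serves the theta product (only \<open>X\<close> moves) and the Euler product (both move)
  alike.\<close>

lemma uniform_limit_qpoch:
  fixes A :: "complex set"
  assumes "compact A" "continuous_on A X" "continuous_on A Q" and Q: "\<And>a. a \<in> A \<Longrightarrow> norm (Q a) < 1"
  shows "uniform_limit A (\<lambda>N a. \<Prod>n<N. 1 - X a * Q a ^ n) (\<lambda>a. qpoch (X a) (Q a)) sequentially"
proof -
  have "bounded (X ` A)"
    using assms by (intro compact_imp_bounded compact_continuous_image)
  then obtain R where R: "\<And>a. a \<in> A \<Longrightarrow> norm (X a) \<le> R"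
    unfolding bounded_iff by blast
  have "\<exists>r. 0 \<le> r \<and> r < 1 \<and> (\<forall>a\<in>A. norm (Q a) \<le> r)"
  proof (cases "A = {}")
    case False
    obtain a where "a \<in> A" "\<And>b. b \<in> A \<Longrightarrow> norm (Q b) \<le> norm (Q a)"
      using continuous_attains_sup[OF assms(1) False, of "\<lambda>a. norm (Q a)"] assms(3)
      by (metis continuous_on_norm)
    then show ?thesis
      using Q by (intro exI[of _ "norm (Q a)"]) auto
  qed (auto intro!: exI[of _ 0])
  then obtain r where r: "0 \<le> r" "r < 1" "\<And>a. a \<in> A \<Longrightarrow> norm (Q a) \<le> r" by blast
  have "uniformly_convergent_on A (\<lambda>N a. \<Prod>n<N. 1 - X a * Q a ^ n)"
  proof (rule uniformly_convergent_on_prod')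
    show "uniformly_convergent_on A (\<lambda>N a. \<Sum>n<N. norm (1 - X a * Q a ^ n - 1))"
    proof (rule Weierstrass_m_test')
      fix n a assume a: "a \<in> A"
      show "norm (norm (1 - X a * Q a ^ n - 1)) \<le> \<bar>R\<bar> * r ^ n"
        using R[OF a] r(1) r(3)[OF a]
        by (auto simp: norm_mult norm_power intro!: mult_mono power_mono)
    next
      show "summable (\<lambda>n. \<bar>R\<bar> * r ^ n)"
        using r by (intro summable_mult summable_geometric) auto
    qed
  qed (use assms in \<open>auto intro!: continuous_intros\<close>)
  then obtain l where l: "uniform_limit A (\<lambda>N a. \<Prod>n<N. 1 - X a * Q a ^ n) l sequentially"
    by (auto simp: uniformly_convergent_on_def)
  have "l a = qpoch (X a) (Q a)" if "a \<in> A" for a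
    using tendsto_uniform_limitI[OF l that] qpoch_LIMSEQ[OF Q[OF that]] LIMSEQ_unique by blast
  then show ?thesis
    using l by (subst uniform_limit_cong'[where g = "\<lambda>N a. \<Prod>n<N. 1 - X a * Q a ^ n" and i = l]) auto
qed

lemma holomorphic_qpoch:
  assumes "open S" "X holomorphic_on S" "Q holomorphic_on S" "\<And>a. a \<in> S \<Longrightarrow> norm (Q a) < 1"
  shows "(\<lambda>a. qpoch (X a) (Q a)) holomorphic_on S"
proof (rule holomorphic_uniform_sequence[OF \<open>open S\<close>])
  show "(\<lambda>a. \<Prod>n<N. 1 - X a * Q a ^ n) holomorphic_on S" for N
    using assms by (intro holomorphic_intros)
next
  fix x assume "x \<in> S"
  then obtain d where "d > 0" "cball x d \<subseteq> S"
    using \<open>open S\<close> open_contains_cball by blast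
  moreover have "uniform_limit (cball x d) (\<lambda>N a. \<Prod>n<N. 1 - X a * Q a ^ n) (\<lambda>a. qpoch (X a) (Q a)) sequentially"
    using assms(4) calculation
      holomorphic_on_imp_continuous_on[OF holomorphic_on_subset[OF assms(2) \<open>cball x d \<subseteq> S\<close>]]
      holomorphic_on_imp_continuous_on[OF holomorphic_on_subset[OF assms(3) \<open>cball x d \<subseteq> S\<close>]]
    by (intro uniform_limit_qpoch) auto
  ultimately show "\<exists>d>0. cball x d \<subseteq> S \<and>
      uniform_limit (cball x d) (\<lambda>N a. \<Prod>n<N. 1 - X a * Q a ^ n) (\<lambda>a. qpoch (X a) (Q a)) sequentially"
    by blast
qed

section \<open>Exponentials and the Jacobi theta product\<close>

definition cexp1 :: "complex \<Rightarrow> complex" where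
  "cexp1 z = exp (2 * of_real pi * \<i> * z)"

lemma cexp1_add: "cexp1 (x + y) = cexp1 x * cexp1 y"
  by (simp add: cexp1_def exp_add [symmetric] algebra_simps)

lemma cexp1_minus: "cexp1 (- x) = inverse (cexp1 x)"
  by (simp add: cexp1_def exp_minus)

lemma cexp1_nonzero [simp]: "cexp1 z \<noteq> 0"
  by (simp add: cexp1_def)

lemma cexp1_0 [simp]: "cexp1 0 = 1"
  by (simp add: cexp1_def)

lemma cexp1_of_nat_mult: "cexp1 (of_nat n * z) = cexp1 z ^ n"
  by (simp add: cexp1_def exp_of_nat_mult [symmetric] algebra_simps)

lemma cexp1_eq_1_iff: "cexp1 z = 1 \<longleftrightarrow> (\<exists>n::int. z = of_int n)"
proof -
  have "cexp1 z = 1 \<longleftrightarrow> (\<exists>n::int. 2 * of_real pi * \<i> * z = of_int (2 * n) * of_real pi * \<i>)"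
    unfolding cexp1_def by (subst exp_eq_1) (auto simp: complex_eq_iff)
  also have "\<dots> \<longleftrightarrow> (\<exists>n::int. z = of_int n)"
    by (simp add: field_simps)
  finally show ?thesis .
qed

lemma cexp1_of_int [simp]: "cexp1 (of_int n) = 1"
  by (auto simp: cexp1_eq_1_iff)

lemma norm_cexp1: "norm (cexp1 z) = exp (- 2 * pi * Im z)"
  by (simp add: cexp1_def)

lemma norm_cexp1_less_1: "Im z > 0 \<Longrightarrow> norm (cexp1 z) < 1"
  by (simp add: norm_cexp1)

lemma holomorphic_cexp1 [holomorphic_intros]:
  "f holomorphic_on S \<Longrightarrow> (\<lambda>z. cexp1 (f z)) holomorphic_on S"
  unfolding cexp1_def by (intro holomorphic_intros)

lemma sin_cexp1: "2 * sin (of_real pi * w) = - \<i> * (cexp1 (w / 2) - inverse (cexp1 (w / 2)))"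
proof -
  have "2 * sin (of_real pi * w) = \<i> * (exp (- (\<i> * (of_real pi * w))) - exp (\<i> * (of_real pi * w)))"
    by (simp add: sin_exp_eq')
  also have "\<dots> = - \<i> * (exp (\<i> * (of_real pi * w)) - exp (- (\<i> * (of_real pi * w))))"
    by (simp only: mult_minus_left mult_minus_right [symmetric] minus_diff_eq)
  also have "\<i> * (of_real pi * w) = 2 * of_real pi * \<i> * (w / 2)"
    by simp
  finally show ?thesis
    by (simp only: cexp1_def exp_minus)
qed

text \<open>Jacobi's function theta_1(w | t) without the factors that do not depend on
  \<open>w\<close>, namely e(t/8) and the Euler product. The sine accounts for the zeros at the
  integers, so the two infinite products start at e(t + w) and e(t - w).\<close>

definition theta_prod :: "complex \<Rightarrow> complex \<Rightarrow> complex" where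
  "theta_prod t w = 2 * sin (of_real pi * w) * qpoch (cexp1 (t + w)) (cexp1 t) * qpoch (cexp1 (t - w)) (cexp1 t)"

lemma theta_prod_minus: "theta_prod t (- w) = - theta_prod t w"
  by (simp add: theta_prod_def)

lemma theta_prod_add_1: "theta_prod t (w + 1) = - theta_prod t w"
proof -
  have "cexp1 (t + (w + 1)) = cexp1 (t + w)" "cexp1 (t - (w + 1)) = cexp1 (t - w)"
    using cexp1_of_int[of 1] cexp1_of_int[of "-1"] cexp1_add[of "t + w" 1] cexp1_add[of "t - w" "-1"]
    by (simp_all add: algebra_simps)
  moreover have "sin (of_real pi * (w + 1)) = - sin (of_real pi * w)"
    by (simp add: distrib_left sin_add flip: sin_of_real cos_of_real)
  ultimately show ?thesis
    by (simp add: theta_prod_def)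
qed

text \<open>Adding \<open>t\<close> to \<open>w\<close> shifts each infinite product by one factor,
  and the sine makes up the difference. In terms of a = e(w/2) and b = e(t/2) the claim reduces to
  the rational identity \<open>e\<close>.\<close>

lemma theta_prod_add_period:
  assumes t: "Im t > 0"
  shows "theta_prod t (w + t) = - cexp1 (- t / 2) * cexp1 (- w) * theta_prod t w"
proof -
  define a b where "a = cexp1 (w / 2)" and "b = cexp1 (t / 2)"
  have [simp]: "a \<noteq> 0" "b \<noteq> 0" by (simp_all add: a_def b_def)
  have q: "norm (cexp1 t) < 1" using t by (rule norm_cexp1_less_1)
  have ew: "cexp1 w = a\<^sup>2" and et: "cexp1 t = b\<^sup>2"
    unfolding a_def b_def power2_eq_square by (simp_all flip: cexp1_add)
  have *: "cexp1 (- w) = inverse (a\<^sup>2)" "cexp1 (- t / 2) = inverse b" "cexp1 (t + w) = a\<^sup>2 * b\<^sup>2"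
    using cexp1_minus[of "t / 2"] by (simp_all add: cexp1_minus cexp1_add ew et b_def)
  have **: "cexp1 ((w + t) / 2) = a * b" "cexp1 (t + (w + t)) = cexp1 (t + w) * cexp1 t"
    "cexp1 (t - w) = cexp1 (t - (w + t)) * cexp1 t" "cexp1 (t - (w + t)) = inverse (a\<^sup>2)"
    by (simp_all add: a_def b_def add_divide_distrib cexp1_add [symmetric] * (1) [symmetric, unfolded a_def] add_ac)
  note * = * **
  have 1: "qpoch (cexp1 (t + w)) (cexp1 t) = (1 - a\<^sup>2 * b\<^sup>2) * qpoch (cexp1 (t + (w + t))) (cexp1 t)"
    using qpoch_rec[OF q, of "cexp1 (t + w)"] by (simp only: *)
  have 2: "qpoch (cexp1 (t - (w + t))) (cexp1 t) = (1 - inverse (a\<^sup>2)) * qpoch (cexp1 (t - w)) (cexp1 t)"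
    using qpoch_rec[OF q, of "cexp1 (t - (w + t))"] by (simp only: * mult.commute)
  have 3: "2 * sin (of_real pi * (w + t)) = - \<i> * (a * b - inverse (a * b))"
    using sin_cexp1[of "w + t"] * by simp
  have 4: "2 * sin (of_real pi * w) = - \<i> * (a - inverse a)"
    using sin_cexp1[of w] by (simp add: a_def)
  have e: "(a * b - inverse (a * b)) * (1 - inverse (a\<^sup>2))
    = - inverse b * inverse (a\<^sup>2) * (a - inverse a) * (1 - a\<^sup>2 * b\<^sup>2)"
    by (simp add: field_simps power2_eq_square)
  have "theta_prod t (w + t) = - \<i> * qpoch (cexp1 (t + (w + t))) (cexp1 t) * qpoch (cexp1 (t - w)) (cexp1 t)
      * ((a * b - inverse (a * b)) * (1 - inverse (a\<^sup>2)))"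
    unfolding theta_prod_def 2 3 by (simp only: mult_ac)
  also have "\<dots> = - cexp1 (- t / 2) * cexp1 (- w) * theta_prod t w"
    unfolding theta_prod_def e 1 4 *(1,2) by (simp only: mult_ac mult_minus_left mult_minus_right)
  finally show ?thesis .
qed

text \<open>A convergent product vanishes only through one of its factors: the sine contributes the
  integers, the two infinite products the lattice points with negative and with positive multiples
  of \<open>t\<close>.\<close>

lemma theta_prod_eq_0_iff:
  assumes t: "Im t > 0"
  shows "theta_prod t w = 0 \<longleftrightarrow> (\<exists>m n :: int. w = of_int m + of_int n * t)"
proof -
  have q: "norm (cexp1 t) < 1" using t by (rule norm_cexp1_less_1)
  have *: "cexp1 x * cexp1 t ^ n = cexp1 (x + of_nat n * t)" for x n
    by (simp add: cexp1_add cexp1_of_nat_mult)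
  have s: "sin (of_real pi * w) = 0 \<longleftrightarrow> (\<exists>n::int. w = of_int n)"
    by (subst sin_eq_0) (auto simp: complex_eq_iff)
  show ?thesis
  proof
    assume "theta_prod t w = 0"
    then consider "sin (of_real pi * w) = 0" | "qpoch (cexp1 (t + w)) (cexp1 t) = 0"
      | "qpoch (cexp1 (t - w)) (cexp1 t) = 0"
      by (auto simp: theta_prod_def)
    then show "\<exists>m n :: int. w = of_int m + of_int n * t"
    proof cases
      case 1
      then obtain m :: int where "w = of_int m + of_int 0 * t" using s by auto
      then show ?thesis by blast
    next
      case 2
      then obtain n where "cexp1 (t + w + of_nat n * t) = 1"
        by (auto simp: qpoch_eq_0_iff[OF q] *)
      then obtain m :: int where "t + w + of_nat n * t = of_int m"
        by (auto simp: cexp1_eq_1_iff)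
      then have "w = of_int m + of_int (- int n - 1) * t"
        by (simp add: algebra_simps)
      then show ?thesis by blast
    next
      case 3
      then obtain n where "cexp1 (t - w + of_nat n * t) = 1"
        by (auto simp: qpoch_eq_0_iff[OF q] *)
      then obtain m :: int where "t - w + of_nat n * t = of_int m"
        by (auto simp: cexp1_eq_1_iff)
      then have "w = of_int (- m) + of_int (int n + 1) * t"
        by (simp add: algebra_simps)
      then show ?thesis by blast
    qed
  next
    assume "\<exists>m n :: int. w = of_int m + of_int n * t"
    then obtain m n :: int where w: "w = of_int m + of_int n * t" by blast
    consider "n = 0" | k where "n = - int (Suc k)" | k where "n = int (Suc k)"
      by (cases n rule: int_cases3) (metis gr0_conv_Suc)+
    then show "theta_prod t w = 0"
    proof cases
      case 1
      then show ?thesis using s w by (simp add: theta_prod_def)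
    next
      case 2
      then have "t + w + of_nat k * t = of_int m" by (simp add: w ring_distribs)
      then have "qpoch (cexp1 (t + w)) (cexp1 t) = 0"
        by (metis * qpoch_eq_0_iff[OF q] cexp1_of_int)
      then show ?thesis by (simp add: theta_prod_def)
    next
      case 3
      then have "t - w + of_nat k * t = of_int (- m)" by (simp add: w ring_distribs)
      then have "qpoch (cexp1 (t - w)) (cexp1 t) = 0"
        by (metis * qpoch_eq_0_iff[OF q] cexp1_of_int)
      then show ?thesis by (simp add: theta_prod_def)
    qed
  qed
qed

lemma holomorphic_theta_prod:
  assumes t: "Im t > 0"
  shows "theta_prod t holomorphic_on UNIV"
proof -
  have "norm (cexp1 t) < 1" using t by (rule norm_cexp1_less_1)
  then show ?thesis
    unfolding theta_prod_def by (intro holomorphic_intros holomorphic_qpoch) auto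
qed

definition euler_prod :: "complex \<Rightarrow> complex" where
  "euler_prod q = qpoch q q"

lemma euler_prod_nonzero:
  assumes "norm q < 1" shows "euler_prod q \<noteq> 0"
proof
  assume "euler_prod q = 0"
  then obtain n where "q ^ Suc n = 1"
    using qpoch_eq_0_iff[OF assms, of q] by (auto simp: euler_prod_def)
  then have "norm q ^ Suc n = 1"
    by (metis norm_one norm_power)
  then show False
    using assms power_less_one_iff[of "norm q" "Suc n"] by simp
qed

text \<open>This is the derivative at the zero w = 0. Through it the Euler product, and with it eta,
  enters the inversion formula.\<close>

lemma theta_prod_limit:
  assumes t: "Im t > 0"
  shows "(\<lambda>w. theta_prod t w / w) \<midarrow>0\<rightarrow> 2 * of_real pi * euler_prod (cexp1 t) ^ 2"
proof -
  define Q where "Q = (\<lambda>w. qpoch (cexp1 (t + w)) (cexp1 t) * qpoch (cexp1 (t - w)) (cexp1 t))"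
  have "norm (cexp1 t) < 1" using t by (rule norm_cexp1_less_1)
  then have "Q holomorphic_on UNIV"
    unfolding Q_def by (intro holomorphic_intros holomorphic_qpoch) auto
  then have "isCont Q 0"
    by (metis continuous_on_eq_continuous_at holomorphic_on_imp_continuous_on open_UNIV UNIV_I)
  then have Q: "Q \<midarrow>0\<rightarrow> euler_prod (cexp1 t) ^ 2"
    by (simp add: isCont_def Q_def euler_prod_def power2_eq_square)
  have "((\<lambda>w. 2 * sin (complex_of_real pi * w)) has_field_derivative 2 * of_real pi) (at 0)"
    by (auto intro!: derivative_eq_intros)
  then have "(\<lambda>w. 2 * sin (complex_of_real pi * w) / w) \<midarrow>0\<rightarrow> 2 * of_real pi"
    by (simp add: has_field_derivative_iff)
  from tendsto_mult[OF this Q] show ?thesis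
    by (simp add: theta_prod_def Q_def mult_ac)
qed

section \<open>Elliptic functions and inversion of the theta product\<close>

definition period_lattice :: "complex \<Rightarrow> complex set" where
  "period_lattice t = {of_int m + of_int n * t | m n :: int. True}"

lemma lattice_diff: "x \<in> period_lattice t \<Longrightarrow> y \<in> period_lattice t \<Longrightarrow> x - y \<in> period_lattice t"
proof -
  assume "x \<in> period_lattice t" "y \<in> period_lattice t"
  then obtain m n m' n' :: int where "x = of_int m + of_int n * t" "y = of_int m' + of_int n' * t"
    by (auto simp: period_lattice_def)
  then have "x - y = of_int (m - m') + of_int (n - n') * t"
    by (simp add: algebra_simps)
  then show ?thesis unfolding period_lattice_def by blast
qed

lemma zero_in_lattice: "0 \<in> period_lattice t"
proof -
  have "0 = of_int 0 + of_int 0 * t" by simp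
  then show ?thesis unfolding period_lattice_def by blast
qed

lemma lattice_shift_iff: "l \<in> period_lattice t \<Longrightarrow> w + l \<in> period_lattice t \<longleftrightarrow> w \<in> period_lattice t"
  using lattice_diff[of "w + l" t l] lattice_diff[of w t "0 - l"] lattice_diff[of 0 t l] zero_in_lattice[of t]
  by auto

lemma period_one_in_lattice: "1 \<in> period_lattice t"
proof -
  have "1 = of_int 1 + of_int 0 * t" by simp
  then show ?thesis unfolding period_lattice_def by blast
qed

lemma period_in_lattice: "t \<in> period_lattice t"
proof -
  have "t = of_int 0 + of_int 1 * t" by simp
  then show ?thesis unfolding period_lattice_def by blast
qed

lemma int_periodic:
  fixes f :: "complex \<Rightarrow> complex"
  assumes "\<And>w. f (w + p) = f w"
  shows "f (w + of_int n * p) = f w"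
proof (induction n rule: int_induct[where k = 0])
  case (step1 i)
  then show ?case using assms[of "w + of_int i * p"] by (simp add: algebra_simps)
next
  case (step2 i)
  then show ?case using assms[of "w + of_int (i - 1) * p"] by (simp add: algebra_simps)
qed auto

text \<open>Periodicity brings every value into the image of the compact period parallelogram, so
  Liouville's theorem applies.\<close>

lemma elliptic_constant:
  assumes t: "Im t > 0" and hol: "f holomorphic_on UNIV"
    and "\<And>w. f (w + 1) = f w" "\<And>w. f (w + t) = f w"
  shows "f constant_on UNIV"
proof (rule Liouville_theorem[OF hol])
  let ?K = "(\<lambda>(x, y). of_real x + of_real y * t) ` (cbox (0::real) 1 \<times> cbox (0::real) 1)"
  have "compact ?K"
    unfolding case_prod_unfold
    by (intro compact_continuous_image compact_Times compact_cbox continuous_intros)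
  then have "bounded (f ` ?K)"
    using continuous_on_subset[OF holomorphic_on_imp_continuous_on[OF hol] subset_UNIV]
    by (intro compact_imp_bounded compact_continuous_image[of _ f])
  moreover have "f w \<in> f ` ?K" for w
  proof -
    define y x where "y = Im w / Im t" and "x = Re w - y * Re t"
    have w: "w = of_real x + of_real y * t"
      using t by (simp add: complex_eq_iff x_def y_def)
    let ?v = "of_real (frac x) + of_real (frac y) * t"
    have "f w = f (?v + of_int \<lfloor>y\<rfloor> * t + of_int \<lfloor>x\<rfloor> * 1)"
      unfolding w by (rule arg_cong[of _ _ f]) (simp add: frac_def algebra_simps)
    also have "\<dots> = f ?v"
      by (simp only: int_periodic[of f 1, OF assms(3)] int_periodic[of f t, OF assms(4)])
    also have "?v \<in> ?K"
      by (force simp: frac_lt_1 less_imp_le)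
    ultimately show ?thesis by blast
  qed
  ultimately show "bounded (range f)"
    by (metis bounded_subset image_subsetI)
qed

lemma Im_neg_inverse_pos: "Im t > 0 \<Longrightarrow> Im (- 1 / t) > 0"
proof -
  assume "Im t > 0"
  then have "(Re t)\<^sup>2 + (Im t)\<^sup>2 > 0" by (simp add: add_nonneg_pos)
  with \<open>Im t > 0\<close> show ?thesis by (simp add: Im_divide)
qed

text \<open>Multiplied by the Gaussian factor, the theta product for -1/t acquires the quasi-periods
  of the one for \<open>t\<close>, and the zeros agree; the quotient is elliptic and entire, hence
  constant. The constant \<open>k\<close> is the ratio of the derivatives at 0.\<close>

theorem theta_prod_inversion:
  fixes t :: complex
  assumes t: "Im t > 0"
  defines "k \<equiv> euler_prod (cexp1 (- 1 / t)) ^ 2 / (t * euler_prod (cexp1 t) ^ 2)"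
  shows "theta_prod (- 1 / t) (w / t) * exp (- of_real pi * \<i> * w\<^sup>2 / t) = k * theta_prod t w"
proof -
  define s where "s = - 1 / t"
  have s: "Im s > 0" using Im_neg_inverse_pos[OF t] by (simp add: s_def)
  have [simp]: "t \<noteq> 0" using t by auto
  define T where "T = (\<lambda>w. theta_prod s (w / t) * exp (- of_real pi * \<i> * w\<^sup>2 / t))"
  \<comment> \<open>The value \<open>k\<close> at lattice points fills the removable singularities.
    Only the one at 0 is examined; translation by lattice points (\<open>RL\<close>) carries
    differentiability to the others.\<close>
  define R where "R = (\<lambda>w. if w \<in> period_lattice t then k else T w / theta_prod t w)"
  have zero: "theta_prod t w = 0 \<longleftrightarrow> w \<in> period_lattice t" for w
    using theta_prod_eq_0_iff[OF t] by (auto simp: period_lattice_def)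
  have T1: "T (w + 1) = - T w" for w
  proof -
    have "theta_prod s (w / t) = - cexp1 (- s / 2) * cexp1 (- ((w + 1) / t)) * theta_prod s ((w + 1) / t)"
      using theta_prod_add_period[OF s, of "(w + 1) / t"] by (simp add: s_def add_divide_distrib)
    moreover have "exp (- of_real pi * \<i> * w\<^sup>2 / t) * (cexp1 (- s / 2) * cexp1 (- ((w + 1) / t)))
      = exp (- of_real pi * \<i> * (w + 1)\<^sup>2 / t)"
      unfolding cexp1_def exp_add [symmetric]
      by (rule arg_cong[of _ _ exp]) (simp add: s_def field_simps power2_eq_square)
    ultimately show ?thesis
      by (simp add: T_def mult_ac)
  qed
  have T2: "T (w + t) = - cexp1 (- t / 2) * cexp1 (- w) * T w" for w
  proof -
    have "theta_prod s ((w + t) / t) = - theta_prod s (w / t)"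
      using theta_prod_add_1[of s "w / t"] by (simp add: add_divide_distrib)
    moreover have "exp (- of_real pi * \<i> * (w + t)\<^sup>2 / t)
      = cexp1 (- t / 2) * cexp1 (- w) * exp (- of_real pi * \<i> * w\<^sup>2 / t)"
      unfolding cexp1_def exp_add [symmetric]
      by (rule arg_cong[of _ _ exp]) (simp add: field_simps power2_eq_square)
    ultimately show ?thesis
      by (simp add: T_def mult_ac)
  qed
  have R1: "R (w + 1) = R w" for w
    using T1[of w] theta_prod_add_1[of t w] lattice_shift_iff[OF period_one_in_lattice]
    by (simp add: R_def)
  have R2: "R (w + t) = R w" for w
    using T2[of w] theta_prod_add_period[OF t, of w] lattice_shift_iff[OF period_in_lattice]
    by (simp add: R_def)
  have RL: "R (w + l) = R w" if l: "l \<in> period_lattice t" for w l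
  proof -
    obtain m n where l: "l = of_int m + of_int n * t"
      using l by (auto simp: period_lattice_def)
    have "R (w + l) = R (w + of_int n * t + of_int m * 1)"
      by (simp add: l add_ac)
    also have "\<dots> = R w"
      by (simp only: int_periodic[of R 1, OF R1] int_periodic[of R t, OF R2])
    finally show ?thesis .
  qed
  have holT: "T holomorphic_on UNIV"
  proof -
    have "theta_prod s \<circ> (\<lambda>w. w / t) holomorphic_on UNIV"
      by (rule holomorphic_on_compose_gen[OF _ holomorphic_theta_prod[OF s]])
         (auto intro!: holomorphic_intros)
    then show ?thesis
      unfolding T_def by (intro holomorphic_intros) (auto simp: o_def)
  qed
  have op: "open (UNIV - period_lattice t)"
  proof -
    have "open {w. theta_prod t w \<noteq> 0}"
      using holomorphic_on_imp_continuous_on[OF holomorphic_theta_prod[OF t]]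
      by (intro open_Collect_neq continuous_intros) auto
    moreover have "{w. theta_prod t w \<noteq> 0} = UNIV - period_lattice t"
      using zero by blast
    ultimately show ?thesis by simp
  qed
  have "(\<lambda>w. T w / theta_prod t w) holomorphic_on (UNIV - period_lattice t)"
    using holT holomorphic_theta_prod[OF t] zero
    by (intro holomorphic_on_divide) (auto intro: holomorphic_on_subset)
  then have holR: "R holomorphic_on (UNIV - period_lattice t)"
    by (rule holomorphic_transform) (simp add: R_def)
  have nz: "2 * of_real pi * euler_prod (cexp1 t) ^ 2 \<noteq> 0"
    using euler_prod_nonzero[OF norm_cexp1_less_1[OF t]] by simp
  have lim: "(\<lambda>w. T w / theta_prod t w) \<midarrow>0\<rightarrow> k"
  proof -
    have "filterlim (\<lambda>w. w / t) (at 0) (at 0)"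
      by (rule filterlim_atI) (auto intro!: tendsto_eq_intros simp: eventually_at_filter)
    from filterlim_compose[OF theta_prod_limit[OF s] this]
    have "((\<lambda>w. (theta_prod s (w / t) / (w / t)) * exp (- of_real pi * \<i> * w\<^sup>2 / t) / t) \<longlongrightarrow>
       2 * of_real pi * euler_prod (cexp1 s) ^ 2 * exp (- of_real pi * \<i> * 0\<^sup>2 / t) / t) (at 0)"
      by (rule tendsto_divide[OF tendsto_mult]) (auto intro!: tendsto_eq_intros)
    then have "(\<lambda>w. (theta_prod s (w / t) / (w / t)) * exp (- of_real pi * \<i> * w\<^sup>2 / t) / t / (theta_prod t w / w))
       \<midarrow>0\<rightarrow> 2 * of_real pi * euler_prod (cexp1 s) ^ 2 * exp (- of_real pi * \<i> * 0\<^sup>2 / t) / t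
        / (2 * of_real pi * euler_prod (cexp1 t) ^ 2)"
      by (rule tendsto_divide[OF _ theta_prod_limit[OF t] nz])
    also have "2 * of_real pi * euler_prod (cexp1 s) ^ 2 * exp (- of_real pi * \<i> * 0\<^sup>2 / t) / t
        / (2 * of_real pi * euler_prod (cexp1 t) ^ 2) = k"
      using nz by (simp add: k_def s_def field_simps)
    finally show ?thesis
      by (rule Lim_transform_eventually) (auto simp: eventually_at_filter T_def)
  qed
  have ev: "eventually (\<lambda>w. theta_prod t w \<noteq> 0) (at 0)"
  proof -
    have "eventually (\<lambda>w. theta_prod t w / w \<noteq> 0) (at 0)"
      by (rule tendsto_imp_eventually_ne[OF theta_prod_limit[OF t] nz])
    then show ?thesis by eventually_elim auto
  qed
  obtain r where r: "r > 0" "\<And>w. w \<noteq> 0 \<Longrightarrow> dist w 0 < r \<Longrightarrow> theta_prod t w \<noteq> 0"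
    using ev unfolding eventually_at by auto
  have "R holomorphic_on ball 0 r"
  proof (rule no_isolated_singularity'[where K = "{0}"])
    fix z :: complex assume "z \<in> {0}"
    have "R \<midarrow>0\<rightarrow> k"
      by (rule Lim_transform_eventually[OF lim]) (use ev zero in \<open>auto elim!: eventually_mono simp: R_def\<close>)
    then show "(R \<longlongrightarrow> R z) (at z within ball 0 r)"
      using \<open>z \<in> {0}\<close> zero_in_lattice[of t] by (auto simp: R_def intro: tendsto_within_subset)
  next
    show "R holomorphic_on ball 0 r - {0}"
      using r zero by (intro holomorphic_on_subset[OF holR]) (auto simp: dist_commute)
  qed auto
  then have R0: "R field_differentiable (at 0)"
    using r by (simp add: holomorphic_on_imp_differentiable_at)
  have "R field_differentiable (at w)" for w
  proof (cases "w \<in> period_lattice t")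
    case True
    have "R \<circ> (\<lambda>v. v - w) field_differentiable (at w)"
      by (rule field_differentiable_compose) (use R0 in \<open>auto intro!: derivative_intros\<close>)
    moreover have "R \<circ> (\<lambda>v. v - w) = R"
      using RL[OF True, of "v - w" for v] by (auto simp: fun_eq_iff)
    ultimately show ?thesis by simp
  next
    case False
    then show ?thesis
      using holomorphic_on_imp_differentiable_at[OF holR op] by auto
  qed
  then have "R holomorphic_on UNIV"
    by (auto simp: holomorphic_on_def intro: field_differentiable_at_within)
  then have "R constant_on UNIV"
    using elliptic_constant[OF t] R1 R2 by blast
  then have "R w = R 0"
    by (auto simp: constant_on_def)
  then have R: "R w = k"
    using zero_in_lattice[of t] by (simp add: R_def)
  have "T w = k * theta_prod t w"
  proof (cases "w \<in> period_lattice t")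
    case False
    then show ?thesis using R zero[of w] by (auto simp: R_def field_simps)
  next
    case True
    then obtain m n :: int where w: "w = of_int m + of_int n * t"
      by (auto simp: period_lattice_def)
    have "w / t = of_int n + of_int (- m) * s"
      by (simp add: w s_def field_simps)
    then have "theta_prod s (w / t) = 0"
      using theta_prod_eq_0_iff[OF s] by blast
    then show ?thesis using True zero by (simp add: T_def)
  qed
  then show ?thesis by (simp add: T_def s_def)
qed

section \<open>Half periods and the inversion of eta\<close>

lemma qpoch_mult_minus:
  assumes "norm q < 1"
  shows "qpoch x q * qpoch (- x) q = qpoch (x\<^sup>2) (q\<^sup>2)"
proof -
  have q2: "norm (q\<^sup>2) < 1"
    using assms by (simp add: norm_power power_less_one_iff)
  have "(\<lambda>N. (\<Prod>n<N. 1 - x * q ^ n) * (\<Prod>n<N. 1 - (- x) * q ^ n)) \<longlonglongrightarrow> qpoch x q * qpoch (- x) q"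
    by (intro tendsto_mult qpoch_LIMSEQ assms)
  moreover have "(\<Prod>n<N. 1 - x * q ^ n) * (\<Prod>n<N. 1 - (- x) * q ^ n) = (\<Prod>n<N. 1 - x\<^sup>2 * (q\<^sup>2) ^ n)" for N
    unfolding prod.distrib [symmetric]
    by (intro prod.cong) (auto simp: algebra_simps power2_eq_square power_mult_distrib)
  ultimately show ?thesis
    using qpoch_LIMSEQ[OF q2, of "x\<^sup>2"] LIMSEQ_unique by simp
qed

lemma qpoch_bisect:
  assumes "norm q < 1"
  shows "qpoch x q = qpoch x (q\<^sup>2) * qpoch (x * q) (q\<^sup>2)"
proof -
  have q2: "norm (q\<^sup>2) < 1"
    using assms by (simp add: norm_power power_less_one_iff)
  have "(\<lambda>N. (\<Prod>n<N. 1 - x * (q\<^sup>2) ^ n) * (\<Prod>n<N. 1 - (x * q) * (q\<^sup>2) ^ n)) \<longlonglongrightarrow> qpoch x (q\<^sup>2) * qpoch (x * q) (q\<^sup>2)"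
    by (intro tendsto_mult qpoch_LIMSEQ q2)
  moreover have "(\<Prod>n<N. 1 - x * (q\<^sup>2) ^ n) * (\<Prod>n<N. 1 - (x * q) * (q\<^sup>2) ^ n) = (\<Prod>n<2*N. 1 - x * q ^ n)" for N
    by (induction N) (simp_all add: power_mult [symmetric] mult_ac)
  moreover have "(\<lambda>N. \<Prod>n<2*N. 1 - x * q ^ n) \<longlonglongrightarrow> qpoch x q"
    using LIMSEQ_subseq_LIMSEQ[OF qpoch_LIMSEQ[OF assms], of "\<lambda>N. 2 * N"]
    by (simp add: o_def strict_mono_def)
  ultimately show ?thesis
    using LIMSEQ_unique by simp
qed

text \<open>Euler's identity between partitions into odd and into distinct parts. With q =
  \<open>h\<^sup>2\<close>, the product (q; q) splits into (q; q^2) = (h; q)(-h; q) and (q^2; q^2) =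
  (q; q)(-q; q), and (q; q) cancels.\<close>

lemma qpoch_euler:
  assumes h: "norm h < 1"
  shows "qpoch (- (h\<^sup>2)) (h\<^sup>2) * qpoch h (h\<^sup>2) * qpoch (- h) (h\<^sup>2) = 1"
proof -
  define q where "q = h\<^sup>2"
  have q: "norm q < 1"
    using assms by (simp add: q_def norm_power power_less_one_iff)
  have "euler_prod q = qpoch q (q\<^sup>2) * qpoch (q\<^sup>2) (q\<^sup>2)"
    using qpoch_bisect[OF q, of q] by (simp add: euler_prod_def power2_eq_square)
  moreover have "qpoch q (q\<^sup>2) = qpoch h q * qpoch (- h) q"
    using qpoch_mult_minus[OF q, of h] by (simp add: q_def)
  moreover have "qpoch (q\<^sup>2) (q\<^sup>2) = euler_prod q * qpoch (- q) q"
    using qpoch_mult_minus[OF q, of q] by (simp add: euler_prod_def)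
  ultimately show ?thesis
    using euler_prod_nonzero[OF q] by (simp add: q_def mult_ac)
qed

lemma cexp1_half: "cexp1 (1 / 2) = - 1"
  by (simp add: cexp1_def)

lemma cexp1_quarter: "cexp1 (1 / 4) = \<i>"
proof -
  have "2 * complex_of_real pi * \<i> * (1 / 4) = \<i> * of_real (pi / 2)" by simp
  then show ?thesis unfolding cexp1_def by (simp only: cis_conv_exp [symmetric]) simp
qed

text \<open>Corresponds to theta_2 theta_3 theta_4 in Jacobi's notation. Up to an elementary factor,
  each value is the square of one of the three products in \<open>qpoch_euler\<close>, so the
  infinite products cancel and an exponential remains.\<close>

lemma theta_prod_half_periods:
  assumes t: "Im t > 0"
  shows "theta_prod t (1 / 2) * theta_prod t (t / 2) * theta_prod t ((1 + t) / 2) = 2 * \<i> * cexp1 (- t / 2)"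
proof -
  define b h q where "b = cexp1 (t / 4)" and "h = cexp1 (t / 2)" and "q = cexp1 t"
  have [simp]: "b \<noteq> 0" "h \<noteq> 0" by (simp_all add: b_def h_def)
  have bh: "b * b = h" and hq: "h * h = q"
    unfolding b_def h_def q_def cexp1_add [symmetric] by (rule arg_cong[of _ _ cexp1], simp)+
  have h: "norm h < 1" and q: "norm q < 1"
    unfolding h_def q_def using t by (auto intro!: norm_cexp1_less_1)
  have half_minus: "cexp1 (- (1 / 2)) = - 1"
    by (simp only: cexp1_minus cexp1_half) simp
  have "theta_prod t (1 / 2) = 2 * qpoch (- q) q ^ 2"
  proof -
    have "sin (complex_of_real pi * (1 / 2)) = 1"
      using sin_of_real[of "pi / 2"] by simp
    moreover have "cexp1 (t + 1 / 2) = - q" "cexp1 (t - 1 / 2) = - q"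
      using cexp1_add[of t "1 / 2"] cexp1_add[of t "- (1 / 2)"] half_minus cexp1_half by (simp_all add: q_def)
    ultimately show ?thesis by (simp add: theta_prod_def power2_eq_square q_def)
  qed
  moreover have "theta_prod t (t / 2) = \<i> * inverse b * qpoch h q ^ 2"
  proof -
    have 1: "qpoch h q = (1 - h) * qpoch (h * q) q" by (rule qpoch_rec[OF q])
    have 2: "2 * sin (of_real pi * (t / 2)) = - \<i> * (b - inverse b)"
      using sin_cexp1[of "t / 2"] by (simp add: b_def)
    have 3: "cexp1 (t + t / 2) = h * q" "cexp1 (t - t / 2) = h"
      using cexp1_add[of t "t / 2"] by (simp_all add: h_def q_def)
    have "theta_prod t (t / 2) = - \<i> * (b - inverse b) * qpoch (h * q) q * qpoch h q"
      unfolding theta_prod_def 2 3 q_def [symmetric] ..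
    also have "- \<i> * (b - inverse b) = \<i> * inverse b * (1 - h)"
      by (simp add: bh [symmetric] field_simps)
    finally show ?thesis by (simp add: 1 power2_eq_square)
  qed
  moreover have "theta_prod t ((1 + t) / 2) = inverse b * qpoch (- h) q ^ 2"
  proof -
    have 1: "qpoch (- h) q = (1 - - h) * qpoch (- h * q) q" by (rule qpoch_rec[OF q])
    have "cexp1 ((1 + t) / 2 / 2) = \<i> * b"
      using cexp1_add[of "1 / 4" "t / 4"] cexp1_quarter by (simp add: b_def add_divide_distrib)
    then have 2: "2 * sin (of_real pi * ((1 + t) / 2)) = - \<i> * (\<i> * b - inverse (\<i> * b))"
      using sin_cexp1[of "(1 + t) / 2"] by simp
    have "cexp1 (t + (1 + t) / 2) = cexp1 t * cexp1 (1 / 2) * cexp1 (t / 2)"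
      "cexp1 (t - (1 + t) / 2) = cexp1 (- (1 / 2)) * cexp1 (t / 2)"
      unfolding cexp1_add [symmetric] by (rule arg_cong[of _ _ cexp1], simp add: field_simps)+
    then have 3: "cexp1 (t + (1 + t) / 2) = - h * q" "cexp1 (t - (1 + t) / 2) = - h"
      unfolding half_minus cexp1_half by (simp_all add: h_def q_def)
    have "theta_prod t ((1 + t) / 2) = - \<i> * (\<i> * b - inverse (\<i> * b)) * qpoch (- h * q) q * qpoch (- h) q"
      unfolding theta_prod_def 2 3 q_def [symmetric] ..
    also have "- \<i> * (\<i> * b - inverse (\<i> * b)) = inverse b * (1 - - h)"
      by (simp add: bh [symmetric] field_simps)
    finally show ?thesis by (simp add: 1 power2_eq_square)
  qed
  ultimately have "theta_prod t (1 / 2) * theta_prod t (t / 2) * theta_prod t ((1 + t) / 2)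
    = 2 * \<i> * inverse (b * b) * (qpoch (- q) q * qpoch h q * qpoch (- h) q) ^ 2"
    by (simp add: power2_eq_square mult_ac)
  also have "qpoch (- q) q * qpoch h q * qpoch (- h) q = 1"
    using qpoch_euler[OF h] hq by (simp add: power2_eq_square)
  also have "inverse (b * b) = cexp1 (- t / 2)"
    using cexp1_minus[of "t / 2"] by (simp add: bh h_def)
  finally show ?thesis by simp
qed

text \<open>The square of Dedekind's eta function, hence z/12 instead of z/24. Its weight is 1, so
  no branch of a square root appears in the transformation laws.\<close>

definition eta_sq :: "complex \<Rightarrow> complex" where
  "eta_sq z = cexp1 (z / 12) * euler_prod (cexp1 z) ^ 2"

lemma eta_sq_nonzero: "Im z > 0 \<Longrightarrow> eta_sq z \<noteq> 0"
  using euler_prod_nonzero[OF norm_cexp1_less_1] by (simp add: eta_sq_def)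

lemma holomorphic_euler_prod [holomorphic_intros]:
  assumes "f holomorphic_on S" "open S" "\<And>z. z \<in> S \<Longrightarrow> norm (f z) < 1"
  shows "(\<lambda>z. euler_prod (f z)) holomorphic_on S"
  unfolding euler_prod_def using assms by (intro holomorphic_qpoch)

lemma holomorphic_eta_sq:
  assumes "f holomorphic_on S" "open S" "\<And>z. z \<in> S \<Longrightarrow> Im (f z) > 0"
  shows "(\<lambda>z. eta_sq (f z)) holomorphic_on S"
  unfolding eta_sq_def using assms by (intro holomorphic_intros norm_cexp1_less_1) auto

text \<open>The derivative at 0 expresses the factor of the theta inversion through Euler products, and the product over
  the three half periods evaluates its cube.\<close>
lemma eta_sq_ratio_cubed:
  assumes t: "Im t > 0"
  shows "(eta_sq (- 1 / t) / (t * eta_sq t)) ^ 3 = \<i>"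
proof -
  define s k where "s = - 1 / t" and "k = euler_prod (cexp1 (- 1 / t)) ^ 2 / (t * euler_prod (cexp1 t) ^ 2)"
  have [simp]: "t \<noteq> 0" using t by auto
  have s: "Im s > 0" using Im_neg_inverse_pos[OF t] by (simp add: s_def)
  have inv: "theta_prod s (w / t) * exp (- of_real pi * \<i> * w\<^sup>2 / t) = k * theta_prod t w" for w
    using theta_prod_inversion[OF t] by (simp add: s_def k_def)
  have cancel: "x * b = - (a * e)" if "- (2 * \<i> * a) * e = x * (2 * \<i> * b)" for a b e x :: complex
  proof -
    have "(2 * \<i>) * (x * b) = (2 * \<i>) * (- (a * e))"
      using that by (simp only: mult_ac mult_minus_left mult_minus_right)
    then show ?thesis by (simp only: mult_cancel_left) simp
  qed
  \<comment> \<open>Inversion permutes the half periods: 1/2, t/2 and (1 + t)/2 go to s/2, 1/2 and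
    (1 + s)/2, up to signs and an integer shift.\<close>
  have f1: "theta_prod s ((1 / 2) / t) = - theta_prod s (s / 2)"
  proof -
    have "(1 / 2) / t = - (s / 2)" by (simp add: s_def)
    then show ?thesis by (simp only: theta_prod_minus)
  qed
  have f2: "theta_prod s ((t / 2) / t) = theta_prod s (1 / 2)"
    by simp
  have f3: "theta_prod s (((1 + t) / 2) / t) = theta_prod s ((1 + s) / 2)"
  proof -
    have "((1 + t) / 2) / t = - ((s - 1) / 2)" "(1 + s) / 2 = (s - 1) / 2 + 1"
      by (simp_all add: s_def field_simps)
    then show ?thesis by (simp only: theta_prod_minus theta_prod_add_1)
  qed
  define E where "E w = exp (- of_real pi * \<i> * w\<^sup>2 / t)" for w
  have "(theta_prod s ((1 / 2) / t) * E (1 / 2)) * (theta_prod s ((t / 2) / t) * E (t / 2)) *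
     (theta_prod s (((1 + t) / 2) / t) * E ((1 + t) / 2))
     = (k * theta_prod t (1 / 2)) * (k * theta_prod t (t / 2)) * (k * theta_prod t ((1 + t) / 2))"
    unfolding E_def inv ..
  then have "- (theta_prod s (1 / 2) * theta_prod s (s / 2) * theta_prod s ((1 + s) / 2)) *
      (exp (- of_real pi * \<i> * (1 / 2)\<^sup>2 / t) * exp (- of_real pi * \<i> * (t / 2)\<^sup>2 / t)
        * exp (- of_real pi * \<i> * ((1 + t) / 2)\<^sup>2 / t))
    = k ^ 3 * (theta_prod t (1 / 2) * theta_prod t (t / 2) * theta_prod t ((1 + t) / 2))"
    unfolding f1 f2 f3 E_def [symmetric] power3_eq_cube by (simp only: mult_ac mult_minus_left mult_minus_right)
  then have "k ^ 3 * cexp1 (- t / 2) = - (cexp1 (- s / 2) *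
      (exp (- of_real pi * \<i> * (1 / 2)\<^sup>2 / t) * exp (- of_real pi * \<i> * (t / 2)\<^sup>2 / t)
        * exp (- of_real pi * \<i> * ((1 + t) / 2)\<^sup>2 / t)))"
    unfolding theta_prod_half_periods[OF t] theta_prod_half_periods[OF s] by (rule cancel)
  \<comment> \<open>The new factor turns the left side into the cube of the eta quotient: the
    prefactors e(s/12) and e(-t/12) have cubes e(s/4) and e(-t/4) = e(-t/2) e(t/4). On the right all
    exponents then add up to the constant -1/4.\<close>
  then have "(k ^ 3 * cexp1 (- t / 2)) * (cexp1 (s / 4) * cexp1 (t / 4)) = - (cexp1 (- s / 2) *
      (exp (- of_real pi * \<i> * (1 / 2)\<^sup>2 / t) * exp (- of_real pi * \<i> * (t / 2)\<^sup>2 / t)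
        * exp (- of_real pi * \<i> * ((1 + t) / 2)\<^sup>2 / t))) * (cexp1 (s / 4) * cexp1 (t / 4))"
    by simp
  also have "\<dots> = - (cexp1 (- s / 2) *
      (exp (- of_real pi * \<i> * (1 / 2)\<^sup>2 / t) * exp (- of_real pi * \<i> * (t / 2)\<^sup>2 / t)
        * exp (- of_real pi * \<i> * ((1 + t) / 2)\<^sup>2 / t)) * (cexp1 (s / 4) * cexp1 (t / 4)))"
    by (simp only: mult_minus_left)
  also have "\<dots> = - cexp1 (- (1 / 4))"
    unfolding cexp1_def exp_add [symmetric]
    by (rule arg_cong[of _ _ "\<lambda>x. - exp x"]) (simp add: s_def field_simps power2_eq_square)
  also have "\<dots> = \<i>"
    unfolding cexp1_minus cexp1_quarter by simp
  finally have *: "(k ^ 3 * cexp1 (- t / 2)) * (cexp1 (s / 4) * cexp1 (t / 4)) = \<i>" .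
  have "eta_sq (- 1 / t) / (t * eta_sq t) = cexp1 (s / 12) * cexp1 (- (t / 12)) * k"
    by (simp add: eta_sq_def k_def cexp1_minus s_def field_simps)
  then have "(eta_sq (- 1 / t) / (t * eta_sq t)) ^ 3 = cexp1 (s / 12) ^ 3 * cexp1 (- (t / 12)) ^ 3 * k ^ 3"
    by (simp add: power_mult_distrib)
  also have "\<dots> = (k ^ 3 * cexp1 (- t / 2)) * (cexp1 (s / 4) * cexp1 (t / 4))"
  proof -
    have "cexp1 (s / 12) ^ 3 * cexp1 (- (t / 12)) ^ 3 = cexp1 (- t / 2) * (cexp1 (s / 4) * cexp1 (t / 4))"
      unfolding cexp1_of_nat_mult [symmetric] cexp1_add [symmetric]
      by (rule arg_cong[of _ _ cexp1]) simp
    then show ?thesis by (simp only: mult_ac)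
  qed
  finally show ?thesis using * by simp
qed

text \<open>The quotient is continuous on the connected half plane and, by the formula for its cube,
  has finitely many values, so it is constant. The fixed point \<i> of the inversion singles out the
  cube root.\<close>

theorem eta_sq_inversion:
  assumes t: "Im t > 0"
  shows "eta_sq (- 1 / t) = - \<i> * t * eta_sq t"
proof -
  let ?r = "\<lambda>t. eta_sq (- 1 / t) / (t * eta_sq t)"
  let ?H = "{z. Im z > 0}"
  have op: "open ?H" by (simp add: open_halfspace_Im_gt)
  have nz: "z \<noteq> 0" if "z \<in> ?H" for z using that by auto
  have hol: "(\<lambda>z. eta_sq (- 1 / z)) holomorphic_on ?H"
    using op nz Im_neg_inverse_pos by (intro holomorphic_eta_sq holomorphic_intros) auto
  have hol2: "eta_sq holomorphic_on ?H"
    using op holomorphic_eta_sq[of "\<lambda>z. z"] by auto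
  have "?r holomorphic_on ?H"
    using nz eta_sq_nonzero by (intro holomorphic_on_divide hol holomorphic_on_mult hol2) auto
  then have "continuous_on ?H ?r" by (rule holomorphic_on_imp_continuous_on)
  moreover have "finite (?r ` ?H)"
  proof (rule finite_subset)
    show "?r ` ?H \<subseteq> {x. x ^ 3 = \<i>}"
      using eta_sq_ratio_cubed by auto
    have "[:- \<i>, 0, 0, 1:] \<noteq> 0" by simp
    from poly_roots_finite[OF this] show "finite {x. x ^ 3 = \<i>}"
      by (simp add: power3_eq_cube algebra_simps)
  qed
  ultimately have "?r constant_on ?H"
    using convex_halfspace_Im_gt[of 0] by (intro continuous_finite_range_constant convex_connected) auto
  then have "?r t = ?r \<i>"
    using t unfolding constant_on_def by (metis (mono_tags, lifting) mem_Collect_eq imaginary_unit.simps(2) zero_less_one)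
  moreover have "- 1 / \<i> = \<i>"
    by (simp add: field_simps)
  then have "?r \<i> = - \<i>"
    using eta_sq_nonzero[of \<i>] by (simp only:) (simp add: field_simps)
  ultimately have "eta_sq (- 1 / t) / (t * eta_sq t) = - \<i>" by simp
  moreover have "t * eta_sq t \<noteq> 0"
    using eta_sq_nonzero[OF t] t by auto
  ultimately show ?thesis
    by (simp add: nonzero_divide_eq_eq)
qed

lemma eta_sq_add_1: "eta_sq (z + 1) = cexp1 (1 / 12) * eta_sq z"
  using cexp1_of_int[of 1] by (simp add: eta_sq_def cexp1_add add_divide_distrib)

section \<open>Modular forms of weight 4 from eta quotients\<close>

text \<open>Dedekind's formula for the multiplier of the square of the eta function, as a twelfth root of unity; only the class
  modulo 12 matters, so the Jacobi symbol in the multiplier of eta itself drops out.\<close>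
definition eta_exponent :: "int \<Rightarrow> int \<Rightarrow> int \<Rightarrow> int \<Rightarrow> int" where
  "eta_exponent a b c d = (a + d) * c - b * d * (c\<^sup>2 - 1)
     + (if even c then 3 * d - 3 - 3 * c * d else - 3 * c)"

text \<open>Translation multiplies \<open>eta_sq\<close> by e(1/12), hence the increment 1. The
  difference is checked modulo 4 by the parity of \<open>c\<close> and modulo 3 by the class of
  \<open>c\<close>.\<close>

lemma eta_exponent_T:
  assumes det: "a * d - b * c = 1"
  shows "eta_exponent a (a + b) c (c + d) mod 12 = (eta_exponent a b c d + 1) mod 12"
proof -
  define X where "X = eta_exponent a (a + b) c (c + d) - (eta_exponent a b c d + 1)"
  define r where "r = (if even c then 3 * c - 3 * (c * c) else 0)"
  have X: "X = (c * c - 1) * (1 - a * c - a * d - b * c) + r"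
    by (simp add: X_def r_def eta_exponent_def power2_eq_square algebra_simps)
  have ad: "a * d = 1 + b * c" using det by simp
  have "4 dvd X"
  proof (cases "even c")
    case True
    then obtain k where k: "c = 2 * k" by blast
    have "odd (a * d)" by (simp add: ad k)
    then obtain l where l: "a = 2 * l + 1" by (auto elim: oddE)
    have "X = 4 * ((2 * (k * k)) * (- a * k - 2 * b * k) + b * k + k * (l + 2) - 3 * (k * k))"
      unfolding X ad by (simp add: r_def k l algebra_simps)
    then show ?thesis by simp
  next
    case False
    then obtain k where k: "c = 2 * k + 1" by (auto elim: oddE)
    have "c * c - 1 = 4 * (k * k + k)" by (simp add: k algebra_simps)
    then show ?thesis using False unfolding X r_def by simp
  qed
  moreover have "3 dvd X"
  proof -
    have "3 dvd r" by (simp add: r_def dvd_diff)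
    moreover have "3 dvd (c * c - 1) * (1 - a * c - a * d - b * c)"
    proof -
      have "c mod 3 = 0 \<or> c mod 3 = 1 \<or> c mod 3 = 2" by presburger
      then consider k where "c = 3 * k" | k where "c = 3 * k + 1" | k where "c = 3 * k + 2"
        by (metis mult_div_mod_eq add_0_right)
      then show ?thesis
      proof cases
        case 1
        have "1 - a * c - a * d - b * c = 3 * (- a * k - 2 * b * k)" unfolding ad 1 by simp
        then show ?thesis by simp
      next
        case 2
        have "c * c - 1 = 3 * (3 * k * k + 2 * k)" by (simp add: 2 algebra_simps)
        then show ?thesis by simp
      next
        case 3
        have "c * c - 1 = 3 * (3 * k * k + 4 * k + 1)" by (simp add: 3 algebra_simps)
        then show ?thesis by simp
      qed
    qed
    ultimately show ?thesis by (simp add: X)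
  qed
  ultimately have "4 * 3 dvd X"
    using coprime_add_one_left[of "3::int"] by (intro divides_mult) auto
  then show ?thesis by (simp add: mod_eq_dvd_iff X_def)
qed

text \<open>The factor -\<i> = e(-3/12) of the inversion formula accounts for the -3. Since
  \<open>c\<close> and \<open>d\<close> are not both even, three parity cases remain.\<close>

lemma eta_exponent_S:
  assumes det: "a * d - b * c = 1"
  shows "eta_exponent b (- a) d (- c) mod 12 = (eta_exponent a b c d - 3) mod 12"
proof -
  define X where "X = eta_exponent b (- a) d (- c) - (eta_exponent a b c d - 3)"
  have "X = - 2 * c * d - c * d * (a * d - b * c) + 3
    + (if even d then - 3 * c - 3 + 3 * d * c else - 3 * d) - (if even c then 3 * d - 3 - 3 * c * d else - 3 * c)"
    by (simp add: X_def eta_exponent_def power2_eq_square algebra_simps)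
  then have X: "X = - 3 * c * d + 3
    + (if even d then - 3 * c - 3 + 3 * d * c else - 3 * d) - (if even c then 3 * d - 3 - 3 * c * d else - 3 * c)"
    unfolding det by simp
  have "odd c \<or> odd d"
    using det by (metis dvd_diff dvd_mult even_mult_iff odd_one)
  then consider "odd c" "even d" | k l where "c = 2 * k + 1" "d = 2 * l + 1" | l where "even c" "d = 2 * l + 1"
    by (metis oddE)
  then have "12 dvd X"
  proof cases
    case 1
    then have "X = 0" by (simp add: X)
    then show ?thesis by simp
  next
    case 2
    then have "X = 12 * (- (k + 1) * l)" by (simp add: X algebra_simps)
    then show ?thesis by (metis dvd_triv_left)
  next
    case 3
    then have "X = 12 * (- l)" by (simp add: X algebra_simps)
    then show ?thesis by (metis dvd_triv_left)
  qed
  then show ?thesis by (simp add: mod_eq_dvd_iff X_def)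
qed

lemma cexp1_mod_12:
  assumes "(m::int) mod 12 = n mod 12"
  shows "cexp1 (of_int m / 12) = cexp1 (of_int n / 12)"
proof -
  obtain k where k: "m = n + 12 * k"
    using assms by (metis mod_eqE)
  show ?thesis
    unfolding k using cexp1_of_int[of k] by (simp add: cexp1_add add_divide_distrib)
qed

definition eta_sq_transforms :: "int \<Rightarrow> int \<Rightarrow> int \<Rightarrow> int \<Rightarrow> bool" where
  "eta_sq_transforms a b c d \<longleftrightarrow> (\<forall>z. Im z > 0 \<longrightarrow>
     eta_sq ((of_int a * z + of_int b) / (of_int c * z + of_int d))
       = cexp1 (of_int (eta_exponent a b c d) / 12) * (of_int c * z + of_int d) * eta_sq z)"

lemma moebius_denominator_nonzero:
  assumes "Im z > 0" "a * d - b * c = (1::int)"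
  shows "of_int c * z + of_int d \<noteq> 0"
proof
  assume *: "of_int c * z + of_int d = 0"
  then have "Im (of_int c * z + of_int d) = 0" by (simp only:) simp
  then have "c = 0" using assms by simp
  then show False using * assms by auto
qed

text \<open>An equivalence, because the Euclidean descent has to return from the reduced matrix to
  the original one.\<close>

lemma eta_sq_transforms_T:
  assumes "a * d - b * c = 1"
  shows "eta_sq_transforms a (a + b) c (c + d) \<longleftrightarrow> eta_sq_transforms a b c d"
proof -
  define D where "D = cexp1 (1 / 12)"
  have e: "cexp1 (of_int (eta_exponent a (a + b) c (c + d)) / 12)
      = cexp1 (of_int (eta_exponent a b c d) / 12) * D"
    unfolding cexp1_mod_12[OF eta_exponent_T[OF assms]] by (simp add: add_divide_distrib cexp1_add D_def)
  have m: "(of_int a * z + of_int (a + b)) = of_int a * (z + 1) + of_int b"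
    "(of_int c * z + of_int (c + d)) = of_int c * (z + 1) + of_int d" for z :: complex
    by (simp_all add: algebra_simps)
  have eta: "D * eta_sq z = eta_sq (z + 1)" for z
    by (simp add: eta_sq_add_1 D_def)
  have *: "eta_sq_transforms a (a + b) c (c + d) \<longleftrightarrow> (\<forall>z. Im z > 0 \<longrightarrow>
     eta_sq ((of_int a * (z + 1) + of_int b) / (of_int c * (z + 1) + of_int d))
       = cexp1 (of_int (eta_exponent a b c d) / 12) * (of_int c * (z + 1) + of_int d) * (D * eta_sq z))"
    unfolding eta_sq_transforms_def e m by (simp only: mult_ac)
  show ?thesis
  proof
    assume L: "eta_sq_transforms a (a + b) c (c + d)"
    show "eta_sq_transforms a b c d"
      unfolding eta_sq_transforms_def
    proof (intro allI impI)
      fix z assume "Im z > 0"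
      then have "Im (z - 1) > 0" by simp
      then show "eta_sq ((of_int a * z + of_int b) / (of_int c * z + of_int d))
        = cexp1 (of_int (eta_exponent a b c d) / 12) * (of_int c * z + of_int d) * eta_sq z"
        using L[unfolded * eta, rule_format, of "z - 1"] by simp
    qed
  next
    assume R: "eta_sq_transforms a b c d"
    show "eta_sq_transforms a (a + b) c (c + d)"
      unfolding * eta
    proof (intro allI impI)
      fix z assume "Im z > 0"
      then have "Im (z + 1) > 0" by simp
      then show "eta_sq ((of_int a * (z + 1) + of_int b) / (of_int c * (z + 1) + of_int d))
        = cexp1 (of_int (eta_exponent a b c d) / 12) * (of_int c * (z + 1) + of_int d) * eta_sq (z + 1)"
        using R unfolding eta_sq_transforms_def by blast
    qed
  qed
qed

lemma eta_sq_transforms_S: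
  assumes det: "a * d - b * c = 1" and "eta_sq_transforms a b c d"
  shows "eta_sq_transforms b (- a) d (- c)"
  unfolding eta_sq_transforms_def
proof (intro allI impI)
  fix z :: complex assume z: "Im z > 0"
  then have [simp]: "z \<noteq> 0" by auto
  have 1: "(of_int a * (- 1 / z) + of_int b) / (of_int c * (- 1 / z) + of_int d)
    = (of_int b * z + of_int (- a)) / (of_int d * z + of_int (- c))"
  proof -
    have "(of_int a * (- 1 / z) + of_int b) / (of_int c * (- 1 / z) + of_int d)
      = (z * (of_int a * (- 1 / z) + of_int b)) / (z * (of_int c * (- 1 / z) + of_int d))"
      by (rule mult_divide_mult_cancel_left [symmetric]) simp
    also have "z * (of_int a * (- 1 / z) + of_int b) = of_int b * z + of_int (- a)"
      by (simp add: field_simps)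
    also have "z * (of_int c * (- 1 / z) + of_int d) = of_int d * z + of_int (- c)"
      by (simp add: field_simps)
    finally show ?thesis .
  qed
  have 2: "eta_sq ((of_int a * (- 1 / z) + of_int b) / (of_int c * (- 1 / z) + of_int d))
     = cexp1 (of_int (eta_exponent a b c d) / 12) * (of_int c * (- 1 / z) + of_int d) * eta_sq (- 1 / z)"
    using assms(2) Im_neg_inverse_pos[OF z] unfolding eta_sq_transforms_def by blast
  have 3: "cexp1 (of_int (eta_exponent b (- a) d (- c)) / 12) = cexp1 (of_int (eta_exponent a b c d) / 12) * (- \<i>)"
  proof -
    have "cexp1 (of_int (eta_exponent b (- a) d (- c)) / 12)
      = cexp1 (of_int (eta_exponent a b c d) / 12 + - (1 / 4))"
      unfolding cexp1_mod_12[OF eta_exponent_S[OF det]] by (simp add: diff_divide_distrib)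
    then show ?thesis by (simp only: cexp1_add cexp1_minus cexp1_quarter) simp
  qed
  have 4: "(of_int c * (- 1 / z) + of_int d) * z = of_int d * z + of_int (- c)"
    by (simp add: field_simps)
  have "eta_sq ((of_int b * z + of_int (- a)) / (of_int d * z + of_int (- c)))
      = cexp1 (of_int (eta_exponent a b c d) / 12) * (- \<i>) * ((of_int c * (- 1 / z) + of_int d) * z) * eta_sq z"
    unfolding 1 [symmetric] 2 eta_sq_inversion[OF z] by (simp only: mult_ac)
  then show "eta_sq ((of_int b * z + of_int (- a)) / (of_int d * z + of_int (- c)))
       = cexp1 (of_int (eta_exponent b (- a) d (- c)) / 12) * (of_int d * z + of_int (- c)) * eta_sq z"
    unfolding 3 4 .
qed

text \<open>The inversion matrix has order 4, so three further applications undo one.\<close>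

lemma eta_sq_transforms_S_iff:
  assumes "a * d - b * c = 1"
  shows "eta_sq_transforms b (- a) d (- c) \<longleftrightarrow> eta_sq_transforms a b c d"
  using eta_sq_transforms_S[of a d b c] eta_sq_transforms_S[of b "- c" "- a" d]
    eta_sq_transforms_S[of "- a" "- d" "- b" "- c"] eta_sq_transforms_S[of "- b" c a "- d"] assms
  by (auto simp: algebra_simps)

lemma eta_sq_transforms_T_power:
  assumes "a * d - b * c = 1"
  shows "eta_sq_transforms a (b + k * a) c (d + k * c) \<longleftrightarrow> eta_sq_transforms a b c d"
proof (induction k rule: int_induct[where k = 0])
  case (step1 k)
  have "a * (d + k * c) - (b + k * a) * c = 1"
    using assms by (simp add: algebra_simps)
  from eta_sq_transforms_T[OF this] step1 show ?case by (simp add: algebra_simps)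
next
  case (step2 k)
  have "a * (d + (k - 1) * c) - (b + (k - 1) * a) * c = 1"
    using assms by (simp add: algebra_simps)
  from eta_sq_transforms_T[OF this] step2 show ?case by (simp add: algebra_simps)
qed auto

text \<open>Euclid's algorithm on the bottom row: a power of the translation replaces
  \<open>d\<close> by \<open>d mod c\<close>, and the inversion makes this the new lower left entry,
  of smaller absolute value. At c = 0 only translations up to sign are left.\<close>

theorem eta_sq_transformation:
  assumes "a * d - b * c = 1"
  shows "eta_sq_transforms a b c d"
  using assms
proof (induction "nat \<bar>c\<bar>" arbitrary: a b c d rule: less_induct)
  case less
  show ?case
  proof (cases "c = 0")
    case True
    have upper: "eta_sq_transforms 1 n 0 1" for n
    proof -
      have "eta_sq_transforms 1 0 0 1" by (simp add: eta_sq_transforms_def eta_exponent_def)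
      then show ?thesis using eta_sq_transforms_T_power[of 1 1 0 0 n] by simp
    qed
    have "a = 1 \<and> d = 1 \<or> a = - 1 \<and> d = - 1"
      using less.prems True by (simp add: zmult_eq_1_iff)
    then show ?thesis
    proof
      \<comment> \<open>Two inversions multiply a matrix by -1.\<close>
      assume "a = - 1 \<and> d = - 1"
      then show ?thesis
        using upper[of "- b"] eta_sq_transforms_S[of 1 1 "- b" 0] eta_sq_transforms_S[of "- b" 0 "- 1" 1] True
        by simp
    qed (use upper True in auto)
  next
    case False
    define k where "k = - (d div c)"
    have det: "a * (d + k * c) - (b + k * a) * c = 1"
      using less.prems by (simp add: algebra_simps)
    have "d + k * c = d mod c"
      by (simp add: k_def minus_div_mult_eq_mod)
    then have "nat \<bar>d + k * c\<bar> < nat \<bar>c\<bar>"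
      using False abs_mod_less[of c d] by simp
    moreover have "(b + k * a) * (- c) - (- a) * (d + k * c) = 1"
      using det by (simp add: algebra_simps)
    ultimately have "eta_sq_transforms (b + k * a) (- a) (d + k * c) (- c)"
      by (rule less.hyps)
    then show ?thesis
      using eta_sq_transforms_S_iff[OF det] eta_sq_transforms_T_power[OF less.prems] by blast
  qed
qed

section \<open>Eta quotients of weight 2 on \<open>\<Gamma>\<^sub>0(5)\<close>\<close>

lemma Im_moebius:
  assumes "a * d - b * c = (1::int)" "Im z > 0"
  shows "Im ((of_int a * z + of_int b) / (of_int c * z + of_int d)) = Im z / (norm (of_int c * z + of_int d))\<^sup>2"
proof -
  have "Im ((of_int a * z + of_int b) / (of_int c * z + of_int d))
    = (of_int (a * d - b * c) * Im z) / (norm (of_int c * z + of_int d))\<^sup>2"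
    by (simp add: Im_divide cmod_power2 algebra_simps add_divide_distrib [symmetric] diff_divide_distrib [symmetric])
  then show ?thesis using assms by simp
qed

lemma Im_moebius_pos:
  assumes "a * d - b * c = (1::int)" "Im z > 0"
  shows "Im ((of_int a * z + of_int b) / (of_int c * z + of_int d)) > 0"
  using moebius_denominator_nonzero[OF assms(2,1)] assms by (simp add: Im_moebius)

text \<open>\<open>eis_a\<close> and \<open>eis_c\<close> are eta(z)^5 / eta(5z) and eta(5z)^5 /
  eta(z), in which the powers of e(z) add up to 0 and 1. They are Eisenstein series of weight 2 for
  the quadratic character modulo 5.\<close>

definition eis_a :: "complex \<Rightarrow> complex" where
  "eis_a z = euler_prod (cexp1 z) ^ 5 / euler_prod (cexp1 (5 * z))"

definition eis_c :: "complex \<Rightarrow> complex" where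
  "eis_c z = cexp1 z * euler_prod (cexp1 (5 * z)) ^ 5 / euler_prod (cexp1 z)"

lemma eis_nonzero:
  assumes "Im z > 0"
  shows "eis_a z \<noteq> 0" "eis_c z \<noteq> 0"
  using assms euler_prod_nonzero[OF norm_cexp1_less_1, of z] euler_prod_nonzero[OF norm_cexp1_less_1, of "5 * z"]
  by (simp_all add: eis_a_def eis_c_def)

text \<open>With only the square of eta at hand, formulas exist for the square of
  \<open>eis_a\<close> and for its product with \<open>eis_c\<close>, not for each function alone;
  together they determine the pair up to a common sign.\<close>

lemma eis_a_squared:
  assumes "Im z > 0"
  shows "eis_a z ^ 2 = eta_sq z ^ 5 / eta_sq (5 * z)"
proof -
  have "cexp1 (z / 12) ^ 5 = cexp1 (5 * z / 12)"
    using cexp1_of_nat_mult[of 5 "z / 12"] by simp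
  then show ?thesis
    by (simp add: eis_a_def eta_sq_def power_mult_distrib power_divide flip: power_mult)
qed

lemma eis_a_eis_c:
  assumes "Im z > 0"
  shows "eis_a z * eis_c z = eta_sq z ^ 2 * eta_sq (5 * z) ^ 2"
proof -
  have "cexp1 (z / 12) ^ 2 * cexp1 (5 * z / 12) ^ 2 = cexp1 z"
    by (simp add: cexp1_def field_simps flip: exp_add exp_of_nat_mult)
  moreover have "euler_prod (cexp1 z) \<noteq> 0" "euler_prod (cexp1 (5 * z)) \<noteq> 0"
    using assms by (auto intro!: euler_prod_nonzero norm_cexp1_less_1)
  ultimately show ?thesis
    by (simp add: eis_a_def eis_c_def eta_sq_def power_mult_distrib field_simps flip: power_mult)
       (simp add: eval_nat_numeral)
qed

text \<open>When (a, b, 5c, d) moves z, the matrix (a, 5b, c, d) moves 5z. The congruence says that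
  the multiplier of \<open>eta_sq\<close> at 5z is the fifth power of the one at z.\<close>

lemma eta_exponent_Gamma0_5:
  "(5 * eta_exponent a b (5 * c) d) mod 12 = eta_exponent a (5 * b) c d mod 12"
proof -
  have "5 * eta_exponent a b (5 * c) d - eta_exponent a (5 * b) c d
    = 12 * (2 * ((a + d) * c) - 10 * (b * d * (c * c)) + (if even c then d - 1 - 6 * (c * d) else - 6 * c))"
    by (simp add: eta_exponent_def power2_eq_square algebra_simps)
  then show ?thesis
    by (simp add: mod_eq_dvd_iff)
qed

lemma eta_sq_Gamma0_5:
  assumes g: "(a, b, c, d) \<in> Gamma0_5" and z: "Im z > 0"
  defines "w \<equiv> (of_int a * z + of_int b) / (of_int c * z + of_int d)"
  obtains e where "eta_sq w = e * (of_int c * z + of_int d) * eta_sq z"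
    "eta_sq (5 * w) = e ^ 5 * (of_int c * z + of_int d) * eta_sq (5 * z)" "e ^ 12 = 1"
proof -
  obtain c' where c: "c = 5 * c'" and det: "a * d - b * c = 1"
    using g by (auto simp: Gamma0_5_def)
  define e where "e = cexp1 (of_int (eta_exponent a b c d) / 12)"
  have e5: "cexp1 (of_int (eta_exponent a (5 * b) c' d) / 12) = e ^ 5"
    using cexp1_mod_12[OF eta_exponent_Gamma0_5, of a b c' d] cexp1_of_nat_mult[of 5 "of_int (eta_exponent a b c d) / 12"]
    by (simp add: e_def c)
  have e12: "e ^ 12 = 1"
    using cexp1_of_nat_mult[of 12 "of_int (eta_exponent a b c d) / 12"] by (simp add: e_def)
  have det': "a * d - (5 * b) * c' = 1" using det c by simp
  have z5: "Im (5 * z) > 0" using z by simp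
  have "eta_sq w = e * (of_int c * z + of_int d) * eta_sq z"
    using eta_sq_transformation[OF det] z unfolding eta_sq_transforms_def w_def e_def by blast
  moreover have "5 * w = (of_int a * (5 * z) + of_int (5 * b)) / (of_int c' * (5 * z) + of_int d)"
    by (simp add: w_def c algebra_simps)
  moreover have "eta_sq ((of_int a * (5 * z) + of_int (5 * b)) / (of_int c' * (5 * z) + of_int d))
    = e ^ 5 * (of_int c' * (5 * z) + of_int d) * eta_sq (5 * z)"
    using eta_sq_transformation[OF det'] z5 unfolding eta_sq_transforms_def e5 by blast
  ultimately show ?thesis
    using e12 by (intro that[of e]) (simp_all add: c mult_ac)
qed

text \<open>The multipliers \<open>e\<close> and \<open>e ^ 5\<close> of \<open>eta_sq\<close> at z
  and 5z cancel in the square of \<open>eis_a\<close> and combine to \<open>e ^ 12 = 1\<close> in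
  the product with \<open>eis_c\<close>. One common sign remains undetermined.\<close>

lemma eis_Gamma0_5:
  assumes g: "(a, b, c, d) \<in> Gamma0_5" and z: "Im z > 0"
  defines "w \<equiv> (of_int a * z + of_int b) / (of_int c * z + of_int d)" and "J \<equiv> of_int c * z + of_int d"
  obtains s where "s\<^sup>2 = 1" "eis_a w = s * J\<^sup>2 * eis_a z" "eis_c w = s * J\<^sup>2 * eis_c z"
proof -
  obtain e where e: "eta_sq w = e * J * eta_sq z" "eta_sq (5 * w) = e ^ 5 * J * eta_sq (5 * z)" "e ^ 12 = 1"
    using eta_sq_Gamma0_5[OF g z] unfolding w_def J_def by metis
  have det: "a * d - b * c = 1" using g by (auto simp: Gamma0_5_def)
  have w: "Im w > 0" unfolding w_def using det z by (rule Im_moebius_pos)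
  have J: "J \<noteq> 0" unfolding J_def using moebius_denominator_nonzero[OF z det] .
  have "e \<noteq> 0" using e(3) by auto
  have z5: "Im (5 * z) > 0" using z by simp
  have A: "eis_a w ^ 2 = (J\<^sup>2 * eis_a z) ^ 2"
    unfolding eis_a_squared[OF w] e power_mult_distrib eis_a_squared[OF z]
    using \<open>e \<noteq> 0\<close> J eta_sq_nonzero[OF z5] by (simp add: field_simps) (simp add: eval_nat_numeral)
  have B: "eis_a w * eis_c w = J ^ 4 * (eis_a z * eis_c z)"
  proof -
    have "eis_a w * eis_c w = e ^ 12 * J ^ 4 * (eta_sq z ^ 2 * eta_sq (5 * z) ^ 2)"
      unfolding eis_a_eis_c[OF w] e(1,2) by (simp add: power_mult_distrib mult_ac flip: power_mult power_add)
    then show ?thesis unfolding eis_a_eis_c[OF z] e(3) by simp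
  qed
  define s where "s = eis_a w / (J\<^sup>2 * eis_a z)"
  have s: "s\<^sup>2 = 1"
    using A J eis_nonzero[OF z] by (simp add: s_def power_divide)
  have aw: "eis_a w = s * J\<^sup>2 * eis_a z"
    using J eis_nonzero[OF z] by (simp add: s_def)
  have "s * (s * J\<^sup>2 * eis_a z * eis_c w) = s * (J ^ 4 * (eis_a z * eis_c z))"
    using B unfolding aw by simp
  then have "J\<^sup>2 * eis_a z * eis_c w = s * (J ^ 4 * (eis_a z * eis_c z))"
    using s by (simp add: mult.assoc [symmetric] power2_eq_square [symmetric])
  also have "\<dots> = J\<^sup>2 * eis_a z * (s * J\<^sup>2 * eis_c z)"
    by (simp add: mult_ac eval_nat_numeral)
  finally have "eis_c w = s * J\<^sup>2 * eis_c z"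
    using J eis_nonzero[OF z] by simp
  with s aw show ?thesis by (rule that)
qed

text \<open>Inversion exchanges the two quotients, which ties the cusp 0 to the cusp at infinity.
  The sign of the root \<open>s\<close> of 5 is left open; later only its norm or its square
  enters.\<close>

lemma eis_Fricke:
  assumes u: "Im u > 0"
  obtains s where "s\<^sup>2 = 5" "eis_a (- 1 / u) = s * u\<^sup>2 * eis_c (u / 5)"
    "eis_c (- 1 / u) = u\<^sup>2 / (25 * s) * eis_a (u / 5)"
proof -
  have u5: "Im (u / 5) > 0" and ui: "Im (- 1 / u) > 0" and u0: "u \<noteq> 0"
    using u Im_neg_inverse_pos[OF u] by auto
  have e1: "eta_sq (- 1 / u) = - \<i> * u * eta_sq u"
    by (rule eta_sq_inversion[OF u])
  have "5 * (- 1 / u) = - 1 / (u / 5)" by simp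
  then have e5: "eta_sq (5 * (- 1 / u)) = - \<i> * (u / 5) * eta_sq (u / 5)"
    using eta_sq_inversion[OF u5] by simp
  have u55: "5 * (u / 5) = u" by simp
  have nz: "eta_sq (u / 5) \<noteq> 0" "eta_sq u \<noteq> 0"
    using eta_sq_nonzero u u5 by auto
  have sq: "eis_a (u / 5) ^ 2 = eta_sq (u / 5) ^ 5 / eta_sq u"
    "eis_a (u / 5) * eis_c (u / 5) = eta_sq (u / 5) ^ 2 * eta_sq u ^ 2"
    using eis_a_squared[OF u5] eis_a_eis_c[OF u5] by simp_all
  have c2: "eis_c (u / 5) ^ 2 = eta_sq u ^ 5 / eta_sq (u / 5)"
  proof -
    have "eis_c (u / 5) ^ 2 * (eta_sq (u / 5) ^ 5 / eta_sq u) = (eta_sq (u / 5) ^ 2 * eta_sq u ^ 2) ^ 2"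
      unfolding sq [symmetric] by (simp add: power_mult_distrib)
    then show ?thesis using nz by (simp add: field_simps) (simp add: eval_nat_numeral mult_ac)
  qed
  have A: "eis_a (- 1 / u) ^ 2 = 5 * (u\<^sup>2 * eis_c (u / 5)) ^ 2"
    unfolding eis_a_squared[OF ui] power_mult_distrib c2 unfolding e1 e5
    using u0 nz by (simp add: field_simps) (simp add: eval_nat_numeral)
  have B: "eis_a (- 1 / u) * eis_c (- 1 / u) = u ^ 4 / 25 * (eis_a (u / 5) * eis_c (u / 5))"
    unfolding eis_a_eis_c[OF ui] sq unfolding e1 e5
    by (simp add: power_mult_distrib power_divide)
  define s where "s = eis_a (- 1 / u) / (u\<^sup>2 * eis_c (u / 5))"
  have s: "s\<^sup>2 = 5"
    using A u0 eis_nonzero[OF u5] by (simp add: s_def power_divide)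
  then have "s \<noteq> 0" by auto
  have a: "eis_a (- 1 / u) = s * u\<^sup>2 * eis_c (u / 5)"
    using u0 eis_nonzero[OF u5] by (simp add: s_def)
  have "eis_c (- 1 / u) = u\<^sup>2 / (25 * s) * eis_a (u / 5)"
    using B \<open>s \<noteq> 0\<close> u0 eis_nonzero[OF u5] unfolding a
    by (simp add: field_simps) (simp add: eval_nat_numeral)
  with s a show ?thesis by (rule that)
qed

lemma holomorphic_eis:
  assumes "f holomorphic_on S" "open S" "\<And>z. z \<in> S \<Longrightarrow> Im (f z) > 0"
  shows "(\<lambda>z. eis_a (f z)) holomorphic_on S" "(\<lambda>z. eis_c (f z)) holomorphic_on S"
proof -
  have [simp]: "norm (cexp1 (f z)) < 1" "norm (cexp1 (5 * f z)) < 1" if "z \<in> S" for z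
    using assms(3)[OF that] by (auto intro!: norm_cexp1_less_1)
  show "(\<lambda>z. eis_a (f z)) holomorphic_on S" "(\<lambda>z. eis_c (f z)) holomorphic_on S"
    unfolding eis_a_def eis_c_def using assms
    by (intro holomorphic_intros; use euler_prod_nonzero in simp)+
qed

lemma open_upper_half_plane: "open upper_half_plane"
  by (simp add: upper_half_plane_def open_halfspace_Im_gt)

text \<open>\<open>\<Gamma>\<^sub>0(5)\<close> has the two cusps infinity and 0, and growth is
  tested there. A matrix with \<open>c\<close> divisible by 5 belongs to the group; any other is a
  group element times the inversion times a translation by some j.\<close>

lemma modular_form_Gamma0_5I:
  assumes hol: "f holomorphic_on upper_half_plane"
    and inv: "\<And>a b c d z. (a, b, c, d) \<in> Gamma0_5 \<Longrightarrow> Im z > 0 \<Longrightarrow>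
       f ((of_int a * z + of_int b) / (of_int c * z + of_int d)) = (of_int c * z + of_int d) ^ k * f z"
    and infty: "\<And>z. Im z \<ge> 1 \<Longrightarrow> norm (f z) \<le> B"
    and zero: "\<And>u. Im u \<ge> 1 \<Longrightarrow> norm (f (- 1 / u)) \<le> B' * norm u ^ k"
  shows "modular_form_Gamma0_5 k f"
proof -
  have "\<exists>B. \<forall>z. Im z \<ge> 1 \<longrightarrow> norm (f ((of_int a * z + of_int b) / (of_int c * z + of_int d)))
          \<le> B * norm (of_int c * z + of_int d) ^ k" if "(a, b, c, d) \<in> SL2Z" for a b c d
  proof (cases "5 dvd c")
    case True
    then have g: "(a, b, c, d) \<in> Gamma0_5" using that by (simp add: Gamma0_5_def SL2Z_def)
    have "norm (f ((of_int a * z + of_int b) / (of_int c * z + of_int d)))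
          \<le> B * norm (of_int c * z + of_int d) ^ k" if "Im z \<ge> 1" for z
      using inv[OF g, of z] infty[OF that] that
      by (simp add: norm_mult norm_power mult.commute mult_right_mono)
    then show ?thesis by blast
  next
    case False
    have det: "a * d - b * c = 1" using that by (simp add: SL2Z_def)
    have "c mod 5 = 1 \<or> c mod 5 = 2 \<or> c mod 5 = 3 \<or> c mod 5 = 4"
      using False by presburger
    then have "\<exists>m n. c * n = 1 + 5 * m"
    proof (elim disjE)
      assume "c mod 5 = 1" then have "c * 1 = 1 + 5 * (c div 5)" by presburger
      then show ?thesis by blast
    next
      assume "c mod 5 = 2" then have "c * 3 = 1 + 5 * (3 * (c div 5) + 1)" by presburger
      then show ?thesis by blast
    next
      assume "c mod 5 = 3" then have "c * 2 = 1 + 5 * (2 * (c div 5) + 1)" by presburger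
      then show ?thesis by blast
    next
      assume "c mod 5 = 4" then have "c * 4 = 1 + 5 * (4 * (c div 5) + 3)" by presburger
      then show ?thesis by blast
    qed
    then obtain m n where mn: "c * n = 1 + 5 * m" by blast
    \<comment> \<open>As \<open>n\<close> inverts \<open>c\<close> modulo 5, this shift makes d - jc
      divisible by 5.\<close>
    define j where "j = n * d"
    have "- (d - j * c) = 5 * (m * d)"
      using arg_cong[OF mn, of "\<lambda>x. x * d"] by (simp add: j_def algebra_simps)
    then have "5 dvd - (d - j * c)" by (metis dvd_triv_left)
    moreover have "- (b - j * a) * c - a * (- (d - j * c)) = 1"
      using det by (simp add: algebra_simps)
    ultimately have g: "(- (b - j * a), a, - (d - j * c), c) \<in> Gamma0_5"
      by (simp add: Gamma0_5_def)
    have "norm (f ((of_int a * z + of_int b) / (of_int c * z + of_int d)))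
          \<le> B' * norm (of_int c * z + of_int d) ^ k" if z: "Im z \<ge> 1" for z
    proof -
      define u where "u = z + of_int j"
      have u: "Im u \<ge> 1" using z by (simp add: u_def)
      then have u0: "u \<noteq> 0" by auto
      have J: "of_int (- (d - j * c)) * (- 1 / u) + of_int c = (of_int c * z + of_int d) / u"
        and N: "of_int (- (b - j * a)) * (- 1 / u) + of_int a = (of_int a * z + of_int b) / u"
        using u0 by (simp_all add: field_simps u_def)
      have "Im (- 1 / u) > 0" using u by (intro Im_neg_inverse_pos) auto
      from inv[OF g this, unfolded J N]
      have "f ((of_int a * z + of_int b) / (of_int c * z + of_int d)) = ((of_int c * z + of_int d) / u) ^ k * f (- 1 / u)"
        using u0 by simp
      then have "norm (f ((of_int a * z + of_int b) / (of_int c * z + of_int d)))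
        = (norm (of_int c * z + of_int d) ^ k / norm u ^ k) * norm (f (- 1 / u))"
        by (simp add: norm_mult norm_power norm_divide power_divide)
      also have "\<dots> \<le> (norm (of_int c * z + of_int d) ^ k / norm u ^ k) * (B' * norm u ^ k)"
        by (intro mult_left_mono zero u) simp
      finally show ?thesis using u0 by (simp add: mult.commute)
    qed
    then show ?thesis by blast
  qed
  then show ?thesis
    using hol inv unfolding modular_form_Gamma0_5_def by (auto simp: upper_half_plane_def)
qed

section \<open>A Sturm bound\<close>

text \<open>Built from translations and the inversion, so that invariance under these two moves is
  transported along the orbit by induction.\<close>

inductive_set ST_orbit :: "complex \<Rightarrow> complex set" for z where
  base: "z \<in> ST_orbit z"
| T: "w \<in> ST_orbit z \<Longrightarrow> w + of_int n \<in> ST_orbit z"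
| S: "w \<in> ST_orbit z \<Longrightarrow> - 1 / w \<in> ST_orbit z"

lemma ST_orbit_moebius:
  assumes "Im z > 0" "w \<in> ST_orbit z"
  shows "\<exists>a b c d :: int. a * d - b * c = 1 \<and> w = (of_int a * z + of_int b) / (of_int c * z + of_int d)"
  using assms(2)
proof induction
  case base
  show ?case by (rule exI[of _ 1], rule exI[of _ 0], rule exI[of _ 0], rule exI[of _ 1]) simp
next
  case (T w n)
  then obtain a b c d :: int where *: "a * d - b * c = 1" "w = (of_int a * z + of_int b) / (of_int c * z + of_int d)"
    by blast
  have "(a + n * c) * d - (b + n * d) * c = 1" using * by (simp add: algebra_simps)
  moreover have "w + of_int n = (of_int (a + n * c) * z + of_int (b + n * d)) / (of_int c * z + of_int d)"
    using moebius_denominator_nonzero[OF assms(1) *(1)] by (simp add: * field_simps)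
  ultimately show ?case by blast
next
  case (S w)
  then obtain a b c d :: int where *: "a * d - b * c = 1" "w = (of_int a * z + of_int b) / (of_int c * z + of_int d)"
    by blast
  have "(- c) * b - (- d) * a = 1" using * by (simp add: algebra_simps)
  moreover have "- 1 / w = (of_int (- c) * z + of_int (- d)) / (of_int a * z + of_int b)"
  proof -
    have "- 1 / (x / y) = (- y) / x" for x y :: complex by simp
    then show ?thesis unfolding *(2) by (simp only: of_int_minus mult_minus_left minus_add_distrib)
  qed
  ultimately show ?case by blast
qed

lemma finite_bounded_lattice_pairs:
  assumes "Im z > 0"
  shows "finite {(c::int, d::int). norm (of_int c * z + of_int d) \<le> R}"
proof (rule finite_subset)
  define K where "K = \<lceil>\<bar>R\<bar> / Im z\<rceil>"
  define L where "L = \<lceil>\<bar>R\<bar> + (\<bar>R\<bar> / Im z + 1) * \<bar>Re z\<bar>\<rceil>"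
  show "{(c::int, d::int). norm (of_int c * z + of_int d) \<le> R} \<subseteq> {- K..K} \<times> {- L..L}"
  proof
    fix p assume "p \<in> {(c::int, d::int). norm (of_int c * z + of_int d) \<le> R}"
    then obtain c d :: int where p: "p = (c, d)" and n: "norm (of_int c * z + of_int d) \<le> R"
      by auto
    have "\<bar>Im (of_int c * z + of_int d)\<bar> \<le> R" using n abs_Im_le_cmod order_trans by blast
    then have 1: "\<bar>of_int c\<bar> * Im z \<le> \<bar>R\<bar>" using assms by (simp add: abs_mult)
    then have c: "\<bar>of_int c\<bar> \<le> \<bar>R\<bar> / Im z" using assms by (simp add: pos_le_divide_eq)
    then have "real_of_int \<bar>c\<bar> \<le> of_int K" unfolding K_def by linarith
    then have cK: "\<bar>c\<bar> \<le> K" by linarith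
    have "\<bar>Re (of_int c * z + of_int d)\<bar> \<le> R" using n abs_Re_le_cmod order_trans by blast
    then have "\<bar>of_int d\<bar> \<le> \<bar>R\<bar> + \<bar>of_int c * Re z\<bar>" by simp
    also have "\<bar>of_int c * Re z\<bar> \<le> (\<bar>R\<bar> / Im z + 1) * \<bar>Re z\<bar>"
      unfolding abs_mult using c by (intro mult_right_mono) auto
    finally have "real_of_int \<bar>d\<bar> \<le> of_int L" unfolding L_def by linarith
    then have "\<bar>d\<bar> \<le> L" by linarith
    with cK show "p \<in> {- K..K} \<times> {- L..L}" by (auto simp: p)
  qed
qed auto

text \<open>Only finitely many heights above that of \<open>z\<close> occur in the orbit, and a highest point of the orbit lies outside
  the unit disc.\<close>
lemma ST_orbit_high:
  assumes z: "Im z > 0"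
  obtains w where "w \<in> ST_orbit z" "\<bar>Re w\<bar> \<le> 1 / 2" "Im w \<ge> 1 / 2"
proof -
  define A where "A = {w \<in> ST_orbit z. Im w \<ge> Im z}"
  have "finite (Im ` A)"
  proof (rule finite_subset)
    show "Im ` A \<subseteq> (\<lambda>(c::int, d::int). Im z / (norm (of_int c * z + of_int d))\<^sup>2) `
        {(c::int, d::int). norm (of_int c * z + of_int d) \<le> 1}"
    proof clarify
      fix w assume "w \<in> A"
      then have w: "w \<in> ST_orbit z" "Im w \<ge> Im z" by (auto simp: A_def)
      obtain a b c d :: int where *: "a * d - b * c = 1" "w = (of_int a * z + of_int b) / (of_int c * z + of_int d)"
        using ST_orbit_moebius[OF z w(1)] by blast
      have Im: "Im w = Im z / (norm (of_int c * z + of_int d))\<^sup>2"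
        unfolding *(2) by (rule Im_moebius[OF *(1) z])
      have nz: "norm (of_int c * z + of_int d) > 0"
        using moebius_denominator_nonzero[OF z *(1)] by simp
      have "(norm (of_int c * z + of_int d))\<^sup>2 \<le> 1"
        using w(2) z nz unfolding Im by (simp add: field_simps)
      then have "norm (of_int c * z + of_int d) \<le> 1"
        using nz by (simp add: power_le_one_iff abs_square_le_1)
      then show "Im w \<in> (\<lambda>(c::int, d::int). Im z / (norm (of_int c * z + of_int d))\<^sup>2) `
        {(c::int, d::int). norm (of_int c * z + of_int d) \<le> 1}"
        using Im by (intro image_eqI[of _ _ "(c, d)"]) auto
    qed
    show "finite ((\<lambda>(c::int, d::int). Im z / (norm (of_int c * z + of_int d))\<^sup>2) `
        {(c::int, d::int). norm (of_int c * z + of_int d) \<le> 1})"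
      using finite_bounded_lattice_pairs[OF z] by (rule finite_imageI)
  qed
  moreover have "z \<in> A" by (simp add: A_def ST_orbit.base)
  ultimately have M: "Max (Im ` A) \<in> Im ` A" "\<And>w. w \<in> A \<Longrightarrow> Im w \<le> Max (Im ` A)"
    by (auto intro!: Max_in)
  then obtain v where v: "v \<in> A" "Im v = Max (Im ` A)" by auto
  \<comment> \<open>Rounding the real part moves the highest point into the strip without changing
    its height.\<close>
  define w where "w = v + of_int (- round (Re v))"
  have w: "w \<in> ST_orbit z" "Im w = Im v"
    using v unfolding w_def A_def by (auto intro: ST_orbit.T simp del: of_int_minus) 
  have Re: "\<bar>Re w\<bar> \<le> 1 / 2"
    using of_int_round_abs_le[of "Re v"] by (simp add: w_def abs_minus_commute)
  have pos: "Im w > 0" using v w z by (auto simp: A_def)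
  have "norm w \<ge> 1"
  proof (rule ccontr)
    assume "\<not> norm w \<ge> 1"
    then have lt: "(norm w)\<^sup>2 < 1" by (simp add: power_less_one_iff abs_square_less_1)
    have nz: "(norm w)\<^sup>2 > 0" using pos by auto
    have Im: "Im (- 1 / w) = Im w / (norm w)\<^sup>2"
      using Im_moebius[of 0 0 "- 1" 1 w] pos by simp
    also have "\<dots> > Im w" using lt nz pos by (simp add: field_simps)
    finally have "Im (- 1 / w) > Im w" .
    moreover have "- 1 / w \<in> A"
      using calculation ST_orbit.S[OF w(1)] v w by (auto simp: A_def)
    ultimately show False using M(2)[of "- 1 / w"] v w by simp
  qed
  then have "1 \<le> (norm w)\<^sup>2" by simp
  also have "\<dots> = (Re w)\<^sup>2 + (Im w)\<^sup>2" by (rule cmod_power2)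
  also have "(Re w)\<^sup>2 \<le> (1 / 2)\<^sup>2" using Re by (metis abs_le_square_iff abs_of_nonneg zero_le_divide_1_iff zero_le_numeral)
  \<comment> \<open>The estimate would give 3/4; the weaker 1/4 keeps the point away from the real
    axis just as well.\<close>
  finally have "(1 / 2)\<^sup>2 \<le> (Im w)\<^sup>2" by (simp add: power2_eq_square)
  then have "Im w \<ge> 1 / 2" using pos by (simp add: power2_le_iff_abs_le abs_le_square_iff [symmetric])
  then show ?thesis using w Re that by blast
qed

text \<open>If \<open>h z\<close> is not 0, all values of norm at least \<open>norm (h z)\<close>
  occur on the compact piece \<open>K\<close> of the strip, because \<open>h\<close> is small high
  up. The norm then attains a maximum on the half plane, \<open>h\<close> is constant, and this
  contradicts the decay.\<close>

lemma ST_invariant_vanishing: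
  assumes hol: "h holomorphic_on upper_half_plane"
    and T: "\<And>z. Im z > 0 \<Longrightarrow> h (z + 1) = h z"
    and S: "\<And>z. Im z > 0 \<Longrightarrow> h (- 1 / z) = h z"
    and lim: "\<And>e. e > 0 \<Longrightarrow> \<exists>Y. \<forall>z. Im z \<ge> Y \<longrightarrow> norm (h z) < e"
    and z: "Im z > 0"
  shows "h z = 0"
proof (rule ccontr)
  assume nz: "h z \<noteq> 0"
  obtain Y where Y: "\<And>w. Im w \<ge> Y \<Longrightarrow> norm (h w) < norm (h z)"
    using lim[of "norm (h z)"] nz by auto
  have T_int: "h (w + of_int n) = h w" if "Im w > 0" for w n
  proof (induction n rule: int_induct[where k = 0])
    case (step1 i)
    then show ?case using T[of "w + of_int i"] that by (simp add: add_ac)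
  next
    case (step2 i)
    then show ?case using T[of "w + of_int (i - 1)"] that by (simp add: add_ac)
  qed auto
  have orbit: "Im v > 0 \<and> h v = h w" if "v \<in> ST_orbit w" "Im w > 0" for v w
    using that(1)
    by induction (use that(2) T_int S Im_neg_inverse_pos in auto)
  define K where "K = {w. \<bar>Re w\<bar> \<le> 1 / 2 \<and> 1 / 2 \<le> Im w \<and> Im w \<le> Y}"
  have K_eq: "K = cbox (Complex (- 1 / 2) (1 / 2)) (Complex (1 / 2) Y)"
    by (auto simp: K_def in_cbox_complex_iff abs_le_iff)
  have low: "\<exists>v\<in>K. h v = h w" if w: "Im w > 0" "norm (h w) \<ge> norm (h z)" for w
  proof -
    obtain v where v: "v \<in> ST_orbit w" "\<bar>Re v\<bar> \<le> 1 / 2" "Im v \<ge> 1 / 2"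
      using ST_orbit_high[OF w(1)] by blast
    have hv: "h v = h w" using orbit[OF v(1) w(1)] by blast
    have "Im v \<le> Y" using Y[of v] w(2) by (force simp: hv)
    then show ?thesis using v hv by (auto simp: K_def)
  qed
  have "compact K" by (simp add: K_eq)
  moreover have "K \<noteq> {}" using low[OF z] by auto
  moreover have "continuous_on K (\<lambda>w. norm (h w))"
    by (intro continuous_intros continuous_on_subset[OF holomorphic_on_imp_continuous_on[OF hol]])
       (auto simp: K_def upper_half_plane_def)
  ultimately obtain m where m: "m \<in> K" "\<And>w. w \<in> K \<Longrightarrow> norm (h w) \<le> norm (h m)"
    using continuous_attains_sup by metis
  have le: "norm (h w) \<le> norm (h m)" if "Im w > 0" for w
  proof (cases "norm (h w) \<ge> norm (h z)")
    case True
    then show ?thesis using low[OF that] m by metis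
  next
    case False
    then show ?thesis using low[OF z] m by (metis linear order_trans)
  qed
  have con: "connected upper_half_plane"
    unfolding upper_half_plane_def using convex_halfspace_Im_gt[of 0] by (rule convex_connected)
  have "h constant_on upper_half_plane"
    by (rule maximum_modulus_principle[OF hol open_upper_half_plane con open_upper_half_plane subset_refl, of m])
       (use m le in \<open>auto simp: K_def upper_half_plane_def\<close>)
  then have "h (of_real (max Y 1) * \<i>) = h z"
    using z unfolding constant_on_def upper_half_plane_def by (auto)
  moreover have "norm (h (of_real (max Y 1) * \<i>)) < norm (h z)"
    by (rule Y) simp
  ultimately show False by simp
qed

lemma holomorphic_mult_eq_0:
  assumes "f holomorphic_on S" "g holomorphic_on S" "open S" "connected S"
    and "\<And>z. z \<in> S \<Longrightarrow> f z * g z = 0"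
  shows "(\<forall>z\<in>S. f z = 0) \<or> (\<forall>z\<in>S. g z = 0)"
proof (rule disjCI)
  assume "\<not> (\<forall>z\<in>S. g z = 0)"
  then obtain w where w: "w \<in> S" "g w \<noteq> 0" by blast
  have "open {z \<in> S. g z \<noteq> 0}"
    using continuous_open_preimage[OF holomorphic_on_imp_continuous_on[OF assms(2)] assms(3), of "- {0}"]
    by (simp add: vimage_def Int_def open_Compl)
  moreover have "f z = 0" if "z \<in> {z \<in> S. g z \<noteq> 0}" for z
    using assms(5)[of z] that by auto
  ultimately show "\<forall>z\<in>S. f z = 0"
    using analytic_continuation_open[of "{z \<in> S. g z \<noteq> 0}" S f "\<lambda>_. 0"] assms w by auto
qed

lemma holomorphic_prod_eq_0:
  assumes "finite I" "\<And>i. i \<in> I \<Longrightarrow> f i holomorphic_on S" "open S" "connected S" "S \<noteq> {}"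
    and "\<And>z. z \<in> S \<Longrightarrow> (\<Prod>i\<in>I. f i z) = 0"
  shows "\<exists>i\<in>I. \<forall>z\<in>S. f i z = 0"
  using assms(1,2,6)
proof (induction I rule: finite_induct)
  case empty
  then show ?case using assms(5) by auto
next
  case (insert i I)
  have "(\<forall>z\<in>S. f i z = 0) \<or> (\<forall>z\<in>S. (\<Prod>i\<in>I. f i z) = 0)"
    using insert assms(3,4) by (intro holomorphic_mult_eq_0 holomorphic_intros) auto
  then show ?case using insert by auto
qed

text \<open>The region Im z \<ge> r is mapped into a compact disc around q = 0 inside the unit disc,
  so continuity there, at the cusp included, gives boundedness.\<close>

lemma bounded_cexp1:
  assumes "continuous_on (ball 0 1) \<phi>" "r > 0"
  shows "\<exists>B. \<forall>z. Im z \<ge> r \<longrightarrow> norm (\<phi> (cexp1 z) :: complex) \<le> B"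
proof -
  have "cball 0 (exp (- 2 * pi * r)) \<subseteq> (ball 0 1 :: complex set)"
    using assms(2) le_less_trans[of _ "exp (- 2 * pi * r)" 1] by auto
  then have "bounded (\<phi> ` cball 0 (exp (- 2 * pi * r)))"
    by (intro compact_imp_bounded compact_continuous_image[OF continuous_on_subset[OF assms(1)]]) auto
  then obtain B where "\<forall>x\<in>\<phi> ` cball 0 (exp (- 2 * pi * r)). norm x \<le> B"
    unfolding bounded_iff by blast
  then have B: "norm (\<phi> q) \<le> B" if "norm q \<le> exp (- 2 * pi * r)" for q
    using that by simp
  show ?thesis
    by (intro exI[of _ B] allI impI B) (simp add: norm_cexp1)
qed

text \<open>\<open>phi_a\<close> and \<open>phi_c\<close> are \<open>eis_a\<close> and
  \<open>eis_c\<close> in the coordinate q = e(z), where the cusp at infinity becomes the interior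
  point 0.\<close>

definition phi_a :: "complex \<Rightarrow> complex" where
  "phi_a q = euler_prod q ^ 5 / euler_prod (q ^ 5)"

definition phi_c :: "complex \<Rightarrow> complex" where
  "phi_c q = q * (euler_prod (q ^ 5) ^ 5 / euler_prod q)"

lemma eis_phi: "eis_a z = phi_a (cexp1 z)" "eis_c z = phi_c (cexp1 z)"
  using cexp1_of_nat_mult[of 5 z] by (simp_all add: eis_a_def eis_c_def phi_a_def phi_c_def)

lemma norm_power_5_less_1: "norm q < 1 \<Longrightarrow> norm (q ^ 5 :: complex) < 1"
  by (simp add: norm_power power_less_one_iff)

lemma holomorphic_phi: "phi_a holomorphic_on ball 0 1" "phi_c holomorphic_on ball 0 1"
  unfolding phi_a_def phi_c_def
  by (intro holomorphic_intros; use euler_prod_nonzero norm_power_5_less_1 in simp)+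

lemma phi_a_nonzero: "norm q < 1 \<Longrightarrow> phi_a q \<noteq> 0"
  using euler_prod_nonzero norm_power_5_less_1 by (simp add: phi_a_def)

text \<open>\<open>phi_a\<close> has no zero in the unit disc, not even at q = 0. At the cusp 0,
  where \<open>eis_c\<close> turns into \<open>eis_a\<close>, this allows division by powers of
  \<open>eis_c\<close>.\<close>

lemma eis_a_lower_bound:
  assumes "r > 0"
  shows "\<exists>d>0. \<forall>z. Im z \<ge> r \<longrightarrow> norm (eis_a z) \<ge> d"
proof -
  have "continuous_on (ball 0 1) (\<lambda>q. inverse (phi_a q))"
    using holomorphic_on_imp_continuous_on[OF holomorphic_phi(1)] phi_a_nonzero
    by (intro continuous_intros) auto
  from bounded_cexp1[OF this assms]
  obtain B where B: "\<And>z. Im z \<ge> r \<Longrightarrow> norm (inverse (eis_a z)) \<le> B"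
    by (auto simp: eis_phi)
  have "inverse (max B 1) \<le> norm (eis_a z)" if "Im z \<ge> r" for z
  proof -
    have "eis_a z \<noteq> 0" using that assms eis_nonzero by auto
    then have "inverse (norm (eis_a z)) \<le> max B 1" using B[OF that] by (simp add: norm_inverse)
    then have "inverse (max B 1) \<le> inverse (inverse (norm (eis_a z)))"
      using \<open>eis_a z \<noteq> 0\<close> by (intro le_imp_inverse_le) auto
    then show ?thesis by simp
  qed
  then show ?thesis by (intro exI[of _ "inverse (max B 1)"]) auto
qed

lemma eis_Gamma0_5_even_power:
  assumes g: "(a, b, c, d) \<in> Gamma0_5" and z: "Im z > 0" and "i + j = 2 * n"
  defines "w \<equiv> (of_int a * z + of_int b) / (of_int c * z + of_int d)"
  shows "eis_a w ^ i * eis_c w ^ j = (of_int c * z + of_int d) ^ (4 * n) * (eis_a z ^ i * eis_c z ^ j)"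
proof -
  define J where "J = of_int c * z + of_int d"
  obtain s where s: "s\<^sup>2 = 1" "eis_a w = s * J\<^sup>2 * eis_a z" "eis_c w = s * J\<^sup>2 * eis_c z"
    using eis_Gamma0_5[OF g z] unfolding w_def J_def by metis
  have "eis_a w ^ i * eis_c w ^ j = (s * J\<^sup>2) ^ (i + j) * (eis_a z ^ i * eis_c z ^ j)"
    unfolding s by (simp add: power_mult_distrib power_add mult_ac)
  also have "(s * J\<^sup>2) ^ (i + j) = (s\<^sup>2) ^ n * J ^ (4 * n)"
    unfolding assms(3) by (simp add: power_mult_distrib flip: power_mult)
  finally show ?thesis using s by (simp add: J_def)
qed

lemma modular_form_Gamma0_5D:
  assumes f: "modular_form_Gamma0_5 k f"
  shows "f holomorphic_on upper_half_plane"
    and "\<And>a b c d z. (a, b, c, d) \<in> Gamma0_5 \<Longrightarrow> Im z > 0 \<Longrightarrow>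
        f ((of_int a * z + of_int b) / (of_int c * z + of_int d)) = (of_int c * z + of_int d) ^ k * f z"
    and "\<And>a b c d. (a, b, c, d) \<in> SL2Z \<Longrightarrow> \<exists>B. \<forall>z. Im z \<ge> 1 \<longrightarrow>
        norm (f ((of_int a * z + of_int b) / (of_int c * z + of_int d))) \<le> B * norm (of_int c * z + of_int d) ^ k"
proof -
  note * = f[unfolded modular_form_Gamma0_5_def]
  show "f holomorphic_on upper_half_plane" using * by (rule conjunct1)
  note 1 = bspec[OF conjunct1[OF conjunct2[OF *]]] and 2 = bspec[OF conjunct2[OF conjunct2[OF *]]]
  show "f ((of_int a * z + of_int b) / (of_int c * z + of_int d)) = (of_int c * z + of_int d) ^ k * f z"
    if "(a, b, c, d) \<in> Gamma0_5" "Im z > 0" for a b c d z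
    by (rule bspec[OF 1[OF that(1), unfolded prod.case]]) (simp add: upper_half_plane_def that)
  show "\<exists>B. \<forall>z. Im z \<ge> 1 \<longrightarrow>
        norm (f ((of_int a * z + of_int b) / (of_int c * z + of_int d))) \<le> B * norm (of_int c * z + of_int d) ^ k"
    if "(a, b, c, d) \<in> SL2Z" for a b c d
    using 2[OF that, unfolded prod.case] .
qed

text \<open>The quotient \<open>h\<close> by \<open>eis_c ^ (2 * m)\<close> is invariant of weight
  0, bounded at the cusp 0 and tends to 0 at infinity. The product of its translates over the six
  cosets has level 1 and inherits the decay, so it vanishes, and then one factor vanishes
  identically.\<close>

theorem modular_form_vanishing:
  assumes f: "modular_form_Gamma0_5 (4 * m) f"
    and ord: "\<And>e. e > 0 \<Longrightarrow> \<exists>Y. \<forall>z. Im z \<ge> Y \<longrightarrow> Im z > 0 \<longrightarrow> norm (f z / eis_c z ^ (2 * m)) < e"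
    and z: "Im z > 0"
  shows "f z = 0"
proof -
  define h where "h z = f z / eis_c z ^ (2 * m)" for z
  note holf = modular_form_Gamma0_5D(1)[OF f] and invf = modular_form_Gamma0_5D(2)[OF f]
    and cusp = modular_form_Gamma0_5D(3)[OF f]
  have holc: "eis_c holomorphic_on upper_half_plane"
    by (rule holomorphic_eis(2)[OF holomorphic_on_ident open_upper_half_plane]) (simp add: upper_half_plane_def)
  have holh: "h holomorphic_on upper_half_plane"
    unfolding h_def
    by (rule holomorphic_on_divide[OF holf holomorphic_on_power[OF holc]])
       (simp add: upper_half_plane_def eis_nonzero)
  have inv: "h ((of_int a * z + of_int b) / (of_int c * z + of_int d)) = h z"
    if "(a, b, c, d) \<in> Gamma0_5" "Im z > 0" for a b c d z
    using eis_Gamma0_5_even_power[OF that, of 0 "2 * m" m] invf[OF that] that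
      moebius_denominator_nonzero[OF that(2), of a d b c]
    by (auto simp: h_def Gamma0_5_def)
  have "(0, - 1, 1, 0) \<in> SL2Z" by (simp add: SL2Z_def)
  from cusp[OF this] obtain B0 where B0: "\<And>u. Im u \<ge> 1 \<Longrightarrow> norm (f (- 1 / u)) \<le> B0 * norm u ^ (4 * m)"
    by auto
  obtain \<delta> where \<delta>: "\<delta> > 0" "\<And>z. Im z \<ge> 1 / 5 \<Longrightarrow> norm (eis_a z) \<ge> \<delta>"
    using eis_a_lower_bound[of "1 / 5"] by auto
  have "norm (h (- 1 / u)) \<le> B0 * ((25 * sqrt 5) / \<delta>) ^ (2 * m)" if u: "Im u \<ge> 1" for u
  proof -
    have up: "Im u > 0" using u by simp
    then have u0: "norm u > 0" by auto
    obtain s where s: "s\<^sup>2 = 5" "eis_c (- 1 / u) = u\<^sup>2 / (25 * s) * eis_a (u / 5)"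
      using eis_Fricke[OF up] by metis
    have "(norm s)\<^sup>2 = 5" using s(1) by (metis norm_numeral norm_power)
    then have "norm s = sqrt 5" by (metis norm_ge_zero real_sqrt_unique)
    then have n: "norm (eis_c (- 1 / u)) = (norm u)\<^sup>2 / (25 * sqrt 5) * norm (eis_a (u / 5))"
      unfolding s(2) by (simp add: norm_mult norm_divide norm_power)
    have "(norm u)\<^sup>2 / (25 * sqrt 5) * \<delta> \<le> norm (eis_c (- 1 / u))"
      unfolding n using \<delta>(2)[of "u / 5"] u by (intro mult_left_mono) auto
    moreover have pos: "(norm u)\<^sup>2 / (25 * sqrt 5) * \<delta> > 0" using u0 \<delta> by simp
    ultimately have "((norm u)\<^sup>2 / (25 * sqrt 5) * \<delta>) ^ (2 * m) \<le> norm (eis_c (- 1 / u)) ^ (2 * m)"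
      by (intro power_mono) auto
    then have "norm (h (- 1 / u)) \<le> (B0 * norm u ^ (4 * m)) / ((norm u)\<^sup>2 / (25 * sqrt 5) * \<delta>) ^ (2 * m)"
      unfolding h_def norm_divide norm_power using B0[OF u] pos
      by (intro frac_le order_trans[OF norm_ge_zero B0[OF u]]) auto
    also have "\<dots> = B0 * ((25 * sqrt 5) / \<delta>) ^ (2 * m)"
      using u0 \<delta>(1) by (simp add: power_mult_distrib power_divide flip: power_mult)
    finally show ?thesis .
  qed
  then obtain B where B: "\<And>u. Im u \<ge> 1 \<Longrightarrow> norm (h (- 1 / u)) \<le> B" by blast
  \<comment> \<open>The six cosets are represented by the identity and by z \<mapsto> -1/(z + j) for
    j < 5.\<close>
  define H where "H z = h z * (\<Prod>j<5. h (- 1 / (z + of_nat j)))" for z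
  have up: "Im (- 1 / (z + of_nat j)) > 0" if "Im z > 0" for z j
    using that by (intro Im_neg_inverse_pos) simp
  have holj: "(\<lambda>z. h (- 1 / (z + of_nat j))) holomorphic_on upper_half_plane" for j
  proof -
    have "h \<circ> (\<lambda>z. - 1 / (z + of_nat j)) holomorphic_on upper_half_plane"
    proof (rule holomorphic_on_compose_gen[OF _ holh])
      show "(\<lambda>z. - 1 / (z + of_nat j)) holomorphic_on upper_half_plane"
        by (intro holomorphic_intros) (auto simp: upper_half_plane_def complex_eq_iff)
    qed (use up in \<open>auto simp: upper_half_plane_def\<close>)
    then show ?thesis by (simp add: o_def)
  qed
  have H0: "H v = 0" if v: "Im v > 0" for v
  proof (rule ST_invariant_vanishing[OF _ _ _ _ v])
    show "H holomorphic_on upper_half_plane"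
      unfolding H_def by (intro holomorphic_intros holh holj)
  next
    fix z :: complex assume z: "Im z > 0"
    then have z0: "z \<noteq> 0" "z + 5 \<noteq> 0" by (auto simp: complex_eq_iff)
    have "h (z + 1) = h z"
      using inv[of 1 1 0 1 z] z by (simp add: Gamma0_5_def)
    \<comment> \<open>Translation shifts j cyclically: from j = 5 the group element (1, 0, -5, 1)
      leads back to j = 0.\<close>
    moreover have "h (- 1 / (z + 5)) = h (- 1 / z)"
    proof -
      have "(of_int 1 * (- 1 / z) + of_int 0) / (of_int (- 5) * (- 1 / z) + of_int 1) = - 1 / (z + 5)"
        using z0 by (simp add: field_simps)
      then show ?thesis
        using inv[of 1 0 "- 5" 1 "- 1 / z"] Im_neg_inverse_pos[OF z] by (simp only:) (simp add: Gamma0_5_def)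
    qed
    ultimately show "H (z + 1) = H z"
      by (simp add: H_def eval_nat_numeral add_ac mult_ac)
  next
    fix z :: complex assume z: "Im z > 0"
    then have z0: "z \<noteq> 0" by auto
    \<comment> \<open>Inversion exchanges the identity coset with j = 0 and sends j to the k with jk
      = -1 modulo 5: 1 and 4 change places, 2 and 3 stay.\<close>
    have *: "h (- 1 / (- 1 / z + of_int j)) = h (- 1 / (z + of_int k))" if "5 dvd 1 + j * k" for j k :: int
    proof -
      have w: "Im (- 1 / (z + of_int k)) > 0"
        using z by (intro Im_neg_inverse_pos) simp
      have zk: "z + of_int k \<noteq> 0" using z by (auto simp: complex_eq_iff)
      have zj: "- 1 / z + of_int j \<noteq> 0"
        using Im_neg_inverse_pos[OF z] by (auto simp: complex_eq_iff)
      have zj': "of_int j * z - 1 \<noteq> 0" using zj z0 by (auto simp: field_simps)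
      have g: "(- k, - 1, 1 + j * k, j) \<in> Gamma0_5"
        using that by (simp add: Gamma0_5_def algebra_simps)
      have "(of_int (- k) * (- 1 / (z + of_int k)) + of_int (- 1)) = - z / (z + of_int k)"
        using zk by (simp add: field_simps)
      moreover have "(of_int (1 + j * k) * (- 1 / (z + of_int k)) + of_int j) = (of_int j * z - 1) / (z + of_int k)"
        using zk by (simp add: field_simps)
      ultimately have "(of_int (- k) * (- 1 / (z + of_int k)) + of_int (- 1)) / (of_int (1 + j * k) * (- 1 / (z + of_int k)) + of_int j)
          = - z / (of_int j * z - 1)"
        using zk by simp
      also have "\<dots> = - 1 / (- 1 / z + of_int j)"
        using z0 zj zj' by (simp add: field_simps)
      finally show ?thesis using inv[OF g w] by simp
    qed
    have "h (- 1 / (- 1 / z)) = h z" using z0 by simp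
    then show "H (- 1 / z) = H z"
      using *[of 1 4] *[of 2 2] *[of 3 3] *[of 4 1] by (simp add: H_def eval_nat_numeral mult_ac)
  next
    fix e :: real assume e: "e > 0"
    define C where "C = max B 1 ^ 5"
    have C: "C > 0" by (simp add: C_def)
    obtain Y where Y: "\<And>z. Im z \<ge> Y \<Longrightarrow> Im z > 0 \<Longrightarrow> norm (h z) < e / C"
      using ord[of "e / C"] e C unfolding h_def by auto
    have "norm (H z) < e" if "Im z \<ge> max Y 1" for z
    proof -
      have "norm (\<Prod>j<5. h (- 1 / (z + of_nat j))) \<le> (\<Prod>j<5::nat. max B 1)"
        unfolding prod_norm [symmetric]
      proof (intro prod_mono conjI)
        fix j :: nat
        have "norm (h (- 1 / (z + of_nat j))) \<le> B" using that by (intro B) simp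
        then show "norm (h (- 1 / (z + of_nat j))) \<le> max B 1" by simp
      qed simp
      then have "norm (H z) \<le> norm (h z) * C"
        unfolding H_def norm_mult C_def by (intro mult_left_mono) auto
      also have "\<dots> < e / C * C"
        using Y[of z] that C by (intro mult_strict_right_mono) auto
      finally show ?thesis using C by simp
    qed
    then show "\<exists>Y. \<forall>z. Im z \<ge> Y \<longrightarrow> norm (H z) < e" by blast
  qed
  have conn: "connected upper_half_plane"
    unfolding upper_half_plane_def using convex_halfspace_Im_gt[of 0] by (rule convex_connected)
  have zH: "z \<in> upper_half_plane" using z by (simp add: upper_half_plane_def)
  have "(\<forall>z\<in>upper_half_plane. h z = 0) \<or> (\<forall>z\<in>upper_half_plane. (\<Prod>j<5. h (- 1 / (z + of_nat j))) = 0)"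
    using H0 by (intro holomorphic_mult_eq_0 holomorphic_intros holh holj open_upper_half_plane conn)
      (auto simp: H_def upper_half_plane_def)
  then have "h z = 0"
  proof
    assume "\<forall>z\<in>upper_half_plane. (\<Prod>j<5. h (- 1 / (z + of_nat j))) = 0"
    then have "\<exists>j\<in>{..<5::nat}. \<forall>z\<in>upper_half_plane. h (- 1 / (z + of_nat j)) = 0"
      using zH by (intro holomorphic_prod_eq_0 holj open_upper_half_plane conn) auto
    then obtain j where j: "\<And>z. z \<in> upper_half_plane \<Longrightarrow> h (- 1 / (z + of_nat j)) = 0"
      by blast
    \<comment> \<open>The point that z \<mapsto> -1/(z + j) carries to the given
      \<open>z\<close>.\<close>
    have "- 1 / z - of_nat j \<in> upper_half_plane"
      using Im_neg_inverse_pos[OF z] by (simp add: upper_half_plane_def)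
    from j[OF this] show "h z = 0" using z by simp
  qed (use zH in blast)
  then show ?thesis
    using eis_nonzero[OF z] by (simp add: h_def)
qed

section \<open>Integral expansions\<close>

text \<open>Base change from the integers, used with the complex numbers for analysis and with
  \<open>bit\<close> for reduction modulo 2.\<close>

definition fps_of_int_fps :: "int fps \<Rightarrow> 'a::comm_ring_1 fps" where
  "fps_of_int_fps g = Abs_fps (\<lambda>n. of_int (fps_nth g n))"

lemma fps_nth_of_int_fps [simp]: "fps_nth (fps_of_int_fps g) n = of_int (fps_nth g n)"
  by (simp add: fps_of_int_fps_def)

lemma fps_of_int_fps_simps [simp]:
  "fps_of_int_fps 0 = 0" "fps_of_int_fps 1 = 1" "fps_of_int_fps fps_X = fps_X"
  "fps_of_int_fps (f + g) = fps_of_int_fps f + fps_of_int_fps g"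
  "fps_of_int_fps (f - g) = fps_of_int_fps f - fps_of_int_fps g"
  "fps_of_int_fps (- f) = - fps_of_int_fps f"
  "fps_of_int_fps (fps_const c) = fps_const (of_int c)"
  "fps_of_int_fps (f * g) = fps_of_int_fps f * fps_of_int_fps g"
  "fps_of_int_fps (of_int n) = of_int n"
  by (auto simp: fps_eq_iff fps_X_def fps_mult_nth fps_of_int)

lemma fps_of_int_fps_power [simp]: "fps_of_int_fps (f ^ n) = fps_of_int_fps f ^ n"
  by (induction n) simp_all

lemma fps_of_int_fps_sum [simp]: "fps_of_int_fps (\<Sum>i\<in>I. f i) = (\<Sum>i\<in>I. fps_of_int_fps (f i))"
  by (induction I rule: infinite_finite_induct) simp_all

lemma fps_of_int_fps_prod [simp]: "fps_of_int_fps (\<Prod>i\<in>I. f i) = (\<Prod>i\<in>I. fps_of_int_fps (f i))"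
  by (induction I rule: infinite_finite_induct) simp_all

lemma fps_of_int_fps_deriv [simp]: "fps_of_int_fps (fps_deriv f) = fps_deriv (fps_of_int_fps f)"
  by (auto simp: fps_eq_iff)

text \<open>Couples a function on the unit disc with an integral Taylor series; the closure rules
  that follow carry integrality through products, inverses and derivatives.\<close>

definition disc_expansion :: "(complex \<Rightarrow> complex) \<Rightarrow> int fps \<Rightarrow> bool" where
  "disc_expansion \<phi> g \<longleftrightarrow> \<phi> holomorphic_on ball 0 1 \<and> \<phi> has_fps_expansion fps_of_int_fps g"

lemma disc_expansion_arith:
  assumes "disc_expansion \<phi> g" "disc_expansion \<psi> h"
  shows "disc_expansion (\<lambda>q. \<phi> q + \<psi> q) (g + h)" "disc_expansion (\<lambda>q. \<phi> q - \<psi> q) (g - h)"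
    "disc_expansion (\<lambda>q. \<phi> q * \<psi> q) (g * h)"
  using assms unfolding disc_expansion_def
  by (auto intro!: holomorphic_intros fps_expansion_intros)

lemma disc_expansion_const: "disc_expansion (\<lambda>_. of_int c) (fps_const c)"
  and disc_expansion_X: "disc_expansion (\<lambda>q. q) fps_X"
  by (auto simp: disc_expansion_def intro!: holomorphic_intros fps_expansion_intros)

lemma disc_expansion_power: "disc_expansion \<phi> g \<Longrightarrow> disc_expansion (\<lambda>q. \<phi> q ^ n) (g ^ n)"
  unfolding disc_expansion_def by (auto intro!: holomorphic_intros fps_expansion_intros)

lemma disc_expansion_sum:
  "(\<And>i. i \<in> I \<Longrightarrow> disc_expansion (\<phi> i) (g i)) \<Longrightarrow> disc_expansion (\<lambda>q. \<Sum>i\<in>I. \<phi> i q) (\<Sum>i\<in>I. g i)"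
  unfolding disc_expansion_def by (auto intro!: holomorphic_intros fps_expansion_intros)

lemma disc_expansion_deriv: "disc_expansion \<phi> g \<Longrightarrow> disc_expansion (deriv \<phi>) (fps_deriv g)"
  unfolding disc_expansion_def by (auto intro!: holomorphic_intros fps_expansion_intros)

text \<open>The recursion is seeded with 1, the inverse of the constant coefficient in all
  applications, so no other integer is divided by and the inverse stays integral.\<close>

definition int_fps_inverse :: "int fps \<Rightarrow> int fps" where
  "int_fps_inverse g = fps_right_inverse g 1"

lemma int_fps_inverse: "fps_nth g 0 = 1 \<Longrightarrow> g * int_fps_inverse g = 1"
  unfolding int_fps_inverse_def by (rule fps_right_inverse) simp

lemma int_fps_inverse_nth_0 [simp]: "fps_nth (int_fps_inverse g) 0 = 1"
  by (simp add: int_fps_inverse_def)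

lemma disc_expansion_inverse:
  assumes "disc_expansion \<phi> g" "fps_nth g 0 = 1" "\<And>q. norm q < 1 \<Longrightarrow> \<phi> q \<noteq> 0"
  shows "disc_expansion (\<lambda>q. inverse (\<phi> q)) (int_fps_inverse g)"
proof -
  have "fps_of_int_fps g * fps_of_int_fps (int_fps_inverse g) = (1 :: complex fps)"
    unfolding fps_of_int_fps_simps(8) [symmetric] int_fps_inverse[OF assms(2)] by simp
  then have "(fps_of_int_fps (int_fps_inverse g) :: complex fps) = inverse (fps_of_int_fps g)"
    by (metis fps_inverse_unique)
  moreover have "(\<lambda>q. inverse (\<phi> q)) has_fps_expansion inverse (fps_of_int_fps g)"
    using assms by (intro has_fps_expansion_inverse) (auto simp: disc_expansion_def)
  moreover have "(\<lambda>q. inverse (\<phi> q)) holomorphic_on ball 0 1"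
    using assms by (intro holomorphic_intros) (auto simp: disc_expansion_def)
  ultimately show ?thesis by (simp add: disc_expansion_def)
qed

text \<open>The substitution q \<mapsto> q^5, given by coefficients to keep the classes of exponents
  modulo 5 visible.\<close>

definition fps_sub5 :: "'a::zero fps \<Rightarrow> 'a fps" where
  "fps_sub5 g = Abs_fps (\<lambda>n. if 5 dvd n then fps_nth g (n div 5) else 0)"

lemma fps_nth_sub5: "fps_nth (fps_sub5 g) n = (if 5 dvd n then fps_nth g (n div 5) else 0)"
  by (simp add: fps_sub5_def)

lemma fps_sub5_conv_compose: "fps_sub5 (g :: 'a::comm_ring_1 fps) = fps_compose g (fps_X ^ 5)"
proof (rule fps_ext)
  fix n
  have "fps_nth (fps_compose g (fps_X ^ 5)) n = (\<Sum>i=0..n. fps_nth g i * (if n = 5 * i then 1 else 0))"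
    by (simp only: fps_compose_nth power_mult [symmetric] fps_X_power_nth)
  also have "\<dots> = (\<Sum>i=0..n. if i = n div 5 then (if 5 dvd n then fps_nth g i else 0) else 0)"
    by (intro sum.cong) auto
  also have "\<dots> = (if 5 dvd n then fps_nth g (n div 5) else 0)"
    by (subst sum.delta) auto
  finally show "fps_nth (fps_sub5 g) n = fps_nth (fps_compose g (fps_X ^ 5)) n"
    by (simp add: fps_nth_sub5)
qed

lemma fps_of_int_fps_sub5: "fps_of_int_fps (fps_sub5 g) = fps_sub5 (fps_of_int_fps g)"
  by (auto simp: fps_eq_iff fps_nth_sub5)

lemma disc_expansion_sub5:
  assumes "disc_expansion \<phi> g"
  shows "disc_expansion (\<lambda>q. \<phi> (q ^ 5)) (fps_sub5 g)"
proof -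
  have "\<phi> \<circ> (\<lambda>q. q ^ 5) holomorphic_on ball 0 1"
    using assms norm_power_5_less_1
    by (intro holomorphic_on_compose_gen[of _ _ _ "ball 0 1"] holomorphic_intros) (auto simp: disc_expansion_def)
  moreover have "(\<phi> \<circ> (\<lambda>q. q ^ 5)) has_fps_expansion fps_compose (fps_of_int_fps g) (fps_X ^ 5)"
    using assms by (intro has_fps_expansion_compose fps_expansion_intros) (auto simp: disc_expansion_def)
  ultimately show ?thesis
    unfolding disc_expansion_def trans[OF fps_of_int_fps_sub5 fps_sub5_conv_compose] by (simp add: o_def)
qed

text \<open>The coefficient of index n no longer changes once n factors are present; reading it off
  there takes the place of a limit of series.\<close>

definition euler_fps :: "int fps" where
  "euler_fps = Abs_fps (\<lambda>n. fps_nth (\<Prod>k<n. 1 - fps_X ^ Suc k) n)"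

lemma euler_fps_nth:
  assumes "n \<le> N"
  shows "fps_nth (\<Prod>k<N. 1 - fps_X ^ Suc k) n = fps_nth euler_fps n"
  using assms
proof (induction N rule: dec_induct)
  case (step N)
  have "fps_nth (p * (1 - fps_X ^ Suc N)) n = fps_nth p n" for p :: "int fps"
    using step by (simp add: right_diff_distrib fps_mult_fps_X_power_nonzero fps_X_power_mult_right_nth del: power_Suc)
  then show ?case using step by simp
qed (simp add: euler_fps_def)

lemma euler_fps_0 [simp]: "fps_nth euler_fps 0 = 1"
  by (simp add: euler_fps_def)

lemma euler_fps_1 [simp]: "fps_nth euler_fps (Suc 0) = - 1"
  by (simp add: euler_fps_def)

text \<open>Uniform convergence near 0 passes to all derivatives, so every Taylor coefficient of the
  infinite product is the limit of an eventually constant sequence of integers.\<close>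

lemma disc_expansion_euler: "disc_expansion euler_prod euler_fps"
proof -
  have hol: "euler_prod holomorphic_on ball 0 1"
    using holomorphic_euler_prod[of "\<lambda>q. q" "ball 0 1"] by auto
  define P where "P = (\<lambda>N (q::complex). \<Prod>n<N. 1 - q * q ^ n)"
  have "uniform_limit (cball 0 (1 / 2)) P euler_prod sequentially"
    unfolding P_def euler_prod_def by (rule uniform_limit_qpoch) (auto intro!: continuous_intros)
  then have lim: "uniform_limit (ball 0 (1 / 2)) P euler_prod sequentially"
    by (rule uniform_limit_on_subset) auto
  have P: "P N has_fps_expansion fps_of_int_fps (\<Prod>k<N. 1 - fps_X ^ Suc k)" for N
    unfolding P_def fps_of_int_fps_prod by (intro fps_expansion_intros) (auto intro!: fps_expansion_intros)
  have exp: "euler_prod has_fps_expansion fps_expansion euler_prod 0"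
    using hol by (intro has_fps_expansion_fps_expansion[of "ball 0 1"]) auto
  have "fps_nth (fps_expansion euler_prod 0) n = of_int (fps_nth euler_fps n)" for n
  proof -
    have "(\<lambda>N. (deriv ^^ n) (P N) 0) \<longlonglongrightarrow> (deriv ^^ n) euler_prod 0"
      by (rule higher_deriv_complex_uniform_limit[OF lim])
         (auto simp: P_def intro!: always_eventually holomorphic_intros)
    then have "(\<lambda>N. (deriv ^^ n) (P N) 0 / fact n) \<longlonglongrightarrow> (deriv ^^ n) euler_prod 0 / fact n"
      by (intro tendsto_intros) auto
    moreover have "(\<lambda>N. (deriv ^^ n) (P N) 0 / fact n) \<longlonglongrightarrow> of_int (fps_nth euler_fps n)"
      by (rule tendsto_eventually) (use eventually_ge_at_top[of n] in
          \<open>eventually_elim; simp only: fps_nth_fps_expansion[OF P, symmetric] fps_nth_of_int_fps euler_fps_nth\<close>)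
    ultimately have "(deriv ^^ n) euler_prod 0 / fact n = of_int (fps_nth euler_fps n)"
      by (rule LIMSEQ_unique)
    then show ?thesis by (simp add: fps_expansion_def)
  qed
  then have "fps_expansion euler_prod 0 = fps_of_int_fps euler_fps"
    by (simp add: fps_eq_iff)
  with exp hol show ?thesis by (simp add: disc_expansion_def)
qed

lemma fps_sub5_nth_0 [simp]: "fps_nth (fps_sub5 g) 0 = fps_nth g 0"
  by (simp add: fps_nth_sub5)

definition a_fps :: "int fps" where
  "a_fps = euler_fps ^ 5 * int_fps_inverse (fps_sub5 euler_fps)"

text \<open>The series of \<open>c\<close> divided by q. Its constant coefficient 1 makes the i-th
  power of \<open>c\<close> start with exactly q^i.\<close>

definition u_fps :: "int fps" where
  "u_fps = fps_sub5 euler_fps ^ 5 * int_fps_inverse euler_fps"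

definition c_fps :: "int fps" where
  "c_fps = fps_X * u_fps"

lemma a_fps_nth_0 [simp]: "fps_nth a_fps 0 = 1" and u_fps_nth_0 [simp]: "fps_nth u_fps 0 = 1"
  by (simp_all add: a_fps_def u_fps_def fps_power_zeroth)

definition phi_u :: "complex \<Rightarrow> complex" where
  "phi_u q = euler_prod (q ^ 5) ^ 5 / euler_prod q"

lemma phi_c_conv_u: "phi_c q = q * phi_u q"
  by (simp add: phi_c_def phi_u_def)

lemma disc_expansion_phi:
  "disc_expansion phi_a a_fps" "disc_expansion phi_u u_fps" "disc_expansion phi_c c_fps"
proof -
  have 5: "disc_expansion (\<lambda>q. euler_prod (q ^ 5)) (fps_sub5 euler_fps)"
    by (intro disc_expansion_sub5 disc_expansion_euler)
  have i5: "disc_expansion (\<lambda>q. inverse (euler_prod (q ^ 5))) (int_fps_inverse (fps_sub5 euler_fps))"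
    by (rule disc_expansion_inverse[OF 5]) (auto intro!: euler_prod_nonzero norm_power_5_less_1)
  have i: "disc_expansion (\<lambda>q. inverse (euler_prod q)) (int_fps_inverse euler_fps)"
    by (rule disc_expansion_inverse[OF disc_expansion_euler]) (auto intro!: euler_prod_nonzero)
  show "disc_expansion phi_a a_fps"
    unfolding phi_a_def a_fps_def divide_inverse
    by (intro disc_expansion_arith(3) disc_expansion_power disc_expansion_euler i5)
  show u: "disc_expansion phi_u u_fps"
    unfolding phi_u_def u_fps_def divide_inverse
    by (intro disc_expansion_arith(3) disc_expansion_power 5 i)
  show "disc_expansion phi_c c_fps"
    unfolding phi_c_conv_u c_fps_def by (intro disc_expansion_arith(3) disc_expansion_X u)
qed

lemma disc_expansion_imp_int_expansion:
  assumes "disc_expansion \<phi> g" "\<And>z. Im z > 0 \<Longrightarrow> f z = \<phi> (cexp1 z)"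
  shows "int_expansion f (fps_nth g)"
  unfolding int_expansion_def
proof
  fix z assume "z \<in> upper_half_plane"
  then have z: "Im z > 0" by (simp add: upper_half_plane_def)
  have "(\<lambda>n. fps_nth (fps_of_int_fps g) n * cexp1 z ^ n) sums \<phi> (cexp1 z)"
    using assms(1) norm_cexp1_less_1[OF z]
    by (intro has_fps_expansion_imp_sums_complex[where r = "ereal 1"]) (auto simp: disc_expansion_def one_ereal_def)
  moreover have "cexp1 z ^ n = exp (2 * pi * \<i> * of_nat n * z)" for n
    unfolding cexp1_of_nat_mult [symmetric] by (simp add: cexp1_def mult_ac)
  ultimately show "(\<lambda>n. of_int (fps_nth g n) * exp (2 * pi * \<i> * of_nat n * z)) sums f z"
    using assms(2)[OF z] by simp
qed

lemma cexp1_surj: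
  assumes "q \<noteq> 0" "norm q < 1"
  obtains z where "Im z > 0" "cexp1 z = q"
proof -
  define z where "z = Ln q / (2 * of_real pi * \<i>)"
  have "cexp1 z = q" using assms by (simp add: cexp1_def z_def exp_Ln)
  moreover from this have "exp (- 2 * pi * Im z) < 1" using assms(2) norm_cexp1[of z] by simp
  then have "Im z > 0" using pi_gt_zero by (simp add: zero_less_mult_iff)
  ultimately show ?thesis using that by blast
qed

lemma disc_expansion_eval_fps:
  fixes g :: "int fps"
  defines "A \<equiv> (fps_of_int_fps g :: complex fps)"
  assumes radius: "fps_conv_radius A \<ge> 1"
  shows "disc_expansion (eval_fps A) g"
  unfolding disc_expansion_def A_def [symmetric]
proof
  show "eval_fps A holomorphic_on ball 0 1"
    using radius ball_eball_mono[of 1 "fps_conv_radius A" 0]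
    by (intro holomorphic_intros) (auto simp: one_ereal_def)
  show "eval_fps A has_fps_expansion A"
    using radius by (intro eval_fps_has_fps_expansion) (auto intro: less_le_trans[of 0 1])
qed

text \<open>Every real r in (0, 1) is e(z) for some \<open>z\<close> in the half plane, so the
  series converges at r; this forces a radius of convergence of at least 1.\<close>

lemma int_expansion_imp_disc_expansion:
  assumes "int_expansion f a"
  obtains \<phi> where "disc_expansion \<phi> (Abs_fps a)" "\<And>z. Im z > 0 \<Longrightarrow> f z = \<phi> (cexp1 z)"
proof -
  define A :: "complex fps" where "A = fps_of_int_fps (Abs_fps a)"
  have sums: "(\<lambda>n. fps_nth A n * cexp1 z ^ n) sums f z" if "Im z > 0" for z
  proof -
    have "cexp1 z ^ n = exp (2 * pi * \<i> * of_nat n * z)" for n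
      unfolding cexp1_of_nat_mult [symmetric] by (simp add: cexp1_def mult_ac)
    then show ?thesis
      using assms that by (simp add: int_expansion_def upper_half_plane_def A_def)
  qed
  have radius: "fps_conv_radius A \<ge> 1"
    unfolding fps_conv_radius_def
  proof (rule conv_radius_geI_ex')
    fix r :: real assume r: "0 < r" "ereal r < 1"
    then obtain z where "Im z > 0" "cexp1 z = of_real r"
      using cexp1_surj[of "of_real r"] by auto
    then show "summable (\<lambda>n. fps_nth A n * of_real r ^ n)"
      using sums[of z] by (simp add: sums_iff)
  qed
  have "disc_expansion (eval_fps A) (Abs_fps a)"
    using radius unfolding A_def by (rule disc_expansion_eval_fps)
  moreover have "f z = eval_fps A (cexp1 z)" if "Im z > 0" for z
    using sums[OF that] by (simp add: eval_fps_def sums_iff)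
  ultimately show ?thesis using that by blast
qed

text \<open>Every nonzero q in the unit disc has the form e(z); the value at q = 0 follows by
  continuity.\<close>

lemma disc_expansion_eq_0:
  assumes "disc_expansion \<phi> g" "\<And>z. Im z > 0 \<Longrightarrow> \<phi> (cexp1 z) = 0"
  shows "g = 0"
proof -
  have z: "\<phi> q = 0" if "q \<noteq> 0" "norm q < 1" for q
    using cexp1_surj[OF that] assms(2) by metis
  have "isCont \<phi> 0"
    using assms(1) by (auto simp: disc_expansion_def intro: has_fps_expansion_imp_continuous)
  then have "\<phi> \<midarrow>0\<rightarrow> \<phi> 0" by (simp add: isCont_def)
  moreover have "\<phi> \<midarrow>0\<rightarrow> 0"
    by (rule tendsto_eventually) (auto simp: eventually_at intro!: exI[of _ 1] z)
  ultimately have "\<phi> 0 = 0" using LIM_unique by blast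
  then have "\<forall>q\<in>ball 0 1. \<phi> q = 0" using z by (metis dist_0_norm mem_ball)
  then have "eventually (\<lambda>q. \<phi> q = 0) (nhds 0)"
    by (intro eventually_nhds_in_open[of "ball 0 1", THEN eventually_mono]) auto
  then have "\<phi> has_fps_expansion 0" by (simp add: has_fps_expansion_0_iff)
  with assms(1) have "(fps_of_int_fps g :: complex fps) = 0"
    using fps_expansion_unique_complex by (auto simp: disc_expansion_def)
  then show ?thesis by (simp add: fps_eq_iff)
qed

section \<open>Integral bases of modular forms\<close>

lemma modular_form_add:
  assumes f: "modular_form_Gamma0_5 k f" and g: "modular_form_Gamma0_5 k g"
  shows "modular_form_Gamma0_5 k (\<lambda>z. f z + s * g z)"
  unfolding modular_form_Gamma0_5_def
proof (intro conjI ballI, goal_cases)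
  case 1
  show ?case
    by (intro holomorphic_intros modular_form_Gamma0_5D(1)[OF f] modular_form_Gamma0_5D(1)[OF g])
next
  case (2 x)
  obtain a b c d where x: "x = (a, b, c, d)" by (cases x) auto
  show ?case
    using 2 modular_form_Gamma0_5D(2)[OF f, of a b c d] modular_form_Gamma0_5D(2)[OF g, of a b c d]
    unfolding x prod.case upper_half_plane_def by (auto simp: algebra_simps)
next
  case (3 x)
  obtain a b c d where x: "x = (a, b, c, d)" by (cases x) auto
  obtain B where B: "\<And>z. Im z \<ge> 1 \<Longrightarrow> norm (f ((of_int a * z + of_int b) / (of_int c * z + of_int d)))
      \<le> B * norm (of_int c * z + of_int d) ^ k"
    using modular_form_Gamma0_5D(3)[OF f 3[unfolded x]] by blast
  obtain B' where B': "\<And>z. Im z \<ge> 1 \<Longrightarrow> norm (g ((of_int a * z + of_int b) / (of_int c * z + of_int d)))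
      \<le> B' * norm (of_int c * z + of_int d) ^ k"
    using modular_form_Gamma0_5D(3)[OF g 3[unfolded x]] by blast
  show ?case
    unfolding x prod.case
  proof (intro exI[of _ "B + norm s * B'"] allI impI)
    fix z :: complex assume z: "Im z \<ge> 1"
    define w n where "w = (of_int a * z + of_int b) / (of_int c * z + of_int d)" and "n = norm (of_int c * z + of_int d) ^ k"
    have "norm (f w + s * g w) \<le> norm (f w) + norm s * norm (g w)"
      by (metis norm_mult norm_triangle_ineq)
    also have "\<dots> \<le> B * n + norm s * (B' * n)"
      using B[OF z] B'[OF z] unfolding w_def n_def by (intro add_mono mult_left_mono) auto
    finally show "norm (f w + s * g w) \<le> (B + norm s * B') * n" by (simp add: algebra_simps)
  qed
qed

lemma modular_form_mult:
  assumes f: "modular_form_Gamma0_5 k f" and g: "modular_form_Gamma0_5 l g"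
  shows "modular_form_Gamma0_5 (k + l) (\<lambda>z. f z * g z)"
  unfolding modular_form_Gamma0_5_def
proof (intro conjI ballI, goal_cases)
  case 1
  show ?case
    by (intro holomorphic_intros modular_form_Gamma0_5D(1)[OF f] modular_form_Gamma0_5D(1)[OF g])
next
  case (2 x)
  obtain a b c d where x: "x = (a, b, c, d)" by (cases x) auto
  show ?case
    using 2 modular_form_Gamma0_5D(2)[OF f, of a b c d] modular_form_Gamma0_5D(2)[OF g, of a b c d]
    unfolding x prod.case upper_half_plane_def by (auto simp: power_add mult_ac)
next
  case (3 x)
  obtain a b c d where x: "x = (a, b, c, d)" by (cases x) auto
  obtain B where B: "\<And>z. Im z \<ge> 1 \<Longrightarrow> norm (f ((of_int a * z + of_int b) / (of_int c * z + of_int d)))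
      \<le> B * norm (of_int c * z + of_int d) ^ k"
    using modular_form_Gamma0_5D(3)[OF f 3[unfolded x]] by blast
  obtain B' where B': "\<And>z. Im z \<ge> 1 \<Longrightarrow> norm (g ((of_int a * z + of_int b) / (of_int c * z + of_int d)))
      \<le> B' * norm (of_int c * z + of_int d) ^ l"
    using modular_form_Gamma0_5D(3)[OF g 3[unfolded x]] by blast
  show ?case
    unfolding x prod.case
  proof (intro exI[of _ "B * B'"] allI impI)
    fix z :: complex assume z: "Im z \<ge> 1"
    define w n where "w = (of_int a * z + of_int b) / (of_int c * z + of_int d)" and "n = norm (of_int c * z + of_int d)"
    have "norm (f w * g w) \<le> (B * n ^ k) * (B' * n ^ l)"
      using B[OF z] B'[OF z] order_trans[OF norm_ge_zero B[OF z]] unfolding w_def n_def norm_mult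
      by (intro mult_mono) auto
    then show "norm (f w * g w) \<le> B * B' * n ^ (k + l)" by (simp add: power_add mult_ac)
  qed
qed

lemma modular_form_zero: "modular_form_Gamma0_5 k (\<lambda>_. 0)"
  by (rule modular_form_Gamma0_5I[of _ _ 0 0]) auto

lemma modular_form_sum:
  assumes "finite I" "\<And>i. i \<in> I \<Longrightarrow> modular_form_Gamma0_5 k (f i)"
  shows "modular_form_Gamma0_5 k (\<lambda>z. \<Sum>i\<in>I. s i * f i z)"
  using assms
proof (induction I rule: finite_induct)
  case empty
  then show ?case by (simp add: modular_form_zero)
next
  case (insert i I)
  then show ?case
    using modular_form_add[of k "\<lambda>z. \<Sum>i\<in>I. s i * f i z" "f i" "s i"] by (simp add: add.commute)
qed

text \<open>In even total degree the signs of \<open>eis_Gamma0_5\<close> cancel. At the cusp 0 the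
  monomial becomes, up to constants and the weight factor, the one with exchanged exponents at
  u/5.\<close>

lemma eis_monomial_modular_form:
  assumes "i + j = 2 * n"
  shows "modular_form_Gamma0_5 (4 * n) (\<lambda>z. eis_a z ^ i * eis_c z ^ j)"
proof -
  have "continuous_on (ball 0 1) (\<lambda>q. phi_a q ^ i * phi_c q ^ j)"
    using holomorphic_phi[THEN holomorphic_on_imp_continuous_on] by (intro continuous_intros)
  from bounded_cexp1[OF this, of 1] obtain B where B: "\<And>z. Im z \<ge> 1 \<Longrightarrow> norm (eis_a z ^ i * eis_c z ^ j) \<le> B"
    by (auto simp: eis_phi)
  have "continuous_on (ball 0 1) (\<lambda>q. phi_c q ^ i * phi_a q ^ j)"
    using holomorphic_phi[THEN holomorphic_on_imp_continuous_on] by (intro continuous_intros)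
  from bounded_cexp1[OF this, of "1 / 5"] obtain B' where
    B': "\<And>z. Im z \<ge> 1 / 5 \<Longrightarrow> norm (eis_c z ^ i * eis_a z ^ j) \<le> B'"
    by (auto simp: eis_phi)
  show ?thesis
  proof (rule modular_form_Gamma0_5I[where B' = "sqrt 5 ^ i / (25 * sqrt 5) ^ j * B'"])
    show "(\<lambda>z. eis_a z ^ i * eis_c z ^ j) holomorphic_on upper_half_plane"
      using holomorphic_eis[OF holomorphic_on_ident open_upper_half_plane]
      by (intro holomorphic_intros) (auto simp: upper_half_plane_def)
  next
    fix u :: complex assume u: "Im u \<ge> 1"
    then have "Im u > 0" by simp
    then obtain s where s: "s\<^sup>2 = 5" "eis_a (- 1 / u) = s * u\<^sup>2 * eis_c (u / 5)"
      "eis_c (- 1 / u) = u\<^sup>2 / (25 * s) * eis_a (u / 5)"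
      using eis_Fricke by metis
    have "(norm s)\<^sup>2 = 5" using s(1) by (metis norm_numeral norm_power)
    then have ns: "norm s = sqrt 5" by (metis norm_ge_zero real_sqrt_unique)
    have "norm (eis_a (- 1 / u) ^ i * eis_c (- 1 / u) ^ j)
      = sqrt 5 ^ i / (25 * sqrt 5) ^ j * norm (eis_c (u / 5) ^ i * eis_a (u / 5) ^ j) * norm u ^ (2 * i + 2 * j)"
      unfolding s norm_mult norm_power norm_divide ns power_mult_distrib power_divide
      by (simp add: power_add power_mult)
    also have "\<dots> \<le> sqrt 5 ^ i / (25 * sqrt 5) ^ j * B' * norm u ^ (2 * i + 2 * j)"
      using u by (intro mult_right_mono mult_left_mono B') auto
    also have "2 * i + 2 * j = 4 * n" using assms by simp
    finally show "norm (eis_a (- 1 / u) ^ i * eis_c (- 1 / u) ^ j) \<le> sqrt 5 ^ i / (25 * sqrt 5) ^ j * B' * norm u ^ (4 * n)" .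
  qed (use B eis_Gamma0_5_even_power[OF _ _ assms] in auto)
qed

text \<open>The i-th product starts with q^i and coefficient 1, so the coefficients can be cleared
  one after another by integers, without division.\<close>

lemma triangular_basis:
  assumes "fps_nth a 0 = 1" "fps_nth u 0 = (1::int)"
  shows "\<exists>s. \<forall>n<K. fps_nth (g - (\<Sum>i<K. fps_const (s i) * (a ^ (N - i) * (fps_X * u) ^ i))) n = 0"
proof (induction K)
  case (Suc K)
  then obtain s where s: "\<And>n. n < K \<Longrightarrow> fps_nth (g - (\<Sum>i<K. fps_const (s i) * (a ^ (N - i) * (fps_X * u) ^ i))) n = 0"
    by blast
  define r where "r = g - (\<Sum>i<K. fps_const (s i) * (a ^ (N - i) * (fps_X * u) ^ i))"
  define t where "t = s(K := fps_nth r K)"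
  define v where "v = a ^ (N - K) * u ^ K"
  have v0: "fps_nth v 0 = 1" by (simp add: v_def fps_power_zeroth assms)
  have "g - (\<Sum>i<Suc K. fps_const (t i) * (a ^ (N - i) * (fps_X * u) ^ i)) = r - fps_const (fps_nth r K) * (fps_X ^ K * v)"
    by (simp add: r_def t_def v_def power_mult_distrib mult_ac)
  moreover have "fps_nth (r - fps_const (fps_nth r K) * (fps_X ^ K * v)) n = 0" if "n < Suc K" for n
    using that s[of n] v0 by (cases "n = K") (auto simp: r_def fps_X_power_mult_nth)
  ultimately show ?case by metis
qed simp

lemma tendsto_0_cexp1:
  assumes "\<psi> \<midarrow>0\<rightarrow> (0::complex)" "e > 0"
  shows "\<exists>Y. \<forall>z. Im z \<ge> Y \<longrightarrow> norm (\<psi> (cexp1 z)) < e"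
proof -
  obtain d where d: "d > 0" "\<And>q. q \<noteq> 0 \<Longrightarrow> norm q < d \<Longrightarrow> norm (\<psi> q) < e"
    using assms unfolding LIM_def by (auto simp: dist_norm)
  have "norm (\<psi> (cexp1 z)) < e" if "Im z \<ge> 1 - ln d / (2 * pi)" for z
  proof (rule d(2))
    have "2 * pi * (1 - ln d / (2 * pi)) \<le> 2 * pi * Im z"
      using that by (intro mult_left_mono) auto
    then have "- 2 * pi * Im z < ln d" by (simp add: right_diff_distrib) (use pi_gt_zero in linarith)
    then have "exp (- 2 * pi * Im z) < exp (ln d)" by (simp only: exp_less_cancel_iff)
    then show "norm (cexp1 z) < d" using d(1) by (simp add: norm_cexp1)
  qed simp
  then show ?thesis by blast
qed

text \<open>Once the coefficients of index at most 2m are cleared, the remainder is a form of the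
  same weight whose quotient by \<open>eis_c ^ (2 * m)\<close> tends to 0 at infinity, so it is
  zero.\<close>

theorem modular_form_int_basis:
  assumes f: "modular_form_Gamma0_5 (4 * m) f" and a: "int_expansion f a"
  shows "\<exists>s. Abs_fps a = (\<Sum>i\<le>2 * m. fps_const (s i) * (a_fps ^ (2 * m - i) * c_fps ^ i))"
proof -
  obtain \<phi> where \<phi>: "disc_expansion \<phi> (Abs_fps a)" "\<And>z. Im z > 0 \<Longrightarrow> f z = \<phi> (cexp1 z)"
    using int_expansion_imp_disc_expansion[OF a] by blast
  obtain s where s: "\<And>n. n < Suc (2 * m) \<Longrightarrow>
      fps_nth (Abs_fps a - (\<Sum>i<Suc (2 * m). fps_const (s i) * (a_fps ^ (2 * m - i) * c_fps ^ i))) n = 0"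
    using triangular_basis[of a_fps u_fps "Suc (2 * m)" "Abs_fps a" "2 * m"] unfolding c_fps_def by auto
  define r where "r = Abs_fps a - (\<Sum>i\<le>2 * m. fps_const (s i) * (a_fps ^ (2 * m - i) * c_fps ^ i))"
  define F where "F z = f z + (- 1) * (\<Sum>i\<le>2 * m. of_int (s i) * (eis_a z ^ (2 * m - i) * eis_c z ^ i))" for z
  define \<Phi> where "\<Phi> q = \<phi> q - (\<Sum>i\<le>2 * m. of_int (s i) * (phi_a q ^ (2 * m - i) * phi_c q ^ i))" for q
  have \<Phi>: "disc_expansion \<Phi> r"
    unfolding \<Phi>_def r_def
    by (intro disc_expansion_arith disc_expansion_sum disc_expansion_const disc_expansion_power disc_expansion_phi \<phi>)
  have F\<Phi>: "F z = \<Phi> (cexp1 z)" if "Im z > 0" for z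
    using \<phi>(2)[OF that] by (simp add: F_def \<Phi>_def eis_phi)
  have modF: "modular_form_Gamma0_5 (4 * m) F"
    unfolding F_def
    by (intro modular_form_add modular_form_sum f eis_monomial_modular_form) auto
  \<comment> \<open>The shift by 2m + 1 exceeds the order of \<open>c ^ (2 * m)\<close> by one; the
    spare factor q makes the quotient tend to 0.\<close>
  define k where "k = fps_shift (Suc (2 * m)) r"
  have r: "r = fps_X ^ Suc (2 * m) * k"
    using s unfolding k_def r_def
    by (auto simp: fps_eq_iff fps_X_power_mult_nth lessThan_Suc_atMost simp del: power_Suc)
  obtain \<kappa> where \<kappa>: "disc_expansion \<kappa> k" "\<And>q. norm q < 1 \<Longrightarrow> q \<noteq> 0 \<Longrightarrow> \<Phi> q = q ^ Suc (2 * m) * \<kappa> q"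
  proof -
    define K :: "complex fps" where "K = fps_of_int_fps k"
    have R: "fps_conv_radius (fps_of_int_fps r :: complex fps) \<ge> 1"
      using \<Phi> holomorphic_on_imp_fps_conv_radius_ge[of \<Phi> "fps_of_int_fps r" "ereal 1"]
      by (auto simp: disc_expansion_def one_ereal_def)
    have K: "K = fps_shift (Suc (2 * m)) (fps_of_int_fps r)"
      by (auto simp: fps_eq_iff K_def k_def)
    then have KR: "fps_conv_radius K \<ge> 1" using R by simp
    have "disc_expansion (eval_fps K) k"
      using KR unfolding K_def by (rule disc_expansion_eval_fps)
    moreover have "\<Phi> q = q ^ Suc (2 * m) * eval_fps K q" if q: "norm q < 1" "q \<noteq> 0" for q
    proof -
      have "\<Phi> q = eval_fps (fps_of_int_fps r) q"
        using \<Phi> q by (intro has_fps_expansion_imp_eval_fps_eq[symmetric, of _ _ _ 1]) (auto simp: disc_expansion_def)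
      also have "fps_of_int_fps r = fps_X ^ Suc (2 * m) * K"
        unfolding r K_def by (simp del: power_Suc)
      also have "eval_fps \<dots> q = q ^ Suc (2 * m) * eval_fps K q"
      proof (subst eval_fps_mult)
        have "ereal (norm q) < 1" using q by (simp add: one_ereal_def)
        then show "ereal (norm q) < fps_conv_radius K" using KR by (rule less_le_trans)
      qed (simp_all del: power_Suc)
      finally show ?thesis .
    qed
    ultimately show ?thesis using that by blast
  qed
  have u0: "phi_u 0 = 1" 
    using has_fps_expansion_imp_0_eq_fps_nth_0[of phi_u "fps_of_int_fps u_fps"] disc_expansion_phi(2)
    by (simp add: disc_expansion_def)
  have cu: "isCont phi_u 0" "isCont \<kappa> 0"
    using disc_expansion_phi(2) \<kappa>(1) by (auto simp: disc_expansion_def intro: has_fps_expansion_imp_continuous)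
  then have "isCont (\<lambda>q. q * \<kappa> q / phi_u q ^ (2 * m)) 0"
    using u0 by (intro continuous_intros) auto
  then have lim: "(\<lambda>q. q * \<kappa> q / phi_u q ^ (2 * m)) \<midarrow>0\<rightarrow> 0"
    by (simp add: isCont_def)
  have "F z = 0" if z: "Im z > 0" for z
  proof (rule modular_form_vanishing[OF modF _ z])
    fix e :: real assume "e > 0"
    from tendsto_0_cexp1[OF lim this] obtain Y where
      Y: "\<And>z. Im z \<ge> Y \<Longrightarrow> norm (cexp1 z * \<kappa> (cexp1 z) / phi_u (cexp1 z) ^ (2 * m)) < e" by blast
    have "F z / eis_c z ^ (2 * m) = cexp1 z * \<kappa> (cexp1 z) / phi_u (cexp1 z) ^ (2 * m)" if "Im z > 0" for z
      using that norm_cexp1_less_1[OF that]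
      by (simp add: F\<Phi> \<kappa>(2) eis_phi phi_c_conv_u power_mult_distrib)
    then show "\<exists>Y. \<forall>z. Im z \<ge> Y \<longrightarrow> Im z > 0 \<longrightarrow> norm (F z / eis_c z ^ (2 * m)) < e"
      using Y by metis
  qed
  then have "r = 0"
    using F\<Phi> by (intro disc_expansion_eq_0[OF \<Phi>]) auto
  then show ?thesis unfolding r_def by (metis right_minus_eq)
qed

section \<open>The Hauptmodul and its logarithmic derivative\<close>

definition hauptmodul :: "complex \<Rightarrow> complex" where
  "hauptmodul z = eis_c z / eis_a z"

text \<open>Division by 2 pi \<i> turns d/dz into q d/dq, which preserves integral
  expansions.\<close>

definition hauptmodul_logderiv :: "complex \<Rightarrow> complex" where
  "hauptmodul_logderiv z = deriv hauptmodul z / (2 * of_real pi * \<i> * hauptmodul z)"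

definition phi_r :: "complex \<Rightarrow> complex" where
  "phi_r q = euler_prod (q ^ 5) * inverse (euler_prod q)"

definition r_fps :: "int fps" where
  "r_fps = fps_sub5 euler_fps * int_fps_inverse euler_fps"

text \<open>The logarithmic derivative of \<open>q * phi_r q ^ 6\<close> under q d/dq: the factor q
  contributes 1, and the even exponent 6 removes the rest modulo 2.\<close>

definition phi_w :: "complex \<Rightarrow> complex" where
  "phi_w q = of_int 1 + of_int 6 * (q * deriv phi_r q * inverse (phi_r q))"

definition w_fps :: "int fps" where
  "w_fps = fps_const 1 + fps_const 6 * (fps_X * fps_deriv r_fps * int_fps_inverse r_fps)"

lemma phi_r_nonzero: "norm q < 1 \<Longrightarrow> phi_r q \<noteq> 0"
  by (simp add: phi_r_def euler_prod_nonzero norm_power_5_less_1)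

lemma disc_expansion_phi_r: "disc_expansion phi_r r_fps"
  unfolding phi_r_def r_fps_def
  by (intro disc_expansion_arith(3) disc_expansion_sub5 disc_expansion_euler
      disc_expansion_inverse[OF disc_expansion_euler]) (auto intro!: euler_prod_nonzero)

lemma disc_expansion_phi_w: "disc_expansion phi_w w_fps"
  unfolding phi_w_def w_fps_def
  by (intro disc_expansion_arith disc_expansion_const disc_expansion_X disc_expansion_deriv disc_expansion_phi_r
      disc_expansion_inverse[OF disc_expansion_phi_r] phi_r_nonzero) (simp_all add: r_fps_def)

lemma holomorphic_hauptmodul: "hauptmodul holomorphic_on upper_half_plane"
  unfolding hauptmodul_def using holomorphic_eis[OF holomorphic_on_ident open_upper_half_plane] eis_nonzero
  by (intro holomorphic_on_divide) (auto simp: upper_half_plane_def)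

lemma hauptmodul_nonzero: "Im z > 0 \<Longrightarrow> hauptmodul z \<noteq> 0"
  by (simp add: hauptmodul_def eis_nonzero)

lemma DERIV_hauptmodul: "Im z > 0 \<Longrightarrow> (hauptmodul has_field_derivative deriv hauptmodul z) (at z)"
  using holomorphic_derivI[OF holomorphic_hauptmodul open_upper_half_plane, of z UNIV]
  by (simp add: upper_half_plane_def)

lemma hauptmodul_expansion:
  assumes "Im z > 0"
  shows "hauptmodul z = cexp1 z * phi_r (cexp1 z) ^ 6"
proof -
  have "norm (cexp1 z) < 1" by (rule norm_cexp1_less_1[OF assms])
  then have "euler_prod (cexp1 z) \<noteq> 0" "euler_prod (cexp1 z ^ 5) \<noteq> 0"
    by (auto intro!: euler_prod_nonzero norm_power_5_less_1)
  then show ?thesis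
    by (simp add: hauptmodul_def eis_phi phi_a_def phi_c_def phi_r_def field_simps) (simp add: eval_nat_numeral)
qed

lemma hauptmodul_logderiv_expansion:
  assumes z: "Im z > 0"
  shows "hauptmodul_logderiv z = phi_w (cexp1 z)"
proof -
  define q where "q = cexp1 z"
  have q: "norm q < 1" "q \<noteq> 0" unfolding q_def using z by (auto intro: norm_cexp1_less_1)
  have Dr: "(phi_r has_field_derivative deriv phi_r q) (at q)"
    using disc_expansion_phi_r q holomorphic_derivI[of phi_r "ball 0 1" q UNIV] by (simp add: disc_expansion_def)
  have De: "(cexp1 has_field_derivative 2 * of_real pi * \<i> * q) (at z)"
    unfolding cexp1_def q_def by (auto intro!: derivative_eq_intros)
  have "((\<lambda>z. cexp1 z * phi_r (cexp1 z) ^ 6) has_field_derivative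
      2 * of_real pi * \<i> * q * phi_r q ^ 6 + q * (6 * phi_r q ^ 5 * (deriv phi_r q * (2 * of_real pi * \<i> * q)))) (at z)"
    using DERIV_chain2[OF Dr[unfolded q_def] De, folded q_def] De q_def
    by (auto intro!: derivative_eq_intros simp: algebra_simps)
  moreover have "((\<lambda>z. cexp1 z * phi_r (cexp1 z) ^ 6) has_field_derivative deriv hauptmodul z) (at z)"
    by (rule has_field_derivative_transform_within_open[OF DERIV_hauptmodul[OF z] open_upper_half_plane])
       (use z in \<open>auto simp: upper_half_plane_def hauptmodul_expansion\<close>)
  ultimately have "deriv hauptmodul z = 2 * of_real pi * \<i> * q * phi_r q ^ 6 + q * (6 * phi_r q ^ 5 * (deriv phi_r q * (2 * of_real pi * \<i> * q)))"
    using DERIV_unique by blast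
  then show ?thesis
    using q phi_r_nonzero[OF q(1)] hauptmodul_expansion[OF z]
    by (simp add: hauptmodul_logderiv_def phi_w_def q_def [symmetric] field_simps) (simp add: eval_nat_numeral)
qed

text \<open>The sign of \<open>eis_Gamma0_5\<close> cancels in \<open>hauptmodul\<close>, which is
  therefore invariant; differentiating this, with 1 / \<open>J\<^sup>2\<close> as derivative of the
  Moebius map, gives weight 2.\<close>

lemma hauptmodul_logderiv_Gamma0_5:
  assumes g: "(a, b, c, d) \<in> Gamma0_5" and z: "Im z > 0"
  defines "J \<equiv> of_int c * z + of_int d"
  shows "hauptmodul_logderiv ((of_int a * z + of_int b) / (of_int c * z + of_int d)) = J\<^sup>2 * hauptmodul_logderiv z"
proof -
  define M where "M z = (of_int a * z + of_int b) / (of_int c * z + of_int d)" for z :: complex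
  have det: "a * d - b * c = 1" using g by (auto simp: Gamma0_5_def)
  have J: "J \<noteq> 0" unfolding J_def using moebius_denominator_nonzero[OF z det] .
  have inv: "hauptmodul (M v) = hauptmodul v" if v: "Im v > 0" for v
  proof -
    obtain s where "s\<^sup>2 = 1" "eis_a (M v) = s * (of_int c * v + of_int d)\<^sup>2 * eis_a v"
      "eis_c (M v) = s * (of_int c * v + of_int d)\<^sup>2 * eis_c v"
      using eis_Gamma0_5[OF g v] unfolding M_def by metis
    then show ?thesis
      using moebius_denominator_nonzero[OF v det] by (auto simp: hauptmodul_def)
  qed
  have "of_int a * J - of_int c * (of_int a * z + of_int b) = (of_int (a * d - b * c) :: complex)"
    by (simp add: J_def algebra_simps)
  then have D: "of_int a * J - of_int c * (of_int a * z + of_int b) = 1" unfolding det by simp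
  have "(M has_field_derivative (of_int a * J - of_int c * (of_int a * z + of_int b)) / J\<^sup>2) (at z)"
    unfolding M_def using J
    by (auto intro!: derivative_eq_intros simp: J_def power2_eq_square algebra_simps)
  then have DM: "(M has_field_derivative 1 / J\<^sup>2) (at z)" unfolding D .
  have "Im (M z) > 0" unfolding M_def by (rule Im_moebius_pos[OF det z])
  from DERIV_chain2[OF DERIV_hauptmodul[OF this] DM]
  have "((\<lambda>v. hauptmodul (M v)) has_field_derivative deriv hauptmodul (M z) * (1 / J\<^sup>2)) (at z)" .
  moreover have "((\<lambda>v. hauptmodul (M v)) has_field_derivative deriv hauptmodul z) (at z)"
    by (rule has_field_derivative_transform_within_open[OF DERIV_hauptmodul[OF z] open_upper_half_plane])
       (use z inv in \<open>auto simp: upper_half_plane_def\<close>)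
  ultimately have "deriv hauptmodul (M z) * (1 / J\<^sup>2) = deriv hauptmodul z"
    using DERIV_unique by blast
  then have "deriv hauptmodul (M z) = J\<^sup>2 * deriv hauptmodul z"
    using J by (simp add: field_simps)
  then show ?thesis
    unfolding M_def [symmetric] by (simp add: hauptmodul_logderiv_def inv[OF z])
qed

text \<open>Exchanging \<open>eis_a\<close> and \<open>eis_c\<close> inverts
  \<open>hauptmodul\<close> up to the constant 125 = 25 \<open>s\<^sup>2\<close>; taking the
  reciprocal changes the sign of the logarithmic derivative.\<close>

lemma hauptmodul_logderiv_Fricke:
  assumes u: "Im u > 0"
  shows "hauptmodul_logderiv (- 1 / u) = - (u\<^sup>2 / 5) * hauptmodul_logderiv (u / 5)"
proof -
  have u0: "u \<noteq> 0" using u by auto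
  have F: "hauptmodul (- 1 / v) = 1 / (125 * hauptmodul (v / 5))" if v: "Im v > 0" for v
  proof -
    have v0: "v \<noteq> 0" using v by auto
    obtain s where s: "s\<^sup>2 = 5" "eis_a (- 1 / v) = s * v\<^sup>2 * eis_c (v / 5)"
      "eis_c (- 1 / v) = v\<^sup>2 / (25 * s) * eis_a (v / 5)"
      using eis_Fricke[OF v] by metis
    have "hauptmodul (- 1 / v) = eis_a (v / 5) / (25 * s\<^sup>2 * eis_c (v / 5))"
      unfolding hauptmodul_def s(2,3) using v0 by (simp add: power2_eq_square field_simps)
    then show ?thesis using s(1) by (simp add: hauptmodul_def)
  qed
  have up: "Im (- 1 / u) > 0" "Im (u / 5) > 0" using u Im_neg_inverse_pos[OF u] by auto
  have "((\<lambda>v. - 1 / v) has_field_derivative 1 / u\<^sup>2) (at u)"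
    using u0 by (auto intro!: derivative_eq_intros simp: power2_eq_square)
  from DERIV_chain2[OF DERIV_hauptmodul[OF up(1)] this]
  have "((\<lambda>v. hauptmodul (- 1 / v)) has_field_derivative deriv hauptmodul (- 1 / u) * (1 / u\<^sup>2)) (at u)" .
  then have 1: "((\<lambda>v. 1 / (125 * hauptmodul (v / 5))) has_field_derivative deriv hauptmodul (- 1 / u) * (1 / u\<^sup>2)) (at u)"
    by (rule has_field_derivative_transform_within_open[OF _ open_upper_half_plane])
       (use u F in \<open>auto simp: upper_half_plane_def\<close>)
  have "((\<lambda>v. v / 5) has_field_derivative 1 / 5) (at u)"
    by (auto intro!: derivative_eq_intros)
  from DERIV_chain2[OF DERIV_hauptmodul[OF up(2)] this]
  have "((\<lambda>v. hauptmodul (v / 5)) has_field_derivative deriv hauptmodul (u / 5) * (1 / 5)) (at u)" .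
  then have "((\<lambda>v. 1 / (125 * hauptmodul (v / 5))) has_field_derivative
      - (deriv hauptmodul (u / 5) / (625 * hauptmodul (u / 5) ^ 2))) (at u)"
    using hauptmodul_nonzero[OF up(2)]
    by (auto intro!: derivative_eq_intros simp: power2_eq_square field_simps)
  with 1 have "deriv hauptmodul (- 1 / u) * (1 / u\<^sup>2) = - (deriv hauptmodul (u / 5) / (625 * hauptmodul (u / 5) ^ 2))"
    using DERIV_unique by blast
  then have d: "deriv hauptmodul (- 1 / u) = - (u\<^sup>2 * deriv hauptmodul (u / 5) / (625 * hauptmodul (u / 5) ^ 2))"
    using u0 by (simp add: field_simps)
  show ?thesis
    unfolding hauptmodul_logderiv_def d F[OF u] using hauptmodul_nonzero[OF up(2)]
    by (simp add: field_simps power2_eq_square)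
qed

text \<open>The square is taken because the integral basis is available in weights divisible by
  4.\<close>

lemma modular_form_logderiv_sq: "modular_form_Gamma0_5 4 (\<lambda>z. hauptmodul_logderiv z ^ 2)"
proof -
  have "continuous_on (ball 0 1) phi_w"
    using disc_expansion_phi_w by (auto simp: disc_expansion_def intro: holomorphic_on_imp_continuous_on)
  from bounded_cexp1[OF this, of "1 / 5"] obtain B where
    B: "\<And>z. Im z \<ge> 1 / 5 \<Longrightarrow> norm (hauptmodul_logderiv z) \<le> B"
    by (auto simp: hauptmodul_logderiv_expansion)
  show ?thesis
  proof (rule modular_form_Gamma0_5I[where B = "B\<^sup>2" and B' = "B\<^sup>2"])
    show "(\<lambda>z. hauptmodul_logderiv z ^ 2) holomorphic_on upper_half_plane"
      unfolding hauptmodul_logderiv_def using hauptmodul_nonzero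
      by (intro holomorphic_intros holomorphic_hauptmodul holomorphic_deriv open_upper_half_plane)
         (auto simp: upper_half_plane_def)
  next
    fix a b c d z assume "(a, b, c, d) \<in> Gamma0_5" "Im z > 0"
    from hauptmodul_logderiv_Gamma0_5[OF this]
    show "hauptmodul_logderiv ((of_int a * z + of_int b) / (of_int c * z + of_int d)) ^ 2
      = (of_int c * z + of_int d) ^ 4 * hauptmodul_logderiv z ^ 2"
      by (simp add: power_mult_distrib flip: power_mult)
  next
    fix z :: complex assume "Im z \<ge> 1"
    then have "norm (hauptmodul_logderiv z) \<le> B" by (intro B) simp
    then show "norm (hauptmodul_logderiv z ^ 2) \<le> B\<^sup>2" by (simp add: norm_power power_mono)
  next
    fix u :: complex assume u: "Im u \<ge> 1"
    then have "norm (hauptmodul_logderiv (u / 5)) \<le> B" by (intro B) simp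
    then have "norm (hauptmodul_logderiv (u / 5)) ^ 2 \<le> B\<^sup>2" by (simp add: power_mono)
    then have "norm u ^ 4 / 25 * norm (hauptmodul_logderiv (u / 5)) ^ 2 \<le> norm u ^ 4 / 25 * B\<^sup>2"
      by (intro mult_left_mono) auto
    also have "\<dots> \<le> B\<^sup>2 * norm u ^ 4" by (simp add: field_simps)
    finally show "norm (hauptmodul_logderiv (- 1 / u) ^ 2) \<le> B\<^sup>2 * norm u ^ 4"
      using u by (subst hauptmodul_logderiv_Fricke)
        (auto simp: norm_mult norm_power norm_divide power_mult_distrib power_divide simp flip: power_mult)
  qed
qed

section \<open>Power series over the field with two elements\<close>

lemma bit_fps_add_self [simp]: "(f :: bit fps) + f = 0"
  by (simp add: fps_eq_iff)

lemma bit_fps_diff [simp]: "(f :: bit fps) - g = f + g"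
  by (simp add: fps_eq_iff)

lemma bit_fps_add_eq_0: "(f :: bit fps) + g = 0 \<longleftrightarrow> f = g"
  by (metis bit_fps_diff right_minus_eq)

lemma bit_fps_square_add: "((f :: bit fps) + g)\<^sup>2 = f\<^sup>2 + g\<^sup>2"
  by (simp add: power2_sum mult_2 distrib_right)

text \<open>The terms for i and n - i cancel in characteristic 2; only a middle term can
  survive.\<close>

lemma bit_fps_square_nth: "fps_nth ((f :: bit fps)\<^sup>2) n = (if even n then fps_nth f (n div 2) else 0)"
proof -
  define h where "h i = fps_nth f i * fps_nth f (n - i)" for i
  have sq: "fps_nth (f\<^sup>2) n = (\<Sum>i\<in>{0..n}. h i)"
    by (simp add: power2_eq_square fps_mult_nth h_def)
  define A B C where "A = {i\<in>{0..n}. 2 * i < n}" and "B = {i\<in>{0..n}. n < 2 * i}" and "C = {i\<in>{0..n}. 2 * i = n}"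
  have "{0..n} = (A \<union> B) \<union> C" by (auto simp: A_def B_def C_def)
  then have "sum h {0..n} = sum h (A \<union> B) + sum h C"
    by (simp only:) (rule sum.union_disjoint; auto simp: A_def B_def C_def)
  also have "sum h (A \<union> B) = sum h A + sum h B"
    by (rule sum.union_disjoint) (auto simp: A_def B_def)
  also have "sum h B = sum h A"
    by (rule sum.reindex_bij_witness[of _ "\<lambda>i. n - i" "\<lambda>i. n - i"]) (auto simp: h_def mult.commute A_def B_def)
  also have "sum h C = (if even n then fps_nth f (n div 2) else 0)"
  proof (cases "even n")
    case True
    then have "C = {n div 2}" by (auto simp: C_def)
    moreover have "n - n div 2 = n div 2" using True by (metis add_diff_cancel_left' dvd_mult_div_cancel mult_2)
    ultimately show ?thesis using True by (simp add: h_def)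
  next
    case False
    then have "C = {}" by (auto simp: C_def)
    then show ?thesis using False by simp
  qed
  finally show ?thesis unfolding sq by simp
qed

definition a_bit :: "bit fps" where "a_bit = fps_of_int_fps a_fps"
definition c_bit :: "bit fps" where "c_bit = fps_of_int_fps c_fps"

lemma c_bit_nth: "fps_nth c_bit 0 = 0" "fps_nth c_bit 1 = 1"
  by (simp_all add: c_bit_def c_fps_def)

lemma a_bit_nth: "fps_nth a_bit 0 = 1" "fps_nth a_bit 1 = 1"
proof -
  show "fps_nth a_bit 0 = 1" by (simp add: a_bit_def)
  define p p5 :: "bit fps" where "p = fps_of_int_fps euler_fps" and "p5 = fps_of_int_fps (fps_sub5 euler_fps)"
  have "a_fps * fps_sub5 euler_fps = euler_fps ^ 5"
    using int_fps_inverse[of "fps_sub5 euler_fps"] by (simp add: a_fps_def mult.assoc) (simp add: mult.commute)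
  then have "a_bit * p5 = p ^ 5"
    unfolding a_bit_def p_def p5_def by (metis fps_of_int_fps_simps(8) fps_of_int_fps_power)
  also have "p ^ 5 = (p\<^sup>2)\<^sup>2 * p" by (simp add: eval_nat_numeral mult_ac)
  finally have "a_bit * p5 = (p\<^sup>2)\<^sup>2 * p" .
  moreover define r where "r = p\<^sup>2"
  ultimately have "fps_nth (a_bit * p5) 1 = fps_nth (r\<^sup>2 * p) 1" by simp
  moreover have "fps_nth r 0 = 1" by (simp add: r_def bit_fps_square_nth p_def)
  ultimately show "fps_nth a_bit 1 = 1"
    by (simp add: fps_mult_nth_1 bit_fps_square_nth p_def p5_def fps_nth_sub5)
qed

text \<open>Modulo 2 the form of weight 4 is 1, and comparing its coefficients of index 0, 1, 2 with
  those of \<open>a\<^sup>2\<close>, \<open>a c\<close>, \<open>c\<^sup>2\<close> gives the weights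
  1, 0, 1. Squaring is injective in characteristic 2, so \<open>1 = a\<^sup>2 + c\<^sup>2\<close>
  descends to 1 = a + c.\<close>

theorem a_bit_conv_c_bit: "a_bit = 1 + c_bit"
proof -
  have "int_expansion (\<lambda>z. hauptmodul_logderiv z ^ 2) (fps_nth (w_fps ^ 2))"
    by (rule disc_expansion_imp_int_expansion[OF disc_expansion_power[OF disc_expansion_phi_w]])
       (simp add: hauptmodul_logderiv_expansion)
  from modular_form_int_basis[of 1, OF _ this] modular_form_logderiv_sq
  obtain s where "Abs_fps (fps_nth (w_fps ^ 2)) = (\<Sum>i\<le>2 * 1. fps_const (s i) * (a_fps ^ (2 * 1 - i) * c_fps ^ i))"
    by auto
  then have s: "w_fps ^ 2 = (\<Sum>i\<le>2. fps_const (s i) * (a_fps ^ (2 - i) * c_fps ^ i))"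
    unfolding fps_nth_inverse by simp
  have "(fps_of_int_fps w_fps :: bit fps) = 1" by (simp add: w_fps_def)
  then have "1 = (fps_of_int_fps (w_fps ^ 2) :: bit fps)" by simp
  also have "\<dots> = fps_const (of_int (s 0)) * a_bit ^ 2 + fps_const (of_int (s 1)) * (a_bit * c_bit) + fps_const (of_int (s 2)) * c_bit ^ 2"
    unfolding s by (simp add: a_bit_def c_bit_def eval_nat_numeral)
  finally have *: "1 = fps_const (of_int (s 0)) * a_bit ^ 2 + fps_const (of_int (s 1)) * (a_bit * c_bit) + fps_const (of_int (s 2)) * c_bit ^ 2" .
  have "of_int (s 0) = (1::bit)"
    using arg_cong[OF *, of "\<lambda>f. fps_nth f 0"] by (simp add: bit_fps_square_nth a_bit_nth c_bit_nth)
  moreover have "of_int (s 1) = (0::bit)"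
    using arg_cong[OF *, of "\<lambda>f. fps_nth f 1"] by (simp add: bit_fps_square_nth a_bit_nth[simplified] c_bit_nth[simplified] fps_mult_nth_1)
  ultimately have "of_int (s 2) = (1::bit)" 
    using arg_cong[OF *, of "\<lambda>f. fps_nth f 2"] by (simp add: bit_fps_square_nth a_bit_nth[simplified] c_bit_nth[simplified])
  with * \<open>of_int (s 0) = 1\<close> \<open>of_int (s 1) = 0\<close> have "1 = a_bit\<^sup>2 + c_bit\<^sup>2" by simp
  then have "(a_bit + c_bit + 1)\<^sup>2 = 0"
    by (simp add: bit_fps_square_add)
  then have "a_bit + c_bit = 1" by (simp add: bit_fps_add_eq_0)
  moreover have "a_bit = (a_bit + c_bit) + c_bit" by (simp add: add.assoc)
  ultimately show ?thesis by simp
qed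

section \<open>The ring of modular forms modulo 2\<close>

lemma poly_subst_conv_poly: "poly_subst p g = poly (map_poly fps_const p) g"
proof -
  have "degree (map_poly fps_const p) = degree p"
    by (rule degree_map_poly) simp
  then show ?thesis
    by (simp add: poly_subst_def poly_altdef coeff_map_poly)
qed

lemma poly_subst_0 [simp]: "poly_subst 0 g = 0"
  and poly_subst_pCons [simp]: "poly_subst (pCons a p) g = fps_const a + g * poly_subst p g"
  by (simp_all add: poly_subst_conv_poly map_poly_pCons)

lemma poly_subst_1 [simp]: "poly_subst 1 g = 1"
  by (simp add: one_pCons)

lemma poly_subst_add [simp]: "poly_subst (p + q) g = poly_subst p g + poly_subst q g"
  by (induction p q rule: poly_induct2) (simp_all add: algebra_simps flip: fps_const_add)

lemma poly_subst_smult [simp]: "poly_subst (smult a p) g = fps_const a * poly_subst p g"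
  by (induction p) (simp_all add: algebra_simps flip: fps_const_mult)

lemma poly_subst_mult [simp]: "poly_subst (p * q) g = poly_subst p g * poly_subst q g"
  by (induction p) (simp_all add: algebra_simps)

lemma poly_subst_power [simp]: "poly_subst (p ^ n) g = poly_subst p g ^ n"
  by (induction n) simp_all

lemma poly_subst_pcompose [simp]: "poly_subst (pcompose p q) g = poly_subst p (poly_subst q g)"
  by (induction p) (simp_all add: pcompose_pCons)

lemma poly_subst_X [simp]: "poly_subst [:0, 1:] g = g"
  by simp

lemma Mk_add:
  assumes "f \<in> Mk k" "g \<in> Mk k"
  shows "f + g \<in> Mk k"
proof -
  obtain F a where F: "f = Abs_fps (\<lambda>n. of_int (a n))" "modular_form_Gamma0_5 k F" "int_expansion F a"
    using assms(1) by (auto simp: Mk_def)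
  obtain G b where G: "g = Abs_fps (\<lambda>n. of_int (b n))" "modular_form_Gamma0_5 k G" "int_expansion G b"
    using assms(2) by (auto simp: Mk_def)
  have "modular_form_Gamma0_5 k (\<lambda>z. F z + 1 * G z)"
    using F(2) G(2) by (rule modular_form_add)
  moreover have "int_expansion (\<lambda>z. F z + 1 * G z) (\<lambda>n. a n + b n)"
    using F(3) G(3) by (auto simp: int_expansion_def algebra_simps intro!: sums_add)
  moreover have "f + g = Abs_fps (\<lambda>n. of_int (a n + b n))"
    unfolding F(1) G(1) by (simp only: fps_eq_iff fps_add_nth fps_nth_Abs_fps of_int_add) simp
  ultimately show ?thesis
    unfolding Mk_def by (intro CollectI exI[of _ "\<lambda>z. F z + 1 * G z"] exI[of _ "\<lambda>n. a n + b n"] conjI)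
qed

lemma Mk_mult:
  assumes "f \<in> Mk k" "g \<in> Mk l"
  shows "f * g \<in> Mk (k + l)"
proof -
  obtain F a where F: "f = Abs_fps (\<lambda>n. of_int (a n))" "modular_form_Gamma0_5 k F" "int_expansion F a"
    using assms(1) by (auto simp: Mk_def)
  obtain G b where G: "g = Abs_fps (\<lambda>n. of_int (b n))" "modular_form_Gamma0_5 l G" "int_expansion G b"
    using assms(2) by (auto simp: Mk_def)
  obtain \<phi> \<psi> where p: "disc_expansion \<phi> (Abs_fps a)" "\<And>z. Im z > 0 \<Longrightarrow> F z = \<phi> (cexp1 z)"
    "disc_expansion \<psi> (Abs_fps b)" "\<And>z. Im z > 0 \<Longrightarrow> G z = \<psi> (cexp1 z)"
    using int_expansion_imp_disc_expansion[OF F(3)] int_expansion_imp_disc_expansion[OF G(3)] by metis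
  have "int_expansion (\<lambda>z. F z * G z) (fps_nth (Abs_fps a * Abs_fps b))"
    by (rule disc_expansion_imp_int_expansion[OF disc_expansion_arith(3)[OF p(1,3)]]) (simp add: p)
  moreover have "f * g = Abs_fps (\<lambda>n. of_int (fps_nth (Abs_fps a * Abs_fps b) n))"
  proof -
    have "f = fps_of_int_fps (Abs_fps a)" "g = fps_of_int_fps (Abs_fps b)"
      by (simp_all add: F(1) G(1) fps_of_int_fps_def)
    then have "f * g = fps_of_int_fps (Abs_fps a * Abs_fps b)" by simp
    then show ?thesis by (simp only: fps_of_int_fps_def)
  qed
  ultimately show ?thesis
    using modular_form_mult[OF F(2) G(2)] unfolding Mk_def by blast
qed

lemma eis_monomial_in_Mk:
  assumes "i + j = 2 * n"
  shows "a_bit ^ i * c_bit ^ j \<in> Mk (4 * n)"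
proof -
  have "disc_expansion (\<lambda>q. phi_a q ^ i * phi_c q ^ j) (a_fps ^ i * c_fps ^ j)"
    by (intro disc_expansion_arith disc_expansion_power disc_expansion_phi)
  then have "int_expansion (\<lambda>z. eis_a z ^ i * eis_c z ^ j) (fps_nth (a_fps ^ i * c_fps ^ j))"
    by (rule disc_expansion_imp_int_expansion) (simp add: eis_phi)
  moreover have "a_bit ^ i * c_bit ^ j = Abs_fps (\<lambda>n. of_int (fps_nth (a_fps ^ i * c_fps ^ j) n))"
    unfolding a_bit_def c_bit_def fps_of_int_fps_power [symmetric] fps_of_int_fps_simps(8) [symmetric]
    by (simp only: fps_of_int_fps_def)
  ultimately show ?thesis
    using eis_monomial_modular_form[OF assms] unfolding Mk_def by blast
qed

text \<open>Since 1 = \<open>a\<^sup>2 + c\<^sup>2\<close>, it is the reduction of a form of weight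
  4. Multiplication by this form raises the weight by 4, which brings polynomials of mixed degree in
  \<open>c\<close> into a single weight.\<close>

lemma one_in_Mk: "1 \<in> Mk 4"
proof -
  have "a_bit ^ 2 * c_bit ^ 0 + a_bit ^ 0 * c_bit ^ 2 \<in> Mk (4 * 1)"
    by (intro Mk_add eis_monomial_in_Mk) auto
  moreover have "a_bit ^ 2 * c_bit ^ 0 + a_bit ^ 0 * c_bit ^ 2 = 1"
    by (simp add: a_bit_conv_c_bit bit_fps_square_add add.assoc)
  ultimately show ?thesis by simp
qed

lemma c_bit_in_Mk: "c_bit \<in> Mk 4"
proof -
  have "a_bit ^ 1 * c_bit ^ 1 + a_bit ^ 0 * c_bit ^ 2 \<in> Mk (4 * 1)"
    by (intro Mk_add eis_monomial_in_Mk) auto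
  moreover have "a_bit ^ 1 * c_bit ^ 1 + a_bit ^ 0 * c_bit ^ 2 = c_bit"
    by (simp add: a_bit_conv_c_bit distrib_right power2_eq_square add.assoc)
  ultimately show ?thesis by simp
qed

lemma one_in_Mk': "1 \<in> Mk (4 * Suc m)"
proof (induction m)
  case (Suc m)
  then show ?case using Mk_mult[OF one_in_Mk Suc] by simp
qed (use one_in_Mk in simp)

lemma bit_fps_const_cases: "fps_const (b::bit) = 0 \<or> fps_const b = 1"
  by (cases b) auto

lemma Mk_poly: "\<exists>m. poly_subst p c_bit \<in> Mk (4 * Suc m)"
proof (induction p)
  case 0
  have "1 + 1 \<in> Mk (4 * Suc 0)" using Mk_add one_in_Mk by (metis One_nat_def mult_1_right)
  then show ?case by (auto intro: exI[of _ 0])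
next
  case (pCons b p)
  then obtain m where "poly_subst p c_bit \<in> Mk (4 * Suc m)" by blast
  from Mk_mult[OF c_bit_in_Mk this] have *: "c_bit * poly_subst p c_bit \<in> Mk (4 * Suc (Suc m))" by simp
  show ?case
    using bit_fps_const_cases[of b] * Mk_add[OF one_in_Mk' *] by (auto intro: exI[of _ "Suc m"])
qed

text \<open>The integral basis reduces to products of powers of 1 + c and c, hence to polynomials in
  \<open>c\<close>. Conversely 1 and \<open>c\<close> are reductions in weight 4, and weights add
  under products.\<close>

theorem Mall_eq: "Mall = range (\<lambda>p. poly_subst p c_bit)"
proof (intro equalityI subsetI)
  fix f assume "f \<in> range (\<lambda>p. poly_subst p c_bit)"
  then show "f \<in> Mall" using Mk_poly unfolding Mall_def by blast
next
  fix f assume "f \<in> Mall"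
  then obtain m F a where f: "f = Abs_fps (\<lambda>n. of_int (a n))" "modular_form_Gamma0_5 (4 * m) F" "int_expansion F a"
    by (auto simp: Mall_def Mk_def)
  obtain s where s: "Abs_fps a = (\<Sum>i\<le>2 * m. fps_const (s i) * (a_fps ^ (2 * m - i) * c_fps ^ i))"
    using modular_form_int_basis[OF f(2,3)] by blast
  have "f = fps_of_int_fps (Abs_fps a)" by (simp add: f(1) fps_of_int_fps_def)
  also have "\<dots> = (\<Sum>i\<le>2 * m. fps_const (of_int (s i)) * (a_bit ^ (2 * m - i) * c_bit ^ i))"
    by (simp add: s a_bit_def c_bit_def)
  also have "\<dots> = poly_subst (\<Sum>i\<le>2 * m. smult (of_int (s i)) ([:1, 1:] ^ (2 * m - i) * [:0, 1:] ^ i)) c_bit"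
  proof -
    have "poly_subst (\<Sum>i\<in>I. h i) g = (\<Sum>i\<in>I. poly_subst (h i) g)" if "finite I" for I :: "nat set" and h g
      using that by (induction I rule: finite_induct) simp_all
    then show ?thesis by (simp add: a_bit_conv_c_bit)
  qed
  finally show "f \<in> range (\<lambda>p. poly_subst p c_bit)" by blast
qed

section \<open>Gauss' identity modulo 2\<close>

text \<open>Shanks' telescoping proof of Gauss' identity for the triangular numbers.\<close>

definition shanks_prod :: "nat \<Rightarrow> 'a::field fps" where
  "shanks_prod n = (\<Prod>s<n. (1 - fps_X ^ (2 * s + 2)) * inverse (1 - fps_X ^ (2 * s + 1)))"

lemma shanks_prod_nth_0 [simp]: "fps_nth (shanks_prod n) 0 = 1"
  by (induction n) (simp_all add: shanks_prod_def)

lemma shanks_prod_Suc: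
  "shanks_prod (Suc n) = shanks_prod n * ((1 - fps_X ^ (2 * n + 2)) * inverse (1 - fps_X ^ (2 * n + 1)))"
  by (simp add: shanks_prod_def)

lemma fps_mult_inverse_1: "fps_nth (f :: 'a::field fps) 0 = 1 \<Longrightarrow> f * inverse f = 1"
  by (rule inverse_mult_eq_1') simp

lemma shanks_prod_inverse_Suc:
  "(1 - fps_X ^ (2 * s + 2)) * inverse (shanks_prod (Suc s)) = (1 - fps_X ^ (2 * s + 1)) * inverse (shanks_prod s :: 'a::field fps)"
proof -
  define u v P where "u = (1 - fps_X ^ (2 * s + 2) :: 'a fps)" and "v = (1 - fps_X ^ (2 * s + 1) :: 'a fps)"
    and "P = (shanks_prod s :: 'a fps)"
  have [simp]: "fps_nth u 0 = 1" "fps_nth v 0 = 1" "fps_nth P 0 = 1" by (simp_all add: u_def v_def P_def)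
  have "inverse (P * (u * inverse v)) = inverse P * (inverse u * v)"
    by (simp add: fps_inverse_mult fps_inverse_idempotent)
  then have "u * inverse (P * (u * inverse v)) = (u * inverse u) * (v * inverse P)"
    by (simp add: mult_ac)
  also have "u * inverse u = 1" by (rule fps_mult_inverse_1) simp
  finally show ?thesis by (simp add: shanks_prod_Suc u_def v_def P_def)
qed

text \<open>Mediates between sum and product: from n to n + 1 it gains two triangular powers, while
  its term s = 0 is \<open>shanks_prod n\<close> and all other terms have order above 2n.\<close>

definition shanks_sum :: "nat \<Rightarrow> 'a::field fps" where
  "shanks_sum n = (\<Sum>s<n. shanks_prod n * inverse (shanks_prod s) * fps_X ^ (s * (2 * n + 1)))"

lemma shanks_sum_Suc:
  "shanks_sum (Suc n) = (shanks_sum n :: 'a::field fps) + fps_X ^ (n * (2 * n + 1)) + fps_X ^ (Suc n * (2 * n + 1))"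
proof -
  define y P where "y = (fps_X ^ (2 * n + 1) :: 'a fps)" and "P = (shanks_prod n :: 'a fps)"
  define i where "i = inverse (1 - y)"
  \<comment> \<open>The telescoping certificate: the change of a summand from n to n + 1 is
    \<open>P\<close> times the difference of \<open>E\<close> at s + 1 and at s.\<close>
  define E where "E s = y ^ s * (1 - fps_X ^ (2 * s)) * inverse (shanks_prod s) * i" for s
  have yi: "(1 - y) * i = 1" unfolding i_def by (rule fps_mult_inverse_1) (simp add: y_def)
  have PS: "shanks_prod (Suc n) = P * ((1 - fps_X * y) * i)"
    by (simp add: shanks_prod_Suc P_def i_def y_def)
  have E1: "E (Suc s) = y ^ s * y * ((1 - fps_X * fps_X ^ (2 * s)) * inverse (shanks_prod s)) * i" for s
    using shanks_prod_inverse_Suc[of s, where 'a = 'a] by (simp add: E_def mult_ac)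
  have summand: "shanks_prod (Suc n) * inverse (shanks_prod s) * fps_X ^ (s * (2 * Suc n + 1)) - P * inverse (shanks_prod s) * y ^ s
    = P * (E (Suc s) - E s)" for s
  proof -
    define x Q where "x = (fps_X ^ (2 * s) :: 'a fps)" and "Q = inverse (shanks_prod s :: 'a fps)"
    have "(fps_X :: 'a fps) ^ (s * (2 * Suc n + 1)) = y ^ s * x"
      by (simp add: y_def x_def power_mult [symmetric] power_add [symmetric] algebra_simps del: power_Suc)
    then have "shanks_prod (Suc n) * inverse (shanks_prod s) * fps_X ^ (s * (2 * Suc n + 1)) - P * inverse (shanks_prod s) * y ^ s
      = P * ((1 - fps_X * y) * i) * Q * (y ^ s * x) - P * Q * y ^ s * ((1 - y) * i)"
      by (simp only: PS Q_def yi mult_1_right)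
    also have "\<dots> = P * (y ^ s * y * ((1 - fps_X * x) * Q) * i - y ^ s * (1 - x) * Q * i)"
      by (simp add: algebra_simps)
    finally show ?thesis unfolding E1 by (simp only: E_def Q_def x_def)
  qed
  have "shanks_sum (Suc n) - (\<Sum>s<Suc n. P * inverse (shanks_prod s) * y ^ s)
    = (\<Sum>s<Suc n. P * (E (Suc s) - E s))"
    unfolding shanks_sum_def sum_subtractf [symmetric] by (intro sum.cong refl summand)
  also have "\<dots> = P * (E (Suc n) - E 0)"
    unfolding sum_distrib_left [symmetric] by (subst sum_lessThan_telescope) simp
  also have "\<dots> = y ^ Suc n * ((1 - y) * i) * (P * inverse P)"
    by (simp add: E1) (simp add: E_def P_def y_def mult_ac)
  also have "\<dots> = y ^ Suc n"
    unfolding yi by (subst fps_mult_inverse_1) (simp_all add: P_def)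
  finally have 1: "shanks_sum (Suc n) = (\<Sum>s<Suc n. P * inverse (shanks_prod s) * y ^ s) + y ^ Suc n"
    by (simp add: algebra_simps)
  have "P * inverse (shanks_prod n) = 1" unfolding P_def by (rule fps_mult_inverse_1) simp
  then have "(\<Sum>s<Suc n. P * inverse (shanks_prod s) * y ^ s) = shanks_sum n + y ^ n"
    by (simp add: shanks_sum_def P_def y_def power_mult [symmetric] mult.commute del: power_Suc)
  with 1 show ?thesis
    by (simp add: y_def power_mult [symmetric] mult.commute del: power_Suc)
qed

lemma shanks_sum_eq: "shanks_sum n = (\<Sum>k<2 * n. fps_X ^ (k * (k + 1) div 2) :: 'a::field fps)"
proof (induction n)
  case (Suc n)
  have "2 * n * (2 * n + 1) div 2 = n * (2 * n + 1)" "(2 * n + 1) * (2 * n + 1 + 1) div 2 = Suc n * (2 * n + 1)"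
    by (simp_all add: algebra_simps)
  moreover have "(\<Sum>k<2 * Suc n. fps_X ^ (k * (k + 1) div 2) :: 'a fps)
    = (\<Sum>k<2 * n. fps_X ^ (k * (k + 1) div 2)) + fps_X ^ (2 * n * (2 * n + 1) div 2) + fps_X ^ ((2 * n + 1) * (2 * n + 1 + 1) div 2)"
    by (simp del: power_Suc)
  ultimately show ?case by (simp only: shanks_sum_Suc Suc)
qed (simp add: shanks_sum_def)

lemma shanks_sum_nth:
  assumes "m < 2 * n + 1" "n > 0"
  shows "fps_nth (shanks_sum n :: 'a::field fps) m = fps_nth (shanks_prod n) m"
proof -
  obtain k where n: "n = Suc k" using assms(2) gr0_conv_Suc by blast
  have "fps_nth (shanks_prod n * inverse (shanks_prod (Suc s)) * fps_X ^ (Suc s * (2 * n + 1)) :: 'a fps) m = 0" for s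
    using assms(1) by (simp add: fps_X_power_mult_right_nth del: power_Suc)
  then have "fps_nth (shanks_sum n :: 'a fps) m = fps_nth (shanks_prod n * inverse (shanks_prod 0)) m"
    unfolding shanks_sum_def n sum.lessThan_Suc_shift by (simp add: fps_sum_nth del: power_Suc)
  then show ?thesis by (simp add: shanks_prod_def)
qed

definition p_bit :: "bit fps" where "p_bit = fps_of_int_fps euler_fps"

definition triangular_fps :: "bit fps" where
  "triangular_fps = Abs_fps (\<lambda>m. if \<exists>k. m = k * (k + 1) div 2 then 1 else 0)"

lemma fps_mult_nth_cong:
  assumes "\<And>i. i \<le> n \<Longrightarrow> fps_nth f i = fps_nth f' i" "\<And>i. i \<le> n \<Longrightarrow> fps_nth g i = fps_nth g' i"
  shows "fps_nth (f * g) n = fps_nth (f' * g') n"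
  unfolding fps_mult_nth using assms by (intro sum.cong) auto

text \<open>Different indices must give different exponents, lest coefficients cancel modulo
  2.\<close>

lemma triangular_inj: "k * (k + 1) div 2 = l * (l + 1) div 2 \<Longrightarrow> k = (l::nat)"
proof (rule ccontr)
  have *: "k * (k + 1) div 2 < l * (l + 1) div 2" if "k < l" for k l :: nat
  proof -
    have "(k + 1) * (k + 2) div 2 = k * (k + 1) div 2 + (k + 1)"
      by (simp add: algebra_simps)
    moreover have "(k + 1) * (k + 2) div 2 \<le> l * (l + 1) div 2"
      using that by (intro div_le_mono mult_le_mono) auto
    ultimately show ?thesis by simp
  qed
  assume "k * (k + 1) div 2 = l * (l + 1) div 2" "k \<noteq> l"
  then show False using *[of k l] *[of l k] by linarith
qed

text \<open>In the product of \<open>shanks_prod\<close> with the Euler product, the odd factors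
  cancel and the even ones are squared. As 1 - q^(2k) is a square modulo 2, this gives
  \<open>p_bit ^ 4\<close>, while Gauss' identity gives
  \<open>p_bit * triangular_fps\<close>.\<close>

theorem p_bit_cube: "p_bit ^ 3 = triangular_fps"
proof -
  define e where "e n = (\<Prod>k<n. 1 - fps_X ^ Suc k :: bit fps)" for n
  have e_nth: "fps_nth (e N) n = fps_nth p_bit n" if "n \<le> N" for n N
  proof -
    have "e N = fps_of_int_fps (\<Prod>k<N. 1 - fps_X ^ Suc k)"
      by (simp add: e_def del: power_Suc)
    then show ?thesis using euler_fps_nth[OF that] by (simp only: p_bit_def fps_nth_of_int_fps)
  qed
  have e4: "e (2 * n) * shanks_prod n = (e n ^ 2) ^ 2" for n
  proof (induction n)
    case (Suc n)
    define u v where "u = (1 - fps_X ^ (2 * n + 2) :: bit fps)" and "v = (1 - fps_X ^ (2 * n + 1) :: bit fps)"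
    have vi: "v * inverse v = 1" by (rule fps_mult_inverse_1) (simp add: v_def)
    have u2: "u = (1 - fps_X ^ Suc n)\<^sup>2"
      by (simp add: u_def bit_fps_square_add power_mult [symmetric] algebra_simps del: power_Suc)
    have "e (2 * Suc n) * shanks_prod (Suc n) = (e (2 * n) * shanks_prod n) * (v * inverse v) * (u * u)"
      by (simp add: e_def shanks_prod_Suc u_def v_def mult_ac del: bit_fps_diff)
    also have "\<dots> = (e n ^ 2) ^ 2 * (((1 - fps_X ^ Suc n)\<^sup>2) ^ 2)"
      unfolding Suc vi by (simp only: u2 power2_eq_square mult_1_right)
    also have "\<dots> = (e (Suc n) ^ 2) ^ 2"
      by (simp add: e_def power_mult_distrib del: power_Suc bit_fps_diff)
    finally show ?case .
  qed (simp add: e_def shanks_prod_def)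
  have "p_bit * triangular_fps = (p_bit ^ 2) ^ 2"
  proof (rule fps_ext)
    fix m
    define n where "n = Suc m"
    have "fps_nth triangular_fps i = fps_nth (shanks_sum n) i" if "i \<le> m" for i
    proof -
      have "fps_nth (shanks_sum n :: bit fps) i = (\<Sum>k<2 * n. if i = k * (k + 1) div 2 then 1 else 0)"
        by (simp add: shanks_sum_eq fps_sum_nth)
      also have "\<dots> = (if \<exists>k. i = k * (k + 1) div 2 then 1 else 0)"
      proof (cases "\<exists>k. i = k * (k + 1) div 2")
        case True
        then obtain k where k: "i = k * (k + 1) div 2" by blast
        have "k \<le> i" 
        proof (cases k)
          case (Suc l)
          have "k * 2 div 2 \<le> k * (k + 1) div 2" unfolding Suc by (intro div_le_mono mult_le_mono) auto
          then show ?thesis by (simp add: k)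
        qed simp
        then have "k < 2 * n" using that by (simp add: n_def)
        moreover have "i = j * (j + 1) div 2 \<longleftrightarrow> j = k" for j
          unfolding k using triangular_inj by blast
        ultimately show ?thesis using True by (simp add: sum.delta)
      qed (auto intro: sum.neutral)
      finally show ?thesis by (simp add: triangular_fps_def)
    qed
    moreover have "fps_nth (shanks_sum n :: bit fps) i = fps_nth (shanks_prod n) i" if "i \<le> m" for i
      using that by (intro shanks_sum_nth) (auto simp: n_def)
    ultimately have "fps_nth (p_bit * triangular_fps) m = fps_nth (e (2 * n) * shanks_prod n) m"
      by (intro fps_mult_nth_cong) (auto simp: e_nth n_def)
    also have "\<dots> = fps_nth ((p_bit ^ 2) ^ 2) m"
      unfolding e4 bit_fps_square_nth by (simp add: e_nth n_def)
    finally show "fps_nth (p_bit * triangular_fps) m = fps_nth ((p_bit ^ 2) ^ 2) m" .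
  qed
  also have "\<dots> = p_bit * p_bit ^ 3" by (simp add: eval_nat_numeral)
  finally have "p_bit * triangular_fps = p_bit * p_bit ^ 3" .
  moreover have "p_bit \<noteq> 0"
  proof
    assume "p_bit = 0"
    then have "fps_nth p_bit 0 = 0" by simp
    then show False by (simp add: p_bit_def)
  qed
  ultimately show ?thesis by simp
qed

text \<open>Squaring three times turns \<open>p_bit ^ 3\<close> into \<open>p_bit ^ 24\<close> and
  multiplies the triangular exponents by 8; then 8 k(k + 1)/2 + 1 = (2k + 1)^2. So F is the
  reduction of the discriminant form.\<close>

lemma Fser_eq: "Fser = fps_X * p_bit ^ 24"
proof (rule fps_ext)
  fix m
  have "p_bit ^ 24 = (((p_bit ^ 3)\<^sup>2)\<^sup>2)\<^sup>2" by (simp flip: power_mult)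
  then have *: "p_bit ^ 24 = ((triangular_fps\<^sup>2)\<^sup>2)\<^sup>2" by (simp only: p_bit_cube)
  have nth: "fps_nth (p_bit ^ 24) n = (if 8 dvd n then fps_nth triangular_fps (n div 8) else 0)" for n
  proof -
    have "(even n \<and> even (n div 2) \<and> even (n div 2 div 2)) = (8 dvd n)" by presburger
    moreover have "n div 2 div 2 div 2 = n div 8" by (simp add: div_mult2_eq [symmetric])
    ultimately show ?thesis unfolding * by (auto simp only: bit_fps_square_nth if_True if_False split: if_splits)
  qed
  show "fps_nth Fser m = fps_nth (fps_X * p_bit ^ 24) m"
  proof (cases m)
    case 0
    then show ?thesis by (auto simp: Fser_def elim: oddE)
  next
    case (Suc n)
    have "(\<exists>k. odd k \<and> Suc n = k\<^sup>2) \<longleftrightarrow> 8 dvd n \<and> (\<exists>k. n div 8 = k * (k + 1) div 2)"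
    proof
      assume "\<exists>k. odd k \<and> Suc n = k\<^sup>2"
      then obtain l where "Suc n = (2 * l + 1)\<^sup>2" by (auto elim: oddE)
      moreover have "(2 * l + 1)\<^sup>2 = Suc (8 * (l * (l + 1) div 2))"
      proof -
        have "2 * (l * (l + 1) div 2) = l * (l + 1)" by simp
        then have "8 * (l * (l + 1) div 2) = 4 * (l * (l + 1))" by linarith
        then show ?thesis by (simp add: power2_eq_square algebra_simps)
      qed
      ultimately have "n = 8 * (l * (l + 1) div 2)" by simp
      then show "8 dvd n \<and> (\<exists>k. n div 8 = k * (k + 1) div 2)" by auto
    next
      assume "8 dvd n \<and> (\<exists>k. n div 8 = k * (k + 1) div 2)"
      then obtain k where k: "n = 8 * (k * (k + 1) div 2)" by (metis dvd_mult_div_cancel)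
      have "2 * (k * (k + 1) div 2) = k * (k + 1)" by simp
      then have "n = 4 * (k * (k + 1))" using k by linarith
      then have "Suc n = (2 * k + 1)\<^sup>2" by (simp add: power2_eq_square algebra_simps)
      then show "\<exists>k. odd k \<and> Suc n = k\<^sup>2" by (intro exI[of _ "2 * k + 1"]) auto
    qed
    then show ?thesis by (simp add: Suc Fser_def nth triangular_fps_def)
  qed
qed

lemma Gser_eq_sub5: "Gser = fps_sub5 Fser"
proof (rule fps_ext)
  fix m
  show "fps_nth Gser m = fps_nth (fps_sub5 Fser) m"
  proof (cases "5 dvd m")
    case True
    then obtain k where "m = 5 * k" by blast
    then show ?thesis by (simp add: Gser_def Fser_def fps_nth_sub5)
  next
    case False
    then show ?thesis by (auto simp: Gser_def fps_nth_sub5)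
  qed
qed

section \<open>The odd part of the ring of modular forms modulo 2\<close>

lemma fps_sub5_mult: "fps_sub5 (f * g :: 'a::idom fps) = fps_sub5 f * fps_sub5 g"
  unfolding fps_sub5_conv_compose by (rule fps_compose_mult_distrib) simp

lemma fps_sub5_add: "fps_sub5 (f + g :: 'a::idom fps) = fps_sub5 f + fps_sub5 g"
  by (auto simp: fps_eq_iff fps_nth_sub5)

lemma fps_sub5_1: "fps_sub5 1 = 1"
  by (auto simp: fps_eq_iff fps_nth_sub5 elim: dvdE)

lemma fps_sub5_power: "fps_sub5 (f ^ n :: 'a::idom fps) = fps_sub5 f ^ n"
  by (induction n) (simp_all add: fps_sub5_mult fps_sub5_1)

lemma fps_sub5_const: "fps_sub5 (fps_const b) = fps_const b"
  by (auto simp: fps_eq_iff fps_nth_sub5)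

lemma fps_sub5_eq_0_iff: "fps_sub5 f = 0 \<longleftrightarrow> f = 0"
proof
  assume *: "fps_sub5 f = 0"
  show "f = 0"
  proof (rule fps_ext)
    fix n show "fps_nth f n = fps_nth 0 n"
      using arg_cong[OF *, of "\<lambda>g. fps_nth g (5 * n)"] by (simp add: fps_nth_sub5)
  qed
qed (simp add: fps_eq_iff fps_nth_sub5)

lemma fps_sub5_poly_subst: "fps_sub5 (poly_subst p g) = poly_subst p (fps_sub5 g)"
  by (induction p) (simp_all add: fps_sub5_eq_0_iff fps_sub5_add fps_sub5_mult fps_sub5_const)

lemma bit_fps_add_left_self [simp]: "(f :: bit fps) + (f + g) = g"
  by (simp flip: add.assoc)

text \<open>This is \<open>a c\<close> = \<open>F + G\<close> and also q times the derivative of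
  \<open>c\<close>. As \<open>u_bit\<close> is a square, its derivative vanishes, and the odd
  elements of M become \<open>d_bit\<close> times polynomials in \<open>u_bit\<close>.\<close>

definition d_bit :: "bit fps" where "d_bit = c_bit + c_bit\<^sup>2"
definition u_bit :: "bit fps" where "u_bit = c_bit\<^sup>2"

lemma Fser_c: "Fser = a_bit ^ 5 * c_bit" and Gser_c: "Gser = a_bit * c_bit ^ 5"
proof -
  define p5 where "p5 = fps_sub5 p_bit"
  have nz: "p5 \<noteq> 0" "p_bit \<noteq> 0"
  proof -
    have "fps_nth p_bit 0 \<noteq> 0" "fps_nth p5 0 \<noteq> 0" by (simp_all add: p_bit_def p5_def)
    then show "p5 \<noteq> 0" "p_bit \<noteq> 0" by auto
  qed
  have "a_fps * fps_sub5 euler_fps = euler_fps ^ 5"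
    using int_fps_inverse[of "fps_sub5 euler_fps"] by (simp add: a_fps_def mult.assoc) (simp add: mult.commute)
  then have "fps_of_int_fps (a_fps * fps_sub5 euler_fps) = (fps_of_int_fps (euler_fps ^ 5) :: bit fps)" by simp
  then have a: "a_bit * p5 = p_bit ^ 5"
    by (simp add: a_bit_def p5_def p_bit_def fps_of_int_fps_sub5)
  have "c_fps * euler_fps = fps_X * fps_sub5 euler_fps ^ 5"
    using int_fps_inverse[of euler_fps] by (simp add: c_fps_def u_fps_def mult.assoc) (simp add: mult.commute)
  then have "fps_of_int_fps (c_fps * euler_fps) = (fps_of_int_fps (fps_X * fps_sub5 euler_fps ^ 5) :: bit fps)" by simp
  then have c: "c_bit * p_bit = fps_X * p5 ^ 5"
    by (simp add: c_bit_def p5_def p_bit_def fps_of_int_fps_sub5)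
  have "(a_bit ^ 5 * c_bit) * (p5 ^ 5 * p_bit) = (a_bit * p5) ^ 5 * (c_bit * p_bit)"
    by (simp add: power_mult_distrib mult_ac)
  also have "\<dots> = (fps_X * p_bit ^ 24) * (p5 ^ 5 * p_bit)"
    unfolding a c by (simp add: power_mult [symmetric] mult_ac flip: power_Suc)
  finally show "Fser = a_bit ^ 5 * c_bit"
    using nz by (simp add: Fser_eq)
  have "Gser = fps_sub5 fps_X * p5 ^ 24"
    by (simp add: Gser_eq_sub5 Fser_eq fps_sub5_mult fps_sub5_power p5_def)
  also have "fps_sub5 fps_X = (fps_X ^ 5 :: bit fps)"
    by (simp add: fps_sub5_conv_compose)
  finally have G: "Gser = fps_X ^ 5 * p5 ^ 24" .
  have "(a_bit * c_bit ^ 5) * (p5 * p_bit ^ 5) = (a_bit * p5) * (c_bit * p_bit) ^ 5"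
    by (simp add: power_mult_distrib mult_ac)
  also have "\<dots> = (fps_X ^ 5 * p5 ^ 24) * (p5 * p_bit ^ 5)"
    unfolding a c by (simp add: power_mult_distrib power_mult [symmetric] mult_ac flip: power_Suc)
  finally show "Gser = a_bit * c_bit ^ 5"
    using nz by (simp add: G)
qed

lemma c_bit_nonzero: "c_bit \<noteq> 0"
  using c_bit_nth(2) by auto

lemma poly_subst_c_bit_eq_0: "poly_subst p c_bit = 0 \<Longrightarrow> p = 0"
proof (induction p)
  case (pCons b p)
  then have *: "fps_const b + c_bit * poly_subst p c_bit = 0" by simp
  have "b = 0" using arg_cong[OF *, of "\<lambda>f. fps_nth f 0"] c_bit_nth(1) by simp
  then show ?case using * pCons.IH c_bit_nonzero by simp
qed simp

lemma u_bit_conv_poly: "u_bit = poly_subst [:0, 0, 1:] c_bit"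
  by (simp add: u_bit_def power2_eq_square)

lemma poly_subst_u_bit_eq_0:
  assumes "poly_subst p u_bit = 0" shows "p = 0"
proof -
  have "pcompose p [:0, 0, 1:] = 0"
    using assms by (intro poly_subst_c_bit_eq_0) (simp add: u_bit_conv_poly del: poly_subst_pCons)
  then show ?thesis by (simp add: pcompose_eq_0)
qed

lemma d_bit_squared: "d_bit\<^sup>2 = u_bit + u_bit\<^sup>2"
  by (simp add: d_bit_def u_bit_def bit_fps_square_add)

lemma d_bit_nonzero: "d_bit \<noteq> 0"
proof -
  have "fps_nth d_bit 1 = 1" using c_bit_nth by (simp add: d_bit_def bit_fps_square_nth)
  then show ?thesis by auto
qed

lemma a_bit_squared: "a_bit\<^sup>2 = 1 + u_bit"
  by (simp add: a_bit_conv_c_bit bit_fps_square_add u_bit_def)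

lemma d_bit_ac: "d_bit = a_bit * c_bit"
  by (simp add: d_bit_def a_bit_conv_c_bit distrib_right power2_eq_square)

lemma Fser_d: "Fser = d_bit * (1 + u_bit\<^sup>2)"
proof -
  have "Fser = (a_bit * c_bit) * (a_bit\<^sup>2)\<^sup>2" by (simp add: Fser_c eval_nat_numeral mult_ac)
  also have "(a_bit\<^sup>2)\<^sup>2 = 1 + u_bit\<^sup>2" by (simp only: a_bit_squared bit_fps_square_add) simp
  finally show ?thesis by (simp add: d_bit_ac)
qed

lemma Gser_d: "Gser = d_bit * u_bit\<^sup>2"
  by (simp add: Gser_c d_bit_ac u_bit_def eval_nat_numeral mult_ac)

lemma Fser_plus_Gser: "Fser + Gser = d_bit"
  by (simp add: Fser_d Gser_d distrib_left add.assoc)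

lemma Gser_squared: "Gser\<^sup>2 = u_bit ^ 5 + u_bit ^ 6"
  by (simp add: Gser_d power_mult_distrib d_bit_squared algebra_simps flip: power_mult power_add power_Suc)

lemma Gser_nonzero: "Gser \<noteq> 0"
proof -
  have "u_bit \<noteq> 0" using c_bit_nonzero by (simp add: u_bit_def)
  then show ?thesis by (simp add: Gser_d d_bit_nonzero)
qed

lemma F_G_relation: "d_bit ^ 6 = Fser * Gser"
  by (simp add: Fser_c Gser_c d_bit_ac power_mult_distrib eval_nat_numeral mult_ac)

text \<open>Identities over the field with two elements, decided by evaluation in
  \<open>bit poly\<close>. At u = \<open>u_bit\<close>, \<open>u ^ 5 + u ^ 6\<close> stands for
  \<open>Gser\<^sup>2\<close> and \<open>u + u\<^sup>2\<close> for \<open>d_bit\<^sup>2\<close>;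
  they treat J9, J7, \<open>F^5\<close> and \<open>F^8\<close>, in this order.\<close>

lemma u_polynomial_identities:
  fixes u :: "bit fps"
  shows "(u\<^sup>2 + u ^ 4) * (1 + u\<^sup>2) ^ 4 * u\<^sup>2 = u ^ 4 + u ^ 5 + (u ^ 5 + u ^ 6) + (u ^ 5 + u ^ 6)\<^sup>2 * u\<^sup>2"
    and "(u + u\<^sup>2) * (1 + u\<^sup>2)\<^sup>2 * u\<^sup>2 = u ^ 3 + u ^ 4 + (u ^ 5 + u ^ 6) * u\<^sup>2"
    and "(u\<^sup>2 + u ^ 4) * (1 + u\<^sup>2) ^ 5
      = u ^ 5 + u\<^sup>2 + ((u ^ 5 + u ^ 6) + (u ^ 5 + u ^ 6)\<^sup>2) * (1 + u\<^sup>2) + (u ^ 5 + u ^ 6) * u\<^sup>2"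
    and "(u ^ 4 + u ^ 8) * (1 + u\<^sup>2) ^ 8
      = (u + u\<^sup>2) * u\<^sup>2 * (u + (u + u\<^sup>2) * (1 + u\<^sup>2)\<^sup>2 * u\<^sup>2 + (1 + (u ^ 5 + u ^ 6) + (u ^ 5 + u ^ 6) ^ 3) * u\<^sup>2)"
proof -
  define X :: "bit poly" where "X = [:0, 1:]"
  have X: "poly_subst X u = u" by (simp add: X_def)
  have "(X\<^sup>2 + X ^ 4) * (1 + X\<^sup>2) ^ 4 * X\<^sup>2 = X ^ 4 + X ^ 5 + (X ^ 5 + X ^ 6) + (X ^ 5 + X ^ 6)\<^sup>2 * X\<^sup>2"
    unfolding X_def by code_simp
  from arg_cong[OF this, of "\<lambda>p. poly_subst p u"]
  show "(u\<^sup>2 + u ^ 4) * (1 + u\<^sup>2) ^ 4 * u\<^sup>2 = u ^ 4 + u ^ 5 + (u ^ 5 + u ^ 6) + (u ^ 5 + u ^ 6)\<^sup>2 * u\<^sup>2"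
    by (simp only: poly_subst_add poly_subst_mult poly_subst_power poly_subst_1 X)
  have "(X + X\<^sup>2) * (1 + X\<^sup>2)\<^sup>2 * X\<^sup>2 = X ^ 3 + X ^ 4 + (X ^ 5 + X ^ 6) * X\<^sup>2"
    unfolding X_def by code_simp
  from arg_cong[OF this, of "\<lambda>p. poly_subst p u"]
  show "(u + u\<^sup>2) * (1 + u\<^sup>2)\<^sup>2 * u\<^sup>2 = u ^ 3 + u ^ 4 + (u ^ 5 + u ^ 6) * u\<^sup>2"
    by (simp only: poly_subst_add poly_subst_mult poly_subst_power poly_subst_1 X)
  have "(X\<^sup>2 + X ^ 4) * (1 + X\<^sup>2) ^ 5
      = X ^ 5 + X\<^sup>2 + ((X ^ 5 + X ^ 6) + (X ^ 5 + X ^ 6)\<^sup>2) * (1 + X\<^sup>2) + (X ^ 5 + X ^ 6) * X\<^sup>2"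
    unfolding X_def by code_simp
  from arg_cong[OF this, of "\<lambda>p. poly_subst p u"]
  show "(u\<^sup>2 + u ^ 4) * (1 + u\<^sup>2) ^ 5
      = u ^ 5 + u\<^sup>2 + ((u ^ 5 + u ^ 6) + (u ^ 5 + u ^ 6)\<^sup>2) * (1 + u\<^sup>2) + (u ^ 5 + u ^ 6) * u\<^sup>2"
    by (simp only: poly_subst_add poly_subst_mult poly_subst_power poly_subst_1 X)
  have "(X ^ 4 + X ^ 8) * (1 + X\<^sup>2) ^ 8
      = (X + X\<^sup>2) * X\<^sup>2 * (X + (X + X\<^sup>2) * (1 + X\<^sup>2)\<^sup>2 * X\<^sup>2 + (1 + (X ^ 5 + X ^ 6) + (X ^ 5 + X ^ 6) ^ 3) * X\<^sup>2)"
    unfolding X_def by code_simp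
  from arg_cong[OF this, of "\<lambda>p. poly_subst p u"]
  show "(u ^ 4 + u ^ 8) * (1 + u\<^sup>2) ^ 8
      = (u + u\<^sup>2) * u\<^sup>2 * (u + (u + u\<^sup>2) * (1 + u\<^sup>2)\<^sup>2 * u\<^sup>2 + (1 + (u ^ 5 + u ^ 6) + (u ^ 5 + u ^ 6) ^ 3) * u\<^sup>2)"
    by (simp only: poly_subst_add poly_subst_mult poly_subst_power poly_subst_1 X)
qed

lemma d_bit_powers: "d_bit ^ 4 = u_bit\<^sup>2 + u_bit ^ 4" "d_bit ^ 8 = u_bit ^ 4 + u_bit ^ 8"
proof -
  have "d_bit ^ 4 = (d_bit\<^sup>2)\<^sup>2" by (simp flip: power_mult)
  then show 4: "d_bit ^ 4 = u_bit\<^sup>2 + u_bit ^ 4"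
    unfolding d_bit_squared bit_fps_square_add by (simp flip: power_mult)
  have "d_bit ^ 8 = (d_bit ^ 4)\<^sup>2" by (simp flip: power_mult)
  then show "d_bit ^ 8 = u_bit ^ 4 + u_bit ^ 8"
    unfolding 4 bit_fps_square_add by (simp flip: power_mult)
qed

lemma Gser_squared': "u_bit ^ 5 + u_bit ^ 6 = Gser\<^sup>2"
  by (simp add: Gser_squared)

text \<open>With the formulas for J7, \<open>F^5\<close> and J3 below, this is a triangular system
  for \<open>d_bit * u_bit ^ n\<close> with n = 1, 3, 4, 5; for n = 0 and n = 2 these are F + G and
  G.\<close>

lemma J9_u: "J9 = d_bit * (u_bit ^ 4 + u_bit ^ 5) + Gser\<^sup>2 * d_bit + (Gser\<^sup>2)\<^sup>2 * Gser"
proof -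
  define w where w: "w = Gser\<^sup>2"
  have "J9 = d_bit * ((u_bit\<^sup>2 + u_bit ^ 4) * (1 + u_bit\<^sup>2) ^ 4 * u_bit\<^sup>2)"
    unfolding J9_def Fser_d Gser_d power_mult_distrib d_bit_powers by (simp only: mult_ac)
  then show ?thesis
    unfolding u_polynomial_identities(1) Gser_squared'
    unfolding w [symmetric] unfolding Gser_d by (simp only: distrib_left mult_ac)
qed

lemma J7_u: "J7 = d_bit * (u_bit ^ 3 + u_bit ^ 4) + Gser\<^sup>2 * Gser"
proof -
  define w where w: "w = Gser\<^sup>2"
  have "J7 = d_bit * ((u_bit + u_bit\<^sup>2) * (1 + u_bit\<^sup>2)\<^sup>2 * u_bit\<^sup>2)"
    unfolding J7_def Fser_d Gser_d power_mult_distrib d_bit_squared by (simp only: mult_ac)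
  then show ?thesis
    unfolding u_polynomial_identities(2) Gser_squared'
    unfolding w [symmetric] unfolding Gser_d by (simp only: distrib_left mult_ac)
qed

lemma F5_u: "Fser ^ 5 = d_bit * u_bit ^ 5 + Gser + (Gser\<^sup>2 + (Gser\<^sup>2)\<^sup>2) * Fser + Gser\<^sup>2 * Gser"
proof -
  define w where w: "w = Gser\<^sup>2"
  have "d_bit ^ 5 = d_bit * (u_bit\<^sup>2 + u_bit ^ 4)"
    unfolding d_bit_powers(1) [symmetric] by (simp flip: power_Suc)
  then have "Fser ^ 5 = d_bit * ((u_bit\<^sup>2 + u_bit ^ 4) * (1 + u_bit\<^sup>2) ^ 5)"
    unfolding Fser_d power_mult_distrib by (simp only: mult_ac)
  then show ?thesis
    unfolding u_polynomial_identities(3) Gser_squared'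
    unfolding w [symmetric] unfolding Gser_d Fser_d by (simp only: distrib_left distrib_right mult_ac add_ac)
qed

lemma J3_u: "J3 = d_bit * u_bit + J7 + (1 + Gser\<^sup>2 + (Gser\<^sup>2) ^ 3) * Gser"
proof -
  define w where w: "w = Gser\<^sup>2"
  define X where "X = d_bit * u_bit + J7 + (1 + Gser\<^sup>2 + (Gser\<^sup>2) ^ 3) * Gser"
  have "J7 = d_bit * ((u_bit + u_bit\<^sup>2) * (1 + u_bit\<^sup>2)\<^sup>2 * u_bit\<^sup>2)"
    unfolding J7_def Fser_d Gser_d power_mult_distrib d_bit_squared by (simp only: mult_ac)
  then have X: "X = d_bit * (u_bit + (u_bit + u_bit\<^sup>2) * (1 + u_bit\<^sup>2)\<^sup>2 * u_bit\<^sup>2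
      + (1 + (u_bit ^ 5 + u_bit ^ 6) + (u_bit ^ 5 + u_bit ^ 6) ^ 3) * u_bit\<^sup>2)"
    unfolding X_def Gser_squared' w [symmetric] unfolding Gser_d by (simp only: distrib_left mult_ac)
  have "Fser ^ 8 = (u_bit ^ 4 + u_bit ^ 8) * (1 + u_bit\<^sup>2) ^ 8"
    unfolding Fser_d power_mult_distrib d_bit_powers ..
  also have "\<dots> = d_bit\<^sup>2 * u_bit\<^sup>2 * (u_bit + (u_bit + u_bit\<^sup>2) * (1 + u_bit\<^sup>2)\<^sup>2 * u_bit\<^sup>2
      + (1 + (u_bit ^ 5 + u_bit ^ 6) + (u_bit ^ 5 + u_bit ^ 6) ^ 3) * u_bit\<^sup>2)"
    unfolding u_polynomial_identities(4) d_bit_squared ..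
  also have "\<dots> = X * Gser"
    unfolding X Gser_d power2_eq_square[of d_bit] by (simp only: mult_ac)
  finally have "Fser ^ 8 = X * Gser" .
  then have "J3 = X"
    using Gser_nonzero by (simp add: J3_def)
  then show ?thesis unfolding X_def .
qed

text \<open>The quotient in the definition of J3 is exact: by F = a^5 c and G = a c^5, it equals
  a^39 c^3.\<close>

lemma J3_mult_Gser: "J3 * Gser = Fser ^ 8"
proof -
  have "Gser dvd Fser ^ 8"
    unfolding Gser_c Fser_c
    by (intro dvdI[of _ _ "a_bit ^ 39 * c_bit ^ 3"])
      (simp add: power_mult_distrib power_mult [symmetric] mult_ac flip: power_Suc power_add)
  then show ?thesis by (simp add: J3_def)
qed

text \<open>The coefficients belong to G, J1, J3, J7, J9, \<open>F^5\<close> in this order. Six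
  generators match the degree 6 of \<open>Gser\<^sup>2\<close> in u; \<open>F^5\<close> lies outside
  the sum of N1, N2a and N2b, so \<open>q\<close> has to vanish in both kernels.\<close>

definition fps_span :: "bit poly \<Rightarrow> bit poly \<Rightarrow> bit poly \<Rightarrow> bit poly \<Rightarrow> bit poly \<Rightarrow> bit poly \<Rightarrow> bit fps" where
  "fps_span p0 p1 p3 p7 p9 q = poly_subst p0 (Gser\<^sup>2) * Gser + poly_subst p1 (Gser\<^sup>2) * J1
     + poly_subst p3 (Gser\<^sup>2) * J3 + poly_subst p7 (Gser\<^sup>2) * J7 + poly_subst p9 (Gser\<^sup>2) * J9
     + poly_subst q (Gser\<^sup>2) * Fser ^ 5"

lemma fps_span_add:
  "fps_span p0 p1 p3 p7 p9 q + fps_span p0' p1' p3' p7' p9' q'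
    = fps_span (p0 + p0') (p1 + p1') (p3 + p3') (p7 + p7') (p9 + p9') (q + q')"
  by (simp add: fps_span_def distrib_right add_ac)

lemma fps_span_mult_poly:
  "poly_subst r (Gser\<^sup>2) * fps_span p0 p1 p3 p7 p9 q = fps_span (r * p0) (r * p1) (r * p3) (r * p7) (r * p9) (r * q)"
  by (simp add: fps_span_def distrib_left mult_ac)

definition in_span :: "bit fps \<Rightarrow> bool" where
  "in_span f \<longleftrightarrow> (\<exists>p0 p1 p3 p7 p9 q. f = fps_span p0 p1 p3 p7 p9 q)"

lemma in_span_add: "in_span f \<Longrightarrow> in_span g \<Longrightarrow> in_span (f + g)"
  unfolding in_span_def using fps_span_add by metis

lemma in_span_mult_poly: "in_span f \<Longrightarrow> in_span (poly_subst r (Gser\<^sup>2) * f)"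
  unfolding in_span_def using fps_span_mult_poly by metis

lemma in_span_mult: "in_span f \<Longrightarrow> in_span (Gser\<^sup>2 * f)"
  using in_span_mult_poly[of f "[:0, 1:]"] by simp

lemma in_span_generators:
  "in_span Gser" "in_span J1" "in_span J3" "in_span J7" "in_span J9" "in_span (Fser ^ 5)" "in_span 0"
proof -
  show "in_span Gser" unfolding in_span_def
    by (rule exI[of _ 1], rule exI[of _ 0], rule exI[of _ 0], rule exI[of _ 0], rule exI[of _ 0], rule exI[of _ 0])
       (simp add: fps_span_def)
  show "in_span J1" unfolding in_span_def
    by (rule exI[of _ 0], rule exI[of _ 1], rule exI[of _ 0], rule exI[of _ 0], rule exI[of _ 0], rule exI[of _ 0])
       (simp add: fps_span_def)
  show "in_span J3" unfolding in_span_def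
    by (rule exI[of _ 0], rule exI[of _ 0], rule exI[of _ 1], rule exI[of _ 0], rule exI[of _ 0], rule exI[of _ 0])
       (simp add: fps_span_def)
  show "in_span J7" unfolding in_span_def
    by (rule exI[of _ 0], rule exI[of _ 0], rule exI[of _ 0], rule exI[of _ 1], rule exI[of _ 0], rule exI[of _ 0])
       (simp add: fps_span_def)
  show "in_span J9" unfolding in_span_def
    by (rule exI[of _ 0], rule exI[of _ 0], rule exI[of _ 0], rule exI[of _ 0], rule exI[of _ 1], rule exI[of _ 0])
       (simp add: fps_span_def)
  show "in_span (Fser ^ 5)" unfolding in_span_def
    by (rule exI[of _ 0], rule exI[of _ 0], rule exI[of _ 0], rule exI[of _ 0], rule exI[of _ 0], rule exI[of _ 1])
       (simp add: fps_span_def)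
  show "in_span 0" unfolding in_span_def
    by (rule exI[of _ 0], rule exI[of _ 0], rule exI[of _ 0], rule exI[of _ 0], rule exI[of _ 0], rule exI[of _ 0])
       (simp add: fps_span_def)
qed

lemma in_span_cancel: "in_span (f + g) \<Longrightarrow> in_span g \<Longrightarrow> in_span f"
  using in_span_add[of "f + g" g] by (simp add: add.assoc)

text \<open>The triangular system is solved from n = 5 downwards; for larger n,
  \<open>u_bit ^ 6 = u_bit ^ 5 + Gser\<^sup>2\<close> lowers the exponent.\<close>

lemma in_span_d_u_power: "in_span (d_bit * u_bit ^ n)"
proof (induction n rule: less_induct)
  case (less n)
  note gens = in_span_generators
  have F: "in_span Fser" using gens(2) by (simp add: J1_def)
  have D: "in_span d_bit" unfolding Fser_plus_Gser [symmetric] by (intro in_span_add F gens)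
  have wm: "in_span ((Gser\<^sup>2)\<^sup>2 * f)" if "in_span f" for f
    using in_span_mult[OF in_span_mult[OF that]] by (simp add: power2_eq_square mult_ac)
  have 5: "in_span (d_bit * u_bit ^ 5)"
  proof -
    have "d_bit * u_bit ^ 5 = Fser ^ 5 + (Gser + Gser\<^sup>2 * Fser + (Gser\<^sup>2)\<^sup>2 * Fser + Gser\<^sup>2 * Gser)"
      unfolding F5_u by (simp only: distrib_right add_ac bit_fps_add_left_self bit_fps_add_self add_0_right add_0_left)
    then show ?thesis
      by (simp only:) (intro in_span_add in_span_mult wm gens F)
  qed
  have 4: "in_span (d_bit * u_bit ^ 4)"
  proof (rule in_span_cancel[OF _ 5], rule in_span_cancel)
    show "in_span (d_bit * u_bit ^ 4 + d_bit * u_bit ^ 5 + (Gser\<^sup>2 * d_bit + (Gser\<^sup>2)\<^sup>2 * Gser))"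
      using gens(5) unfolding J9_u by (simp only: distrib_left add_ac)
    show "in_span (Gser\<^sup>2 * d_bit + (Gser\<^sup>2)\<^sup>2 * Gser)" by (intro in_span_add in_span_mult wm gens D)
  qed
  have 3: "in_span (d_bit * u_bit ^ 3)"
  proof (rule in_span_cancel[OF _ 4], rule in_span_cancel)
    show "in_span (d_bit * u_bit ^ 3 + d_bit * u_bit ^ 4 + Gser\<^sup>2 * Gser)"
      using gens(4) unfolding J7_u by (simp only: distrib_left)
    show "in_span (Gser\<^sup>2 * Gser)" by (intro in_span_mult gens)
  qed
  have 1: "in_span (d_bit * u_bit)"
  proof (rule in_span_cancel)
    show "in_span (d_bit * u_bit + (J7 + poly_subst [:1, 1, 0, 1:] (Gser\<^sup>2) * Gser))"
      using gens(3) unfolding J3_u by (simp add: add_ac algebra_simps eval_nat_numeral)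
    show "in_span (J7 + poly_subst [:1, 1, 0, 1:] (Gser\<^sup>2) * Gser)"
      by (intro in_span_add in_span_mult_poly gens)
  qed
  have 2: "in_span (d_bit * u_bit ^ 2)" using gens(1) by (simp add: Gser_d)
  consider "n = 0" | "n = 1" | "n = 2" | "n = 3" | "n = 4" | "n = 5" | k where "n = k + 6"
  proof -
    assume *: "n = 0 \<Longrightarrow> thesis" "n = 1 \<Longrightarrow> thesis" "n = 2 \<Longrightarrow> thesis" "n = 3 \<Longrightarrow> thesis"
      "n = 4 \<Longrightarrow> thesis" "n = 5 \<Longrightarrow> thesis" "\<And>k. n = k + 6 \<Longrightarrow> thesis"
    show thesis
    proof (cases "n < 6")
      case True
      then have "n = 0 \<or> n = 1 \<or> n = 2 \<or> n = 3 \<or> n = 4 \<or> n = 5" by linarith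
      then show thesis using * by blast
    next
      case False
      then show thesis using *(7)[of "n - 6"] by simp
    qed
  qed
  then show ?case
  proof cases
    case 7
    have "u_bit ^ 6 = u_bit ^ 5 + Gser\<^sup>2" by (simp add: Gser_squared)
    then have "d_bit * u_bit ^ n = d_bit * u_bit ^ (k + 5) + Gser\<^sup>2 * (d_bit * u_bit ^ k)"
      unfolding 7 power_add by (simp only: distrib_left mult_ac)
    moreover have "in_span (d_bit * u_bit ^ (k + 5))" "in_span (d_bit * u_bit ^ k)"
      using 7 by (auto intro: less)
    ultimately show ?thesis using in_span_add in_span_mult by simp
  qed (use D 1 2 3 4 5 in simp_all)
qed

text \<open>The additional power \<open>u_bit ^ k\<close> absorbs the shift of degree in the
  induction.\<close>

lemma in_span_d_poly: "in_span (d_bit * (u_bit ^ k * poly_subst r u_bit))"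
proof (induction r arbitrary: k)
  case (pCons b r)
  have "in_span (d_bit * (u_bit ^ Suc k * poly_subst r u_bit))" by (rule pCons.IH)
  moreover have "in_span (fps_const b * (d_bit * u_bit ^ k))"
    using bit_fps_const_cases[of b] in_span_d_u_power[of k] in_span_generators by auto
  ultimately have "in_span (fps_const b * (d_bit * u_bit ^ k) + d_bit * (u_bit ^ Suc k * poly_subst r u_bit))"
    by (rule in_span_add[rotated])
  then show ?case by (simp add: distrib_left mult_ac)
qed (simp add: in_span_generators)

lemma fps_deriv_poly_subst:
  assumes "fps_deriv g = 0" shows "fps_deriv (poly_subst p g) = 0"
  using assms by (induction p) simp_all

lemma of_nat_bit: "(of_nat n :: bit) = of_bool (odd n)"
  by (induction n) auto

text \<open>Modulo 2, q d/dq multiplies the coefficient of index n by the parity of n: it is the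
  projection onto the odd part.\<close>

lemma fps_X_deriv_odd:
  assumes "\<And>n. even n \<Longrightarrow> fps_nth (f :: bit fps) n = 0"
  shows "fps_X * fps_deriv f = f"
proof (rule fps_ext)
  fix n show "fps_nth (fps_X * fps_deriv f) n = fps_nth f n"
    using assms[of n] by (cases n) (auto simp: of_nat_bit simp del: of_nat_Suc)
qed

lemma poly_even_odd_split:
  fixes p :: "bit poly"
  obtains s r where "p = pcompose s [:0, 0, 1:] + [:0, 1:] * pcompose r [:0, 0, 1:]"
proof -
  have "\<exists>s r. p = pcompose s [:0, 0, 1:] + [:0, 1:] * pcompose r [:0, 0, 1:]"
  proof (induction p)
    case (pCons b p)
    then obtain s r where p: "p = pcompose s [:0, 0, 1:] + [:0, 1:] * pcompose r [:0, 0, 1:]" by blast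
    have "pCons b p = pcompose (pCons b r) [:0, 0, 1:] + [:0, 1:] * pcompose s [:0, 0, 1:]"
      unfolding p by (simp add: pcompose_pCons)
    then show ?case by blast
  qed (intro exI[of _ 0], simp)
  then show ?thesis using that by blast
qed

lemma Fser_odd: "even n \<Longrightarrow> fps_nth Fser n = 0"
  and Gser_odd: "even n \<Longrightarrow> fps_nth Gser n = 0"
  by (auto simp: Fser_def Gser_def)

text \<open>Write f = s(u) + c r(u). The operator q d/dq fixes f, kills polynomials in u and sends c
  to d, so f = d r(u).\<close>

theorem Modd_in_span:
  assumes "f \<in> Modd" shows "in_span f"
proof -
  obtain p where p: "f = poly_subst p c_bit" and odd: "\<And>n. even n \<Longrightarrow> fps_nth f n = 0"
    using assms by (auto simp: Modd_def Mall_eq)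
  obtain s r where sr: "p = pcompose s [:0, 0, 1:] + [:0, 1:] * pcompose r [:0, 0, 1:]"
    by (rule poly_even_odd_split)
  have u': "fps_deriv u_bit = 0"
    by (simp add: u_bit_def fps_deriv_power)
  have "fps_deriv d_bit = fps_deriv c_bit"
    using u' by (simp add: d_bit_def u_bit_def)
  moreover have "fps_X * fps_deriv d_bit = d_bit"
    by (rule fps_X_deriv_odd) (simp add: Fser_odd Gser_odd flip: Fser_plus_Gser)
  ultimately have c': "fps_X * fps_deriv c_bit = d_bit" by simp
  have f: "f = poly_subst s u_bit + c_bit * poly_subst r u_bit"
    unfolding p sr u_bit_conv_poly by (simp only: poly_subst_add poly_subst_mult poly_subst_pcompose poly_subst_X)
  have "f = fps_X * fps_deriv f"
    using odd by (simp add: fps_X_deriv_odd)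
  also have "\<dots> = (fps_X * fps_deriv c_bit) * poly_subst r u_bit"
    unfolding f using u' by (simp add: fps_deriv_poly_subst mult_ac)
  finally show ?thesis
    using in_span_d_poly[of 0 r] by (simp add: c')
qed

section \<open>Residue classes of exponents\<close>

definition graded :: "nat \<Rightarrow> nat \<Rightarrow> bit fps \<Rightarrow> bool" where
  "graded m i f \<longleftrightarrow> (\<forall>n. fps_nth f n \<noteq> 0 \<longrightarrow> n mod m = i mod m)"

definition grade_part :: "nat \<Rightarrow> nat \<Rightarrow> bit fps \<Rightarrow> bit fps" where
  "grade_part m i f = Abs_fps (\<lambda>n. if n mod m = i mod m then fps_nth f n else 0)"

lemma grade_part_nth: "fps_nth (grade_part m i f) n = (if n mod m = i mod m then fps_nth f n else 0)"
  by (simp add: grade_part_def)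

lemma graded_grade_part: "graded m i (grade_part m i f)"
  by (simp add: graded_def grade_part_nth)

lemma grade_part_add: "grade_part m i (f + g) = grade_part m i f + grade_part m i g"
  by (simp add: fps_eq_iff grade_part_nth)

lemma grade_part_graded: "graded m i f \<Longrightarrow> grade_part m j f = (if i mod m = j mod m then f else 0)"
  by (auto simp: fps_eq_iff grade_part_nth graded_def)

lemma nat_mod_add_right_cancel: "(a + j) mod m = (b + j) mod m \<longleftrightarrow> a mod m = (b::nat) mod m"
proof -
  have "int ((a + j) mod m) = int ((b + j) mod m) \<longleftrightarrow> int (a mod m) = int (b mod m)"
    unfolding zmod_int mod_eq_dvd_iff by simp
  then show ?thesis by (simp only: of_nat_eq_iff)
qed

text \<open>A homogeneous factor merely translates the classes of exponents, so taking a component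
  commutes with multiplication by it.\<close>

lemma grade_part_mult_graded:
  assumes "graded m j g"
  shows "grade_part m (i + j) (f * g) = grade_part m i f * g"
proof (rule fps_ext)
  fix n
  have "fps_nth (grade_part m i f * g) n
    = (\<Sum>k=0..n. (if k mod m = i mod m then fps_nth f k else 0) * fps_nth g (n - k))"
    by (simp add: fps_mult_nth grade_part_nth)
  also have "\<dots> = (\<Sum>k=0..n. if n mod m = (i + j) mod m then fps_nth f k * fps_nth g (n - k) else 0)"
  proof (intro sum.cong refl)
    fix k assume k: "k \<in> {0..n}"
    show "(if k mod m = i mod m then fps_nth f k else 0) * fps_nth g (n - k)
      = (if n mod m = (i + j) mod m then fps_nth f k * fps_nth g (n - k) else 0)"
    proof (cases "fps_nth g (n - k) = 0")
      case False
      then have "(n - k) mod m = j mod m" using assms by (simp add: graded_def)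
      then have "n mod m = (k + j) mod m"
        using k by (metis atLeastAtMost_iff le_add_diff_inverse mod_add_right_eq)
      moreover have "(k + j) mod m = (i + j) mod m \<longleftrightarrow> k mod m = i mod m"
        by (rule nat_mod_add_right_cancel)
      ultimately show ?thesis by simp
    qed simp
  qed
  also have "\<dots> = fps_nth (grade_part m (i + j) (f * g)) n"
    by (simp add: grade_part_nth fps_mult_nth)
  finally show "fps_nth (grade_part m (i + j) (f * g)) n = fps_nth (grade_part m i f * g) n" by simp
qed

lemma graded_iff_grade_part: "graded m i f \<longleftrightarrow> grade_part m i f = f"
  by (auto simp: fps_eq_iff grade_part_nth graded_def)

lemma graded_mult: "graded m i f \<Longrightarrow> graded m j g \<Longrightarrow> graded m (i + j) (f * g)"
  using grade_part_mult_graded[of m j g i f] by (simp add: graded_iff_grade_part)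

lemma graded_1: "graded m 0 1"
  by (simp add: graded_def)

lemma graded_power: "graded m i f \<Longrightarrow> graded m (k * i) (f ^ k)"
  by (induction k) (auto simp: graded_1 graded_mult)

lemma graded_add: "graded m i f \<Longrightarrow> graded m i g \<Longrightarrow> graded m i (f + g)"
  by (simp add: graded_iff_grade_part grade_part_add)

lemma graded_cong: "graded m i f \<Longrightarrow> i mod m = j mod m \<Longrightarrow> graded m j f"
  by (simp add: graded_def)

lemma graded_poly_subst:
  assumes "graded m 0 g" shows "graded m 0 (poly_subst p g)"
proof (induction p)
  case (pCons b p)
  have "graded m 0 (fps_const b)" by (simp add: graded_def)
  moreover have "graded m 0 (g * poly_subst p g)" using graded_mult[OF assms pCons.IH] by simp
  ultimately show ?case by (simp add: graded_add)
qed (simp add: graded_def)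

lemma odd_square_mod_8: "odd (k::nat) \<Longrightarrow> k\<^sup>2 mod 8 = 1"
proof -
  assume "odd k"
  then obtain l where l: "k = 2 * l + 1" by (auto elim: oddE)
  have "even (l * (l + 1))" by simp
  then obtain j where "l * (l + 1) = 2 * j" by blast
  then have "k\<^sup>2 = 8 * j + 1" by (simp add: l power2_eq_square algebra_simps)
  then show ?thesis by simp
qed

lemma graded_8_Fser: "graded 8 1 Fser"
  by (auto simp: graded_def Fser_def odd_square_mod_8)

lemma graded_8_Gser: "graded 8 5 Gser"
  unfolding graded_def
proof (intro allI impI)
  fix n assume "fps_nth Gser n \<noteq> 0"
  then obtain k where k: "odd k" "n = 5 * k\<^sup>2" by (auto simp: Gser_def split: if_splits)
  have "n mod 8 = 5 * (k\<^sup>2 mod 8) mod 8" unfolding k(2) by (rule mod_mult_right_eq [symmetric])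
  then show "n mod 8 = 5 mod 8" by (simp add: odd_square_mod_8[OF k(1)])
qed

lemma graded_5_sub5: "graded 5 0 (fps_sub5 f)"
  by (simp add: graded_def fps_nth_sub5)

lemma graded_5_Gser: "graded 5 0 Gser"
  unfolding Gser_eq_sub5 by (rule graded_5_sub5)

text \<open>The squares divisible by 5 are 25 times squares, so this part of F is F(q^25), that is,
  G at q^5, just as G is F at q^5.\<close>

definition E5 :: "bit fps" where "E5 = fps_sub5 Gser"
definition U5 :: "bit fps" where "U5 = grade_part 5 1 Fser"
definition V5 :: "bit fps" where "V5 = grade_part 5 4 Fser"

lemma graded_5_EUV: "graded 5 0 E5" "graded 5 1 U5" "graded 5 4 V5"
  by (simp_all add: E5_def U5_def V5_def graded_5_sub5 graded_grade_part)

lemma square_mod_5: "(k::nat)\<^sup>2 mod 5 = 0 \<and> 5 dvd k \<or> k\<^sup>2 mod 5 = 1 \<or> k\<^sup>2 mod 5 = 4"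
proof -
  have "k\<^sup>2 mod 5 = (k mod 5)\<^sup>2 mod 5" by (simp add: power_mod)
  moreover have "k mod 5 = 0 \<or> k mod 5 = 1 \<or> k mod 5 = 2 \<or> k mod 5 = 3 \<or> k mod 5 = 4" by linarith
  ultimately show ?thesis by (auto simp: power2_eq_square)
qed

lemma Fser_EUV: "Fser = E5 + U5 + V5"
proof (rule fps_ext)
  fix n
  have E: "fps_nth E5 n = (if n mod 5 = 0 then fps_nth Fser n else 0)"
  proof (cases "n mod 5 = 0")
    case True
    then obtain m where m: "n = 5 * m" by (auto elim: dvdE simp: mod_eq_0_iff_dvd)
    have "(\<exists>k. odd k \<and> m = 5 * k\<^sup>2) \<longleftrightarrow> (\<exists>k. odd k \<and> n = k\<^sup>2)"
    proof
      assume "\<exists>k. odd k \<and> m = 5 * k\<^sup>2"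
      then obtain k where "odd k" "n = (5 * k)\<^sup>2" by (auto simp: m power2_eq_square)
      then show "\<exists>k. odd k \<and> n = k\<^sup>2" by (intro exI[of _ "5 * k"]) auto
    next
      assume "\<exists>k. odd k \<and> n = k\<^sup>2"
      then obtain k where k: "odd k" "n = k\<^sup>2" by blast
      then have "5 dvd k" using square_mod_5[of k] True by auto
      then obtain l where "k = 5 * l" by blast
      then have "odd l \<and> m = 5 * l\<^sup>2" using k m by (auto simp: power2_eq_square)
      then show "\<exists>k. odd k \<and> m = 5 * k\<^sup>2" by blast
    qed
    then show ?thesis using True by (simp add: E5_def fps_nth_sub5 m Gser_def Fser_def)
  next
    case False
    then show ?thesis by (simp add: E5_def fps_nth_sub5 mod_eq_0_iff_dvd)
  qed
  have "n mod 5 = 0 \<or> n mod 5 = 1 \<or> n mod 5 = 4" if nz: "fps_nth Fser n \<noteq> 0"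
  proof -
    obtain k where "n = k\<^sup>2" using nz by (auto simp: Fser_def split: if_splits)
    then show ?thesis using square_mod_5[of k] by (elim disjE) simp_all
  qed
  then show "fps_nth Fser n = fps_nth (E5 + U5 + V5) n"
    by (auto simp: E U5_def V5_def grade_part_nth)
qed

lemma U5_nonzero: "U5 \<noteq> 0"
proof -
  have "fps_nth U5 1 = 1" by (auto simp: U5_def grade_part_nth Fser_def intro: exI[of _ 1])
  then show ?thesis by auto
qed

text \<open>Comparing residue classes modulo 5 in the equation \<open>(F + G)^6 = F G\<close>.\<close>
lemma UV_relations: "U5 * V5 = (E5 + Gser)\<^sup>2" "U5 ^ 5 + V5 ^ 5 = Gser"
proof -
  define Y s where "Y = U5 + V5" and "s = (E5 + Gser)\<^sup>2"
  note gr = graded_5_EUV graded_5_Gser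
  have gs: "graded 5 0 s"
    unfolding s_def using graded_power[OF graded_add[OF gr(1,4)], of 2] by simp
  have Y0: "Y \<noteq> 0"
  proof
    assume "Y = 0"
    then have "grade_part 5 1 Y = 0" by (simp add: fps_eq_iff grade_part_nth)
    then show False using U5_nonzero by (simp add: Y_def grade_part_add grade_part_graded[OF gr(2)] grade_part_graded[OF gr(3)])
  qed
  have d: "d_bit = Y + (E5 + Gser)"
    by (simp add: Y_def Fser_EUV add_ac flip: Fser_plus_Gser)
  have d2: "d_bit\<^sup>2 = Y\<^sup>2 + s" unfolding d bit_fps_square_add s_def ..
  have d4: "d_bit ^ 4 = Y ^ 4 + s\<^sup>2"
  proof -
    have "d_bit ^ 4 = (Y\<^sup>2 + s)\<^sup>2" unfolding d2 [symmetric] by (simp flip: power_mult)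
    then show ?thesis by (simp add: bit_fps_square_add flip: power_mult)
  qed
  have s3: "s ^ 3 = E5 * Gser"
  proof -
    \<comment> \<open>The substitution q \<mapsto> q^5 in \<open>F_G_relation\<close> carries d to E
      + G and F G to G E.\<close>
    have "E5 + Gser = fps_sub5 d_bit"
      unfolding E5_def Fser_plus_Gser [symmetric] fps_sub5_add Gser_eq_sub5 [symmetric] by (rule add.commute)
    then have "s ^ 3 = fps_sub5 (d_bit ^ 6)" by (simp add: s_def fps_sub5_power flip: power_mult)
    then show ?thesis
      unfolding F_G_relation fps_sub5_mult Gser_eq_sub5 [symmetric] by (simp add: E5_def mult.commute)
  qed
  have "d_bit ^ 6 = d_bit\<^sup>2 * d_bit ^ 4" by (simp flip: power_add)
  also have "\<dots> = (Y ^ 6 + s * Y ^ 4 + s\<^sup>2 * Y\<^sup>2) + s ^ 3"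
    unfolding d2 d4 by (simp add: algebra_simps eval_nat_numeral)
  \<comment> \<open>Both sides contain E G; once it is cancelled, a factor Y splits off.\<close>
  finally have "(Y ^ 6 + s * Y ^ 4 + s\<^sup>2 * Y\<^sup>2) + E5 * Gser = (Y + E5) * Gser"
    unfolding F_G_relation s3 by (simp add: Y_def Fser_EUV add_ac)
  then have "(Y ^ 6 + s * Y ^ 4 + s\<^sup>2 * Y\<^sup>2) + E5 * Gser = Y * Gser + E5 * Gser"
    by (simp only: distrib_right)
  then have "Y ^ 6 + s * Y ^ 4 + s\<^sup>2 * Y\<^sup>2 = Y * Gser"
    by (simp only: add_right_cancel)
  then have "Y * (Y ^ 5 + s * Y ^ 3 + s\<^sup>2 * Y) = Y * Gser"
    by (simp add: algebra_simps eval_nat_numeral)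
  then have eq: "Y ^ 5 + s * Y ^ 3 + s\<^sup>2 * Y = Gser" using Y0 by simp
  have Y2: "Y\<^sup>2 = U5\<^sup>2 + V5\<^sup>2" by (simp add: Y_def bit_fps_square_add)
  have Y4: "Y ^ 4 = U5 ^ 4 + V5 ^ 4"
  proof -
    have "Y ^ 4 = (U5\<^sup>2 + V5\<^sup>2)\<^sup>2" unfolding Y2 [symmetric] by (simp flip: power_mult)
    then show ?thesis by (simp add: bit_fps_square_add flip: power_mult)
  qed
  have Y5: "Y ^ 5 = U5 ^ 5 + U5 ^ 4 * V5 + V5 ^ 4 * U5 + V5 ^ 5"
  proof -
    have "Y ^ 5 = Y ^ 4 * Y" by (simp add: eval_nat_numeral)
    then show ?thesis unfolding Y4 unfolding Y_def by (simp add: algebra_simps eval_nat_numeral)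
  qed
  have Y3: "Y ^ 3 = U5 ^ 3 + U5\<^sup>2 * V5 + V5\<^sup>2 * U5 + V5 ^ 3"
  proof -
    have "Y ^ 3 = Y\<^sup>2 * Y" by (simp add: eval_nat_numeral)
    then show ?thesis unfolding Y2 unfolding Y_def by (simp add: algebra_simps eval_nat_numeral)
  qed
  have eq: "U5 ^ 5 + U5 ^ 4 * V5 + V5 ^ 4 * U5 + V5 ^ 5 + (s * U5 ^ 3 + s * (U5\<^sup>2 * V5) + s * (V5\<^sup>2 * U5) + s * V5 ^ 3)
    + (s\<^sup>2 * U5 + s\<^sup>2 * V5) = Gser"
    using eq unfolding Y3 Y5 by (simp add: Y_def distrib_left)
  have h: "graded 5 (5 * 1) (U5 ^ 5)" "graded 5 (4 * 1 + 4) (U5 ^ 4 * V5)" "graded 5 (4 * 4 + 1) (V5 ^ 4 * U5)"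
    "graded 5 (5 * 4) (V5 ^ 5)" "graded 5 (0 + 3 * 1) (s * U5 ^ 3)" "graded 5 (0 + (2 * 1 + 4)) (s * (U5\<^sup>2 * V5))"
    "graded 5 (0 + (2 * 4 + 1)) (s * (V5\<^sup>2 * U5))" "graded 5 (0 + 3 * 4) (s * V5 ^ 3)"
    "graded 5 (2 * 0 + 1) (s\<^sup>2 * U5)" "graded 5 (2 * 0 + 4) (s\<^sup>2 * V5)"
    by (intro graded_mult graded_power gr gs)+
  note g = h[THEN grade_part_graded] gr(4)[THEN grade_part_graded]
  \<comment> \<open>In class 0 only U^5, V^5 and G occur, in class 3 only U^4 V and s U^3.\<close>
  from arg_cong[OF eq, of "grade_part 5 0"] show "U5 ^ 5 + V5 ^ 5 = Gser"
    by (simp add: grade_part_add g)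
  from arg_cong[OF eq, of "grade_part 5 3"] have "U5 ^ 4 * V5 + s * U5 ^ 3 = 0"
    by (simp add: grade_part_add g)
  then have "U5 ^ 3 * (U5 * V5) = U5 ^ 3 * s"
    by (simp add: bit_fps_add_eq_0 eval_nat_numeral mult_ac)
  then show "U5 * V5 = (E5 + Gser)\<^sup>2"
    using U5_nonzero by (simp add: s_def)
qed

section \<open>Recovering coefficients from components modulo 5\<close>

definition w_poly :: "bit poly" where "w_poly = [:0, 1, 1:] * [:1, 0, 0, 0, 1:]"

lemma degree_w_poly: "degree w_poly = 6"
  unfolding w_poly_def by (subst degree_mult_eq) auto

lemma Fser_squared: "Fser\<^sup>2 = poly_subst w_poly u_bit"
proof -
  have "Fser\<^sup>2 = (u_bit + u_bit\<^sup>2) * (1 + u_bit\<^sup>2)\<^sup>2"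
    unfolding Fser_d power_mult_distrib d_bit_squared ..
  then show ?thesis
    by (simp add: bit_fps_square_add) (simp add: w_poly_def algebra_simps eval_nat_numeral)
qed

text \<open>A polynomial in G^2 is the image under q \<mapsto> q^5 of one in F^2, which is a
  composition with \<open>w_poly\<close> at u. Relations among series in q^5 are thereby pulled back
  to polynomial identities in u.\<close>

lemma poly_Gser_squared: "poly_subst p (Gser\<^sup>2) = fps_sub5 (poly_subst p (Fser\<^sup>2))"
  by (simp add: fps_sub5_poly_subst fps_sub5_power Gser_eq_sub5)

lemma poly_Fser_squared: "poly_subst p (Fser\<^sup>2) = poly_subst (pcompose p w_poly) u_bit"
  by (simp add: Fser_squared)

lemma poly_Gser_squared_eq_0: "poly_subst p (Gser\<^sup>2) = 0 \<Longrightarrow> p = 0"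
proof -
  assume "poly_subst p (Gser\<^sup>2) = 0"
  then have "pcompose p w_poly = 0"
    by (intro poly_subst_u_bit_eq_0) (simp add: poly_Gser_squared fps_sub5_eq_0_iff poly_Fser_squared)
  then show "p = 0"
    using degree_w_poly by (simp add: pcompose_eq_0)
qed

text \<open>Polynomials in \<open>w_poly\<close> have degree divisible by 6, hence the degrees cannot match.\<close>
lemma w_poly_independent:
  assumes "pcompose p w_poly + pcompose q w_poly * r = 0" "degree r = 2"
  shows "p = 0" "q = 0"
proof -
  have "- pcompose q w_poly * r = pcompose p w_poly"
    using assms(1) by (metis minus_mult_left neg_eq_iff_add_eq_0 add.commute)
  then have "degree (- pcompose q w_poly * r) = degree p * 6"
    by (simp only: degree_pcompose degree_w_poly)
  moreover have "r \<noteq> 0" using assms(2) by auto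
  ultimately show "q = 0"
  proof (cases "pcompose q w_poly = 0")
    case True
    then show ?thesis using degree_w_poly by (simp add: pcompose_eq_0)
  next
    case False
    then have "degree (- pcompose q w_poly * r) = degree q * 6 + 2"
      using \<open>r \<noteq> 0\<close> assms(2) by (subst degree_mult_eq) (auto simp: degree_w_poly degree_pcompose)
    with \<open>degree (- pcompose q w_poly * r) = degree p * 6\<close> have "degree p * 6 = degree q * 6 + 2" by simp
    then have False by presburger
    then show ?thesis ..
  qed
  with assms(1) have "pcompose p w_poly = 0" by simp
  then show "p = 0" using degree_w_poly by (simp add: pcompose_eq_0)
qed

text \<open>Multiplication by G clears the denominator of J3 and leaves a polynomial in F whose
  coefficients have exponents divisible by 5.\<close>

lemma Gser_mult_span:
  "Gser * fps_span p0 p1 p3 p7 p9 q = poly_subst p0 (Gser\<^sup>2) * Gser\<^sup>2 + poly_subst p1 (Gser\<^sup>2) * Gser * Fser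
     + poly_subst p3 (Gser\<^sup>2) * Fser ^ 8 + poly_subst p7 (Gser\<^sup>2) * Gser\<^sup>2 * Fser\<^sup>2
     + poly_subst p9 (Gser\<^sup>2) * Gser\<^sup>2 * Fser ^ 4 + poly_subst q (Gser\<^sup>2) * Gser * Fser ^ 5"
proof -
  have "Gser * (poly_subst p3 (Gser\<^sup>2) * J3) = poly_subst p3 (Gser\<^sup>2) * Fser ^ 8"
    unfolding J3_mult_Gser [symmetric] by (simp only: mult_ac)
  then show ?thesis
    unfolding fps_span_def distrib_left by (simp add: J1_def J7_def J9_def power2_eq_square mult_ac)
qed

lemma Fser_powers_EUV:
  "Fser\<^sup>2 = E5\<^sup>2 + U5\<^sup>2 + V5\<^sup>2" "Fser ^ 4 = E5 ^ 4 + U5 ^ 4 + V5 ^ 4" "Fser ^ 8 = E5 ^ 8 + U5 ^ 8 + V5 ^ 8"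
proof -
  show 2: "Fser\<^sup>2 = E5\<^sup>2 + U5\<^sup>2 + V5\<^sup>2"
    unfolding Fser_EUV bit_fps_square_add ..
  have "Fser ^ 4 = (Fser\<^sup>2)\<^sup>2" by (simp flip: power_mult)
  then show 4: "Fser ^ 4 = E5 ^ 4 + U5 ^ 4 + V5 ^ 4"
    unfolding 2 bit_fps_square_add by (simp flip: power_mult)
  have "Fser ^ 8 = (Fser ^ 4)\<^sup>2" by (simp flip: power_mult)
  then show "Fser ^ 8 = E5 ^ 8 + U5 ^ 8 + V5 ^ 8"
    unfolding 4 bit_fps_square_add by (simp flip: power_mult)
qed

text \<open>Frobenius makes F^2, F^4 and F^8 sums of pure powers of E, U and V; only F^5 = F^4 F has
  mixed terms. So classes 1 and 4 involve just A1, A9, B, and classes 2 and 3 just A3, A7,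
  B.\<close>

lemma grade_part_combination:
  assumes "graded 5 0 A0" "graded 5 0 A1" "graded 5 0 A3" "graded 5 0 A7" "graded 5 0 A9" "graded 5 0 B"
  defines "f \<equiv> A0 + A1 * Fser + A3 * Fser ^ 8 + A7 * Fser\<^sup>2 + A9 * Fser ^ 4 + B * Fser ^ 5"
  shows "grade_part 5 1 f = A1 * U5 + A9 * V5 ^ 4 + B * (E5 ^ 4 * U5 + V5 ^ 4 * E5)"
    and "grade_part 5 4 f = A1 * V5 + A9 * U5 ^ 4 + B * (E5 ^ 4 * V5 + U5 ^ 4 * E5)"
    and "grade_part 5 2 f = A3 * V5 ^ 8 + A7 * U5\<^sup>2 + B * (V5 ^ 4 * U5)"
    and "grade_part 5 3 f = A3 * U5 ^ 8 + A7 * V5\<^sup>2 + B * (U5 ^ 4 * V5)"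
proof -
  note gr = graded_5_EUV assms(1-6)
  have F5: "Fser ^ 5 = E5 ^ 4 * E5 + E5 ^ 4 * U5 + E5 ^ 4 * V5 + (U5 ^ 4 * E5 + U5 ^ 4 * U5 + U5 ^ 4 * V5)
    + (V5 ^ 4 * E5 + V5 ^ 4 * U5 + V5 ^ 4 * V5)"
  proof -
    have "Fser ^ 5 = Fser ^ 4 * Fser" by (simp add: eval_nat_numeral)
    then show ?thesis unfolding Fser_powers_EUV unfolding Fser_EUV by (simp only: distrib_left distrib_right add_ac)
  qed
  have f: "f = A0 + (A1 * E5 + A1 * U5 + A1 * V5) + (A3 * E5 ^ 8 + A3 * U5 ^ 8 + A3 * V5 ^ 8)
    + (A7 * E5\<^sup>2 + A7 * U5\<^sup>2 + A7 * V5\<^sup>2) + (A9 * E5 ^ 4 + A9 * U5 ^ 4 + A9 * V5 ^ 4)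
    + (B * (E5 ^ 4 * E5) + B * (E5 ^ 4 * U5) + B * (E5 ^ 4 * V5) + (B * (U5 ^ 4 * E5) + B * (U5 ^ 4 * U5) + B * (U5 ^ 4 * V5))
    + (B * (V5 ^ 4 * E5) + B * (V5 ^ 4 * U5) + B * (V5 ^ 4 * V5)))"
    unfolding f_def F5 unfolding Fser_powers_EUV unfolding Fser_EUV by (simp only: distrib_left)
  have h: "graded 5 (0 + 0) (A1 * E5)" "graded 5 (0 + 1) (A1 * U5)" "graded 5 (0 + 4) (A1 * V5)"
    "graded 5 (0 + 8 * 0) (A3 * E5 ^ 8)" "graded 5 (0 + 8 * 1) (A3 * U5 ^ 8)" "graded 5 (0 + 8 * 4) (A3 * V5 ^ 8)"
    "graded 5 (0 + 2 * 0) (A7 * E5\<^sup>2)" "graded 5 (0 + 2 * 1) (A7 * U5\<^sup>2)" "graded 5 (0 + 2 * 4) (A7 * V5\<^sup>2)"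
    "graded 5 (0 + 4 * 0) (A9 * E5 ^ 4)" "graded 5 (0 + 4 * 1) (A9 * U5 ^ 4)" "graded 5 (0 + 4 * 4) (A9 * V5 ^ 4)"
    "graded 5 (0 + (4 * 0 + 0)) (B * (E5 ^ 4 * E5))" "graded 5 (0 + (4 * 0 + 1)) (B * (E5 ^ 4 * U5))"
    "graded 5 (0 + (4 * 0 + 4)) (B * (E5 ^ 4 * V5))" "graded 5 (0 + (4 * 1 + 0)) (B * (U5 ^ 4 * E5))"
    "graded 5 (0 + (4 * 1 + 1)) (B * (U5 ^ 4 * U5))" "graded 5 (0 + (4 * 1 + 4)) (B * (U5 ^ 4 * V5))"
    "graded 5 (0 + (4 * 4 + 0)) (B * (V5 ^ 4 * E5))" "graded 5 (0 + (4 * 4 + 1)) (B * (V5 ^ 4 * U5))"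
    "graded 5 (0 + (4 * 4 + 4)) (B * (V5 ^ 4 * V5))"
    by (intro graded_mult graded_power gr)+
  note g = h[THEN grade_part_graded] assms(1)[THEN grade_part_graded]
  show "grade_part 5 1 f = A1 * U5 + A9 * V5 ^ 4 + B * (E5 ^ 4 * U5 + V5 ^ 4 * E5)"
    unfolding f by (simp add: grade_part_add g distrib_left add_ac)
  show "grade_part 5 4 f = A1 * V5 + A9 * U5 ^ 4 + B * (E5 ^ 4 * V5 + U5 ^ 4 * E5)"
    unfolding f by (simp add: grade_part_add g distrib_left add_ac)
  show "grade_part 5 2 f = A3 * V5 ^ 8 + A7 * U5\<^sup>2 + B * (V5 ^ 4 * U5)"
    unfolding f by (simp add: grade_part_add g add_ac)
  show "grade_part 5 3 f = A3 * U5 ^ 8 + A7 * V5\<^sup>2 + B * (U5 ^ 4 * V5)"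
    unfolding f by (simp add: grade_part_add g add_ac)
qed

lemma graded_5_poly_Gser: "graded 5 0 (poly_subst p (Gser\<^sup>2))"
  using graded_power[OF graded_5_Gser, of 2] by (intro graded_poly_subst) simp

lemma grade_part_Gser_mult: "grade_part 5 i (Gser * f) = Gser * grade_part 5 i f"
  using grade_part_mult_graded[OF graded_5_Gser, of i f] by (simp add: mult.commute)

lemma E5_Gser_sub5: "E5 + Gser = fps_sub5 d_bit"
  unfolding E5_def Fser_plus_Gser [symmetric] fps_sub5_add Gser_eq_sub5 [symmetric] by (rule add.commute)

text \<open>Eliminating A7 and cancelling G leaves A3 G + B U V = 0. As U V = (E + G)^2, this is,
  after another factor G, a relation in q^5; pulled back, it contains \<open>d_bit\<^sup>2\<close>,
  whose degree 2 in u separates p3 from q.\<close>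

lemma span_coefficients_residue:
  assumes f: "f = fps_span p0 p1 p3 p7 p9 q" and "grade_part 5 2 f = 0" "grade_part 5 3 f = 0"
  shows "q = 0" "p3 = 0" "p7 = 0"
proof -
  define A3 A7 B where "A3 = poly_subst p3 (Gser\<^sup>2)" and "A7 = poly_subst p7 (Gser\<^sup>2) * Gser\<^sup>2"
    and "B = poly_subst q (Gser\<^sup>2) * Gser"
  have g2: "graded 5 0 (Gser\<^sup>2)" using graded_power[OF graded_5_Gser, of 2] by simp
  have gr: "graded 5 0 (poly_subst p (Gser\<^sup>2) * Gser\<^sup>2)" "graded 5 0 (poly_subst p (Gser\<^sup>2) * Gser)" for p
    using graded_mult[OF graded_5_poly_Gser g2] graded_mult[OF graded_5_poly_Gser graded_5_Gser] by simp_all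
  note c = grade_part_combination[OF gr(1) gr(2) graded_5_poly_Gser gr(1) gr(1) gr(2),
      of p0 p1 p3 p7 p9 q, folded Gser_mult_span]
  have 2: "A3 * V5 ^ 8 + A7 * U5\<^sup>2 + B * (V5 ^ 4 * U5) = 0"
    using c(3) assms(2) by (simp add: f grade_part_Gser_mult A3_def A7_def B_def)
  have 3: "A3 * U5 ^ 8 + A7 * V5\<^sup>2 + B * (U5 ^ 4 * V5) = 0"
    using c(4) assms(3) by (simp add: f grade_part_Gser_mult A3_def A7_def B_def)
  \<comment> \<open>The multipliers \<open>V5\<^sup>2\<close> and \<open>U5\<^sup>2\<close> make the
    two A7 terms equal, so they cancel.\<close>
  have "(U5 ^ 5 + V5 ^ 5) * (A3 * (U5 ^ 5 + V5 ^ 5) + B * (U5 * V5))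
    = V5\<^sup>2 * (A3 * V5 ^ 8 + A7 * U5\<^sup>2 + B * (V5 ^ 4 * U5)) + U5\<^sup>2 * (A3 * U5 ^ 8 + A7 * V5\<^sup>2 + B * (U5 ^ 4 * V5))"
    by (simp add: algebra_simps eval_nat_numeral)
  then have "A3 * Gser + B * (E5 + Gser)\<^sup>2 = 0"
    unfolding 2 3 UV_relations using Gser_nonzero by simp
  then have "Gser * (A3 + poly_subst q (Gser\<^sup>2) * (E5 + Gser)\<^sup>2) = 0"
    by (simp add: B_def distrib_left mult_ac)
  then have "fps_sub5 (poly_subst p3 (Fser\<^sup>2) + poly_subst q (Fser\<^sup>2) * d_bit\<^sup>2) = 0"
    using Gser_nonzero
    by (simp add: A3_def fps_sub5_add fps_sub5_mult fps_sub5_power poly_Gser_squared E5_Gser_sub5)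
  then have "poly_subst p3 (Fser\<^sup>2) + poly_subst q (Fser\<^sup>2) * d_bit\<^sup>2 = 0"
    by (simp add: fps_sub5_eq_0_iff)
  then have "poly_subst (pcompose p3 w_poly + pcompose q w_poly * [:0, 1, 1:]) u_bit = 0"
    unfolding poly_Fser_squared d_bit_squared by (simp add: power2_eq_square distrib_left mult_ac)
  from poly_subst_u_bit_eq_0[OF this] show q: "q = 0" and p3: "p3 = 0"
    using w_poly_independent[of p3 q "[:0, 1, 1:]"] by simp_all
  have "A7 * U5\<^sup>2 = 0" using 2 by (simp add: A3_def B_def q p3)
  then have "poly_subst p7 (Gser\<^sup>2) = 0"
    using U5_nonzero Gser_nonzero by (simp add: A7_def)
  then show "p7 = 0" by (rule poly_Gser_squared_eq_0)
qed

text \<open>The two equations are linear in P1 + Q E^4 and P9 G + Q E. Eliminating the former shows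
  that the latter vanishes, then both do; the relation P9 G + Q E = 0 lives in q^5 and decides p9
  and q.\<close>

lemma span_coefficients_nonresidue:
  assumes f: "f = fps_span p0 p1 p3 p7 p9 q" and "grade_part 5 1 f = 0" "grade_part 5 4 f = 0"
  shows "q = 0" "p1 = 0" "p9 = 0"
proof -
  define P1 P9 Q where "P1 = poly_subst p1 (Gser\<^sup>2)" and "P9 = poly_subst p9 (Gser\<^sup>2)"
    and "Q = poly_subst q (Gser\<^sup>2)"
  have g2: "graded 5 0 (Gser\<^sup>2)" using graded_power[OF graded_5_Gser, of 2] by simp
  have gr: "graded 5 0 (poly_subst p (Gser\<^sup>2) * Gser\<^sup>2)" "graded 5 0 (poly_subst p (Gser\<^sup>2) * Gser)" for p
    using graded_mult[OF graded_5_poly_Gser g2] graded_mult[OF graded_5_poly_Gser graded_5_Gser] by simp_all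
  note c = grade_part_combination[OF gr(1) gr(2) graded_5_poly_Gser gr(1) gr(1) gr(2),
      of p0 p1 p3 p7 p9 q, folded Gser_mult_span]
  have "Gser * ((P1 + Q * E5 ^ 4) * U5 + (P9 * Gser + Q * E5) * V5 ^ 4) = 0"
  proof -
    have "P1 * Gser * U5 + P9 * Gser\<^sup>2 * V5 ^ 4 + Q * Gser * (E5 ^ 4 * U5 + V5 ^ 4 * E5) = 0"
      using c(1) assms(2) by (simp add: f grade_part_Gser_mult P1_def P9_def Q_def)
    then show ?thesis by (simp add: algebra_simps eval_nat_numeral)
  qed
  then have 1: "(P1 + Q * E5 ^ 4) * U5 + (P9 * Gser + Q * E5) * V5 ^ 4 = 0"
    using Gser_nonzero by simp
  have "Gser * ((P1 + Q * E5 ^ 4) * V5 + (P9 * Gser + Q * E5) * U5 ^ 4) = 0"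
  proof -
    have "P1 * Gser * V5 + P9 * Gser\<^sup>2 * U5 ^ 4 + Q * Gser * (E5 ^ 4 * V5 + U5 ^ 4 * E5) = 0"
      using c(2) assms(3) by (simp add: f grade_part_Gser_mult P1_def P9_def Q_def)
    then show ?thesis by (simp add: algebra_simps eval_nat_numeral)
  qed
  then have 4: "(P1 + Q * E5 ^ 4) * V5 + (P9 * Gser + Q * E5) * U5 ^ 4 = 0"
    using Gser_nonzero by simp
  have "(P9 * Gser + Q * E5) * (U5 ^ 5 + V5 ^ 5)
    = V5 * ((P1 + Q * E5 ^ 4) * U5 + (P9 * Gser + Q * E5) * V5 ^ 4)
      + U5 * ((P1 + Q * E5 ^ 4) * V5 + (P9 * Gser + Q * E5) * U5 ^ 4)"
    by (simp add: algebra_simps eval_nat_numeral)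
  then have b: "P9 * Gser + Q * E5 = 0"
    unfolding 1 4 UV_relations using Gser_nonzero by simp
  then have "(P1 + Q * E5 ^ 4) * U5 = 0" using 1 by simp
  then have a: "P1 + Q * E5 ^ 4 = 0" using U5_nonzero by simp
  have "fps_sub5 (poly_subst p9 (Fser\<^sup>2) * Fser + poly_subst q (Fser\<^sup>2) * Gser) = 0"
    using b by (simp add: P9_def Q_def fps_sub5_add fps_sub5_mult poly_Gser_squared E5_def flip: Gser_eq_sub5)
  then have "poly_subst p9 (Fser\<^sup>2) * Fser + poly_subst q (Fser\<^sup>2) * Gser = 0"
    by (simp add: fps_sub5_eq_0_iff)
  moreover have "X * Fser + Y * Gser = d_bit * (X * (1 + u_bit\<^sup>2) + Y * u_bit\<^sup>2)" for X Y
    unfolding Fser_d Gser_d by (simp add: algebra_simps)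
  ultimately have "d_bit * (poly_subst p9 (Fser\<^sup>2) * (1 + u_bit\<^sup>2) + poly_subst q (Fser\<^sup>2) * u_bit\<^sup>2) = 0"
    by simp
  then have "poly_subst p9 (Fser\<^sup>2) * (1 + u_bit\<^sup>2) + poly_subst q (Fser\<^sup>2) * u_bit\<^sup>2 = 0"
    using d_bit_nonzero by simp
  \<comment> \<open>Regrouping as p9 + (p9 + q) \<open>u\<^sup>2\<close> yields a factor of degree
    2, the shape that \<open>w_poly_independent\<close> treats.\<close>
  then have "poly_subst (pcompose p9 w_poly + pcompose (p9 + q) w_poly * [:0, 0, 1:]) u_bit = 0"
    unfolding poly_Fser_squared by (simp add: power2_eq_square pcompose_add algebra_simps)
  from poly_subst_u_bit_eq_0[OF this] show p9: "p9 = 0" and "q = 0"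
    using w_poly_independent[of p9 "p9 + q" "[:0, 0, 1:]"] by simp_all
  then have "poly_subst p1 (Gser\<^sup>2) = 0" using a by (simp add: P1_def Q_def)
  then show "p1 = 0" by (rule poly_Gser_squared_eq_0)
qed

section \<open>Supports modulo 20\<close>

definition supported :: "nat set \<Rightarrow> bit fps \<Rightarrow> bool" where
  "supported A f \<longleftrightarrow> (\<forall>n. fps_nth f n \<noteq> 0 \<longrightarrow> n mod 20 \<in> A)"

lemma supported_add: "supported A f \<Longrightarrow> supported A g \<Longrightarrow> supported A (f + g)"
  by (force simp: supported_def)

lemma supported_mono: "supported A f \<Longrightarrow> A \<subseteq> B \<Longrightarrow> supported B f"
  by (auto simp: supported_def)

lemma supported_mult_graded:
  assumes "supported A f" "graded 20 j g" "\<And>a. a \<in> A \<Longrightarrow> (a + j) mod 20 \<in> B"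
  shows "supported B (g * f)"
  unfolding supported_def
proof (intro allI impI)
  fix n assume n: "fps_nth (g * f) n \<noteq> 0"
  \<comment> \<open>A representative of n - j modulo 20 that avoids truncated subtraction.\<close>
  define i where "i = n + 20 * j - j"
  have ij: "(i + j) mod 20 = n mod 20" by (simp add: i_def)
  have "fps_nth (grade_part 20 (i + j) (f * g)) n \<noteq> 0"
    using n ij by (simp add: grade_part_nth mult.commute)
  then have "grade_part 20 i f \<noteq> 0"
    unfolding grade_part_mult_graded[OF assms(2)] by auto
  then obtain m where "m mod 20 = i mod 20" "fps_nth f m \<noteq> 0"
    by (auto simp: fps_eq_iff grade_part_nth split: if_splits)
  then have "i mod 20 \<in> A" using assms(1) by (metis supported_def)
  from assms(3)[OF this] show "n mod 20 \<in> B"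
    using ij by (simp add: mod_add_left_eq)
qed

lemma supported_cancel_graded:
  assumes "supported B (g * f)" "graded 20 j g" "g \<noteq> 0" "\<And>i. i < 20 \<Longrightarrow> (i + j) mod 20 \<in> B \<Longrightarrow> i \<in> A"
  shows "supported A f"
  unfolding supported_def
proof (intro allI impI)
  fix n assume "fps_nth f n \<noteq> 0"
  then have "grade_part 20 n f \<noteq> 0" by (auto simp: fps_eq_iff grade_part_nth)
  then have "grade_part 20 (n + j) (f * g) \<noteq> 0"
    unfolding grade_part_mult_graded[OF assms(2)] using assms(3) by simp
  then obtain m where "m mod 20 = (n + j) mod 20" "fps_nth (g * f) m \<noteq> 0"
    by (auto simp: fps_eq_iff grade_part_nth mult.commute split: if_splits)
  then have "(n mod 20 + j) mod 20 \<in> B"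
    using assms(1) unfolding supported_def by (metis mod_add_left_eq)
  then show "n mod 20 \<in> A" by (intro assms(4)) auto
qed

lemma supported_square:
  assumes "supported A f" "\<And>a. a \<in> A \<Longrightarrow> (2 * a) mod 20 \<in> B"
  shows "supported B (f\<^sup>2)"
  unfolding supported_def
proof (intro allI impI)
  fix n assume "fps_nth (f\<^sup>2) n \<noteq> 0"
  then obtain k where k: "n = 2 * k" "fps_nth f k \<noteq> 0"
    by (auto simp: bit_fps_square_nth elim!: evenE split: if_splits)
  then have "(2 * (k mod 20)) mod 20 \<in> B" using assms by (auto simp: supported_def)
  then show "n mod 20 \<in> B" by (simp add: k(1) mod_mult_right_eq)
qed

lemma mod_20_eqI:
  assumes "(n::nat) mod 4 = k mod 4" "n mod 5 = k mod 5"
  shows "n mod 20 = k mod 20"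
proof -
  have "int n mod 4 = int k mod 4" "int n mod 5 = int k mod 5"
    using assms by (metis of_nat_mod of_nat_numeral)+
  then have "4 * 5 dvd int n - int k"
    using coprime_add_one_right[of "4::int"] by (intro divides_mult) (auto simp: mod_eq_dvd_iff)
  then have "int (n mod 20) = int (k mod 20)" by (simp add: zmod_int mod_eq_dvd_iff)
  then show ?thesis by (simp only: of_nat_eq_iff)
qed

lemma mod_20_of_mod_8_mod_5:
  assumes "(n::nat) mod 8 mod 4 = 1"
  shows "n mod 5 = 0 \<Longrightarrow> n mod 20 = 5" "n mod 5 = 1 \<Longrightarrow> n mod 20 = 1" "n mod 5 = 4 \<Longrightarrow> n mod 20 = 9"
proof -
  have "n mod 4 = 1" using assms by (simp add: mod_mod_cancel)
  then show "n mod 5 = 0 \<Longrightarrow> n mod 20 = 5" "n mod 5 = 1 \<Longrightarrow> n mod 20 = 1" "n mod 5 = 4 \<Longrightarrow> n mod 20 = 9"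
    using mod_20_eqI[of n 5] mod_20_eqI[of n 1] mod_20_eqI[of n 9] by simp_all
qed

lemma graded_20_Gser: "graded 20 5 Gser"
  unfolding graded_def
proof (intro allI impI)
  fix n assume "fps_nth Gser n \<noteq> 0"
  then have "n mod 8 = 5" "n mod 5 = 0" using graded_8_Gser graded_5_Gser by (auto simp: graded_def)
  then show "n mod 20 = 5 mod 20" using mod_20_of_mod_8_mod_5(1)[of n] by simp
qed

lemma graded_20_Gser_squared: "graded 20 10 (Gser\<^sup>2)"
  using graded_power[OF graded_20_Gser, of 2] by simp

lemma graded_20_Gser_4: "graded 20 0 (Gser ^ 4)"
  using graded_cong[OF graded_power[OF graded_20_Gser, of 4], of 0] by simp

lemma supported_Fser: "supported {1, 5, 9} Fser"
  unfolding supported_def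
proof (intro allI impI)
  fix n assume n: "fps_nth Fser n \<noteq> 0"
  then have 8: "n mod 8 = 1" using graded_8_Fser by (auto simp: graded_def)
  have "n mod 5 = 0 \<or> n mod 5 = 1 \<or> n mod 5 = 4"
    using n graded_5_EUV unfolding Fser_EUV graded_def by (auto split: if_splits) 
  with 8 show "n mod 20 \<in> {1, 5, 9}" using mod_20_of_mod_8_mod_5[of n] by auto
qed

lemma supported_Fser_powers:
  "supported {2, 10, 18} (Fser\<^sup>2)" "supported {0, 4, 16} (Fser ^ 4)" "supported {0, 8, 12} (Fser ^ 8)"
proof -
  show 2: "supported {2, 10, 18} (Fser\<^sup>2)"
    by (rule supported_square[OF supported_Fser]) auto
  have "supported {0, 4, 16} ((Fser\<^sup>2)\<^sup>2)"
    by (rule supported_square[OF 2]) auto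
  then show 4: "supported {0, 4, 16} (Fser ^ 4)" by (simp flip: power_mult)
  have "supported {0, 8, 12} ((Fser ^ 4)\<^sup>2)"
    by (rule supported_square[OF 4]) auto
  then show "supported {0, 8, 12} (Fser ^ 8)" by (simp flip: power_mult)
qed

text \<open>The support of J3 is obtained from F^8 = G J3 by cancelling the homogeneous factor G.
  The classes 5 and 15 that occur are seen by neither \<open>p_a\<close> nor
  \<open>p_b\<close>.\<close>

lemma supported_J:
  "supported {1, 5, 9} J1" "supported {3, 7, 15} J3" "supported {3, 7, 15} J7" "supported {1, 5, 9} J9"
proof -
  show "supported {1, 5, 9} J1" by (simp only: J1_def supported_Fser)
  have "supported {0, 8, 12} (Gser * J3)"
    using supported_Fser_powers(3) by (simp add: J3_mult_Gser[symmetric] mult.commute)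
  then show "supported {3, 7, 15} J3"
  proof (rule supported_cancel_graded[OF _ graded_20_Gser Gser_nonzero])
    have *: "\<forall>i\<in>{0..<20::nat}. (i + 5) mod 20 \<in> {0, 8, 12} \<longrightarrow> i \<in> {3, 7, 15}"
      by code_simp
    show "i \<in> {3, 7, 15}" if "i < 20" "(i + 5) mod 20 \<in> {0, 8, 12}" for i :: nat
    proof -
      have "i \<in> {0..<20}" using that(1) by simp
      from mp[OF bspec[OF * this] that(2)] show ?thesis .
    qed
  qed
  have "supported {3, 7, 15} (Gser * Fser\<^sup>2)"
    by (rule supported_mult_graded[OF supported_Fser_powers(1) graded_20_Gser]) auto
  then show "supported {3, 7, 15} J7" by (simp add: J7_def mult.commute)
  have "supported {1, 5, 9} (Gser * Fser ^ 4)"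
    by (rule supported_mult_graded[OF supported_Fser_powers(2) graded_20_Gser]) auto
  then show "supported {1, 5, 9} J9" by (simp add: J9_def mult.commute)
qed

lemma supported_poly_mult:
  assumes "supported A f" "A \<subseteq> {..<20}" shows "supported A (poly_subst p (Gser ^ 4) * f)"
  by (rule supported_mult_graded[OF assms(1) graded_poly_subst[OF graded_20_Gser_4]]) (use assms(2) in auto)

lemma supported_N1: "g \<in> N1 \<Longrightarrow> supported {5, 15} g"
proof -
  assume "g \<in> N1"
  then obtain p where g: "g = poly_subst p (Gser\<^sup>2) * Gser" by (auto simp: N1_def)
  have "graded 10 0 (Gser\<^sup>2)"
    unfolding graded_def
  proof (intro allI impI)
    fix n assume "fps_nth (Gser\<^sup>2) n \<noteq> 0"
    then have "n mod 20 = 10" using graded_20_Gser_squared by (auto simp: graded_def)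
    then show "n mod 10 = 0 mod 10" using mod_mod_cancel[of 10 20 n] by simp
  qed
  moreover have "graded 10 5 Gser"
    unfolding graded_def
  proof (intro allI impI)
    fix n assume "fps_nth Gser n \<noteq> 0"
    then have "n mod 20 = 5" using graded_20_Gser by (auto simp: graded_def)
    then show "n mod 10 = 5 mod 10" using mod_mod_cancel[of 10 20 n] by simp
  qed
  ultimately have "graded 10 5 g"
    using graded_mult[OF graded_poly_subst, of 10 "Gser\<^sup>2" 5 Gser p] by (simp add: g)
  then show ?thesis
    unfolding supported_def graded_def
  proof (intro allI impI)
    fix n assume "\<forall>n. fps_nth g n \<noteq> 0 \<longrightarrow> n mod 10 = 5 mod 10" "fps_nth g n \<noteq> 0"
    then have 10: "n mod 20 mod 10 = 5" by (simp add: mod_mod_cancel)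
    have *: "\<forall>r\<in>{0..<20::nat}. r mod 10 = 5 \<longrightarrow> r \<in> {5, 15}" by code_simp
    have "n mod 20 \<in> {0..<20}" by simp
    from mp[OF bspec[OF * this] 10] show "n mod 20 \<in> {5, 15}" .
  qed
qed

lemma graded_cancel:
  assumes "graded m (i + j) (f * g)" "graded m j g" "g \<noteq> 0"
  shows "graded m i f"
  using assms grade_part_mult_graded[OF assms(2), of i f] by (simp add: graded_iff_grade_part)

lemma graded_4: "graded 4 1 Gser" "graded 4 1 Fser" "graded 4 1 J1" "graded 4 3 J3" "graded 4 3 J7" "graded 4 1 J9"
  "graded 4 1 (Fser ^ 5)"
proof -
  have 8: "graded 4 i f" if "graded 8 i f" for i f
    unfolding graded_def
  proof (intro allI impI)
    fix n assume "fps_nth f n \<noteq> 0"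
    then have "n mod 8 = i mod 8" using that by (simp add: graded_def)
    then have "n mod 8 mod 4 = i mod 8 mod 4" by (rule arg_cong)
    then show "n mod 4 = i mod 4" by (simp add: mod_mod_cancel)
  qed
  show G: "graded 4 1 Gser" by (rule graded_cong[OF 8[OF graded_8_Gser]]) simp
  show F: "graded 4 1 Fser" by (rule 8[OF graded_8_Fser])
  then show "graded 4 1 J1" by (simp only: J1_def)
  have "graded 4 (3 + 1) (J3 * Gser)"
    unfolding J3_mult_Gser by (rule graded_cong[OF graded_power[OF F]]) simp
  then show "graded 4 3 J3" by (rule graded_cancel[OF _ G Gser_nonzero])
  show "graded 4 3 J7"
    unfolding J7_def by (rule graded_cong[OF graded_mult[OF graded_power[OF F] G]]) simp
  show "graded 4 1 J9"
    unfolding J9_def by (rule graded_cong[OF graded_mult[OF graded_power[OF F] G]]) simp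
  show "graded 4 1 (Fser ^ 5)"
    by (rule graded_cong[OF graded_power[OF F]]) simp
qed

section \<open>Splitting modulo 4 and the two kernels\<close>

definition poly_sq :: "bit poly \<Rightarrow> bit poly" where
  "poly_sq p = pcompose p [:0, 0, 1:]"

lemma poly_sq_subst: "poly_subst (poly_sq p) (Gser\<^sup>2) = poly_subst p (Gser ^ 4)"
  by (simp add: poly_sq_def eval_nat_numeral mult_ac)

lemma X_poly_sq_subst: "poly_subst ([:0, 1:] * poly_sq p) (Gser\<^sup>2) = Gser\<^sup>2 * poly_subst p (Gser ^ 4)"
  by (simp only: poly_subst_mult poly_sq_subst poly_subst_X)

lemma graded_4_poly_Gser_4: "graded 4 0 (poly_subst p (Gser ^ 4))"
  by (rule graded_poly_subst[OF graded_cong[OF graded_power[OF graded_4(1)]]]) simp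

text \<open>Modulo 4, the generators G, J1, J9, F^5 have class 1, J3 and J7 have class 3, and G^2
  adds 2. So class 1 pairs the former with even and the latter with odd polynomials in G^2; class 3
  does the opposite.\<close>

lemma graded_4_span_parts:
  "graded 4 1 (fps_span (poly_sq s0) (poly_sq s1) ([:0, 1:] * poly_sq r3) ([:0, 1:] * poly_sq r7) (poly_sq s9) (poly_sq t))"
  "graded 4 3 (fps_span ([:0, 1:] * poly_sq r0) ([:0, 1:] * poly_sq r1) (poly_sq s3) (poly_sq s7) ([:0, 1:] * poly_sq r9) ([:0, 1:] * poly_sq t'))"
proof -
  have a: "graded 4 i (poly_subst (poly_sq p) (Gser\<^sup>2) * f)" if "graded 4 i f" for p f i
    unfolding poly_sq_subst using graded_mult[OF graded_4_poly_Gser_4 that] by simp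
  have b: "graded 4 j (poly_subst ([:0, 1:] * poly_sq p) (Gser\<^sup>2) * f)" if "graded 4 i f" "(2 + i) mod 4 = j mod 4" for p f i j
    unfolding X_poly_sq_subst
    using graded_cong[OF graded_mult[OF graded_mult[OF graded_power[OF graded_4(1), of 2] graded_4_poly_Gser_4] that(1)], of j] that(2)
    by simp
  show "graded 4 1 (fps_span (poly_sq s0) (poly_sq s1) ([:0, 1:] * poly_sq r3) ([:0, 1:] * poly_sq r7) (poly_sq s9) (poly_sq t))"
    unfolding fps_span_def
    by (intro graded_add a b[OF graded_4(4)] b[OF graded_4(5)] graded_4) simp_all
  show "graded 4 3 (fps_span ([:0, 1:] * poly_sq r0) ([:0, 1:] * poly_sq r1) (poly_sq s3) (poly_sq s7) ([:0, 1:] * poly_sq r9) ([:0, 1:] * poly_sq t'))"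
    unfolding fps_span_def
    by (intro graded_add a b[OF graded_4(1)] b[OF graded_4(3)] b[OF graded_4(6)] b[OF graded_4(7)] graded_4) simp_all
qed

text \<open>The letters indicate the destination: s1, s3, s7, s9 belong to N2a, the coefficients r1,
  r3, r7, r9 with their extra G^2 to N2b, s0 and r0 to N1, and t, t' to F^5.\<close>

lemma Modd_decomposition:
  assumes "f \<in> Modd"
  obtains s0 s1 s3 s7 s9 t r0 r1 r3 r7 r9 t' where
    "grade_part 4 1 f = fps_span (poly_sq s0) (poly_sq s1) ([:0, 1:] * poly_sq r3) ([:0, 1:] * poly_sq r7) (poly_sq s9) (poly_sq t)"
    "grade_part 4 3 f = fps_span ([:0, 1:] * poly_sq r0) ([:0, 1:] * poly_sq r1) (poly_sq s3) (poly_sq s7) ([:0, 1:] * poly_sq r9) ([:0, 1:] * poly_sq t')"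
    "f = grade_part 4 1 f + grade_part 4 3 f"
proof -
  obtain p0 p1 p3 p7 p9 q where f: "f = fps_span p0 p1 p3 p7 p9 q"
    using Modd_in_span[OF assms] by (auto simp: in_span_def)
  have split: "\<exists>s r. p = poly_sq s + [:0, 1:] * poly_sq r" for p :: "bit poly"
    using poly_even_odd_split[of p] unfolding poly_sq_def by metis
  obtain s0 r0 s1 r1 s3 r3 s7 r7 s9 r9 t t' where
    s: "p0 = poly_sq s0 + [:0, 1:] * poly_sq r0" "p1 = poly_sq s1 + [:0, 1:] * poly_sq r1"
    "p3 = [:0, 1:] * poly_sq r3 + poly_sq s3" "p7 = [:0, 1:] * poly_sq r7 + poly_sq s7"
    "p9 = poly_sq s9 + [:0, 1:] * poly_sq r9" "q = poly_sq t + [:0, 1:] * poly_sq t'"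
    using split[of p0] split[of p1] split[of p3] split[of p7] split[of p9] split[of q] by (metis add.commute)
  define f1 f3 where
    "f1 = fps_span (poly_sq s0) (poly_sq s1) ([:0, 1:] * poly_sq r3) ([:0, 1:] * poly_sq r7) (poly_sq s9) (poly_sq t)"
    and "f3 = fps_span ([:0, 1:] * poly_sq r0) ([:0, 1:] * poly_sq r1) (poly_sq s3) (poly_sq s7) ([:0, 1:] * poly_sq r9) ([:0, 1:] * poly_sq t')"
  have sum: "f = f1 + f3" unfolding f f1_def f3_def fps_span_add s ..
  have g: "graded 4 1 f1" "graded 4 3 f3" unfolding f1_def f3_def by (rule graded_4_span_parts)+
  have "grade_part 4 1 f = f1" "grade_part 4 3 f = f3"
    unfolding sum grade_part_add grade_part_graded[OF g(1)] grade_part_graded[OF g(2)] by simp_all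
  then show ?thesis using that sum unfolding f1_def f3_def by metis
qed

lemma grade_part_4_5_eq_0:
  assumes "\<And>n. n mod 20 = k mod 20 \<Longrightarrow> fps_nth f n = 0" "k mod 4 = i mod 4" "k mod 5 = j mod 5"
  shows "grade_part 5 j (grade_part 4 i f) = 0"
proof (rule fps_ext)
  fix n
  have "n mod 20 = k mod 20" if "n mod 4 = i mod 4" "n mod 5 = j mod 5"
    using that assms by (intro mod_20_eqI) simp_all
  then show "fps_nth (grade_part 5 j (grade_part 4 i f)) n = fps_nth 0 n"
    using assms(1) by (simp add: grade_part_nth)
qed

lemma p_b_eq_0_iff: "p_b f = 0 \<longleftrightarrow> (\<forall>n. n mod 20 \<in> {11, 13, 17, 19} \<longrightarrow> fps_nth f n = 0)"
  and p_a_eq_0_iff: "p_a f = 0 \<longleftrightarrow> (\<forall>n. n mod 20 \<in> {1, 3, 7, 9} \<longrightarrow> fps_nth f n = 0)"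
  unfolding p_b_def p_a_def fps_eq_iff fps_nth_Abs_fps fps_zero_nth by presburger+

text \<open>Among the classes where \<open>f\<close> vanishes, 13 and 17 are 1 modulo 4 and
  nonresidues modulo 5, while 11 and 19 are 3 modulo 4 and residues modulo 5. The former annihilate
  r3, r7, t, the latter r1, r9, t'.\<close>

lemma kernel_p_b_subset:
  assumes f: "f \<in> Modd" and "p_b f = 0"
  shows "\<exists>g\<in>N1. \<exists>h\<in>N2a_lift. f = g + h"
proof -
  obtain s0 s1 s3 s7 s9 t r0 r1 r3 r7 r9 t' where
    1: "grade_part 4 1 f = fps_span (poly_sq s0) (poly_sq s1) ([:0, 1:] * poly_sq r3) ([:0, 1:] * poly_sq r7) (poly_sq s9) (poly_sq t)"
    and 3: "grade_part 4 3 f = fps_span ([:0, 1:] * poly_sq r0) ([:0, 1:] * poly_sq r1) (poly_sq s3) (poly_sq s7) ([:0, 1:] * poly_sq r9) ([:0, 1:] * poly_sq t')"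
    and sum: "f = grade_part 4 1 f + grade_part 4 3 f"
    by (rule Modd_decomposition[OF f])
  have z: "fps_nth f n = 0" if "n mod 20 \<in> {11, 13, 17, 19}" for n
    using assms(2) that by (simp only: p_b_eq_0_iff)
  have c1_1: "grade_part 5 2 (grade_part 4 1 f) = 0" by (rule grade_part_4_5_eq_0[of 17]) (simp_all add: z)
  have c1_2: "grade_part 5 3 (grade_part 4 1 f) = 0" by (rule grade_part_4_5_eq_0[of 13]) (simp_all add: z)
  note c1 = span_coefficients_residue[OF 1 c1_1 c1_2]
  have c3_1: "grade_part 5 1 (grade_part 4 3 f) = 0" by (rule grade_part_4_5_eq_0[of 11]) (simp_all add: z)
  have c3_2: "grade_part 5 4 (grade_part 4 3 f) = 0" by (rule grade_part_4_5_eq_0[of 19]) (simp_all add: z)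
  note c3 = span_coefficients_nonresidue[OF 3 c3_1 c3_2]
  define g h where "g = poly_subst (poly_sq s0 + [:0, 1:] * poly_sq r0) (Gser\<^sup>2) * Gser"
    and "h = poly_subst s1 (Gser ^ 4) * J1 + poly_subst s3 (Gser ^ 4) * J3 + poly_subst s7 (Gser ^ 4) * J7 + poly_subst s9 (Gser ^ 4) * J9"
  have "f = g + h"
    unfolding g_def h_def
    by (subst sum, unfold 1 3 c1 c3 fps_span_def poly_subst_add distrib_right poly_sq_subst) (simp add: add_ac)
  moreover have "g \<in> N1" unfolding g_def N1_def by blast
  moreover have "h \<in> N2a_lift" unfolding h_def N2a_lift_def by blast
  ultimately show ?thesis by blast
qed

text \<open>Residues and nonresidues change roles: 1 and 9 are 1 modulo 4 and annihilate s1, s9, t;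
  3 and 7 are 3 modulo 4 and annihilate s3, s7, t'.\<close>

lemma kernel_p_a_subset:
  assumes f: "f \<in> Modd" and "p_a f = 0"
  shows "\<exists>g\<in>N1. \<exists>h\<in>N2b_lift. f = g + h"
proof -
  obtain s0 s1 s3 s7 s9 t r0 r1 r3 r7 r9 t' where
    1: "grade_part 4 1 f = fps_span (poly_sq s0) (poly_sq s1) ([:0, 1:] * poly_sq r3) ([:0, 1:] * poly_sq r7) (poly_sq s9) (poly_sq t)"
    and 3: "grade_part 4 3 f = fps_span ([:0, 1:] * poly_sq r0) ([:0, 1:] * poly_sq r1) (poly_sq s3) (poly_sq s7) ([:0, 1:] * poly_sq r9) ([:0, 1:] * poly_sq t')"
    and sum: "f = grade_part 4 1 f + grade_part 4 3 f"
    by (rule Modd_decomposition[OF f])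
  have z: "fps_nth f n = 0" if "n mod 20 \<in> {1, 3, 7, 9}" for n
    using assms(2) that by (simp only: p_a_eq_0_iff)
  have c1_1: "grade_part 5 1 (grade_part 4 1 f) = 0" by (rule grade_part_4_5_eq_0[of 1]) (simp_all add: z)
  have c1_2: "grade_part 5 4 (grade_part 4 1 f) = 0" by (rule grade_part_4_5_eq_0[of 9]) (simp_all add: z)
  note c1 = span_coefficients_nonresidue[OF 1 c1_1 c1_2]
  have c3_1: "grade_part 5 2 (grade_part 4 3 f) = 0" by (rule grade_part_4_5_eq_0[of 7]) (simp_all add: z)
  have c3_2: "grade_part 5 3 (grade_part 4 3 f) = 0" by (rule grade_part_4_5_eq_0[of 3]) (simp_all add: z)
  note c3 = span_coefficients_residue[OF 3 c3_1 c3_2]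
  define g h where "g = poly_subst (poly_sq s0 + [:0, 1:] * poly_sq r0) (Gser\<^sup>2) * Gser"
    and "h = poly_subst r1 (Gser ^ 4) * J11 + poly_subst r3 (Gser ^ 4) * J13 + poly_subst r7 (Gser ^ 4) * J17 + poly_subst r9 (Gser ^ 4) * J19"
  have "f = g + h"
    unfolding g_def h_def J11_def J13_def J17_def J19_def
    by (subst sum, unfold 1 3 c1 c3 fps_span_def poly_subst_add distrib_right X_poly_sq_subst) (simp add: add_ac mult_ac)
  moreover have "g \<in> N1" unfolding g_def N1_def by blast
  moreover have "h \<in> N2b_lift" unfolding h_def N2b_lift_def by blast
  ultimately show ?thesis by blast
qed

section \<open>The reverse inclusions\<close>

lemma Mall_closed:
  "f \<in> Mall \<Longrightarrow> g \<in> Mall \<Longrightarrow> f + g \<in> Mall" "f \<in> Mall \<Longrightarrow> g \<in> Mall \<Longrightarrow> f * g \<in> Mall" "c_bit \<in> Mall" "1 \<in> Mall"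
  unfolding Mall_eq
  by (metis (no_types, lifting) poly_subst_add rangeE rangeI, metis (no_types, lifting) poly_subst_mult rangeE rangeI,
      metis poly_subst_X rangeI, metis poly_subst_1 rangeI)

lemma Mall_power: "f \<in> Mall \<Longrightarrow> f ^ n \<in> Mall"
  by (induction n) (auto intro: Mall_closed)

lemma Mall_poly_subst: "f \<in> Mall \<Longrightarrow> poly_subst p f \<in> Mall"
proof (induction p)
  case 0
  have "1 + 1 \<in> Mall" by (intro Mall_closed)
  then show ?case by simp
next
  case (pCons b p)
  then have *: "f * poly_subst p f \<in> Mall" by (intro Mall_closed) auto
  show ?case using bit_fps_const_cases[of b] * Mall_closed(1)[OF Mall_closed(4) *] by auto
qed

lemma generators_in_Mall: "Gser \<in> Mall" "Fser \<in> Mall" "J1 \<in> Mall" "J3 \<in> Mall" "J7 \<in> Mall" "J9 \<in> Mall"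
proof -
  have a: "a_bit \<in> Mall" unfolding a_bit_conv_c_bit by (intro Mall_closed)
  show G: "Gser \<in> Mall" unfolding Gser_c by (intro Mall_closed Mall_power a)
  show F: "Fser \<in> Mall" unfolding Fser_c by (intro Mall_closed Mall_power a)
  then show "J1 \<in> Mall" by (simp only: J1_def)
  show 7: "J7 \<in> Mall" unfolding J7_def by (intro Mall_closed Mall_power F G)
  show "J9 \<in> Mall" unfolding J9_def by (intro Mall_closed Mall_power F G)
  \<comment> \<open>The formula \<open>J3_u\<close> involves no division.\<close>
  show "J3 \<in> Mall" unfolding J3_u d_bit_def u_bit_def by (intro Mall_closed Mall_power 7 G)
qed

lemma Modd_supportedI:
  assumes "f \<in> Mall" "supported {1, 3, 5, 7, 9, 11, 13, 15, 17, 19} f"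
  shows "f \<in> Modd"
proof -
  have "fps_nth f n = 0" if "even n" for n
  proof (rule ccontr)
    assume "fps_nth f n \<noteq> 0"
    then have "n mod 20 \<in> {1, 3, 5, 7, 9, 11, 13, 15, 17, 19}" using assms(2) unfolding supported_def by blast
    then have "odd (n mod 20)" by (elim insertE) simp_all
    moreover have "even (n mod 20)" using that by (simp add: dvd_mod)
    ultimately show False by blast
  qed
  then show ?thesis using assms(1) by (simp add: Modd_def)
qed

lemma N1_in_Mall: "g \<in> N1 \<Longrightarrow> g \<in> Mall"
  unfolding N1_def by (auto intro!: Mall_closed Mall_poly_subst Mall_power generators_in_Mall)

lemma N2a_in_Mall: "h \<in> N2a_lift \<Longrightarrow> h \<in> Mall"
  unfolding N2a_lift_def by (auto intro!: Mall_closed Mall_poly_subst Mall_power generators_in_Mall)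

lemma N2b_in_Mall: "h \<in> N2b_lift \<Longrightarrow> h \<in> Mall"
  unfolding N2b_lift_def J11_def J13_def J17_def J19_def
  by (auto intro!: Mall_closed Mall_poly_subst Mall_power generators_in_Mall)

lemma supported_N2a: "h \<in> N2a_lift \<Longrightarrow> supported {1, 3, 5, 7, 9, 15} h"
proof -
  have "supported {1, 3, 5, 7, 9, 15} (poly_subst p (Gser ^ 4) * J)" if "supported {1, 5, 9} J \<or> supported {3, 7, 15} J" for p J
    by (rule supported_poly_mult) (use that supported_mono in \<open>auto 0 3\<close>)
  then show "h \<in> N2a_lift \<Longrightarrow> supported {1, 3, 5, 7, 9, 15} h"
    using supported_J unfolding N2a_lift_def by (auto intro!: supported_add)
qed

text \<open>The factor G^2 adds 10 to exponents modulo 20: 1, 3, 7, 9 become 11, 13, 17, 19, and 5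
  and 15 are exchanged.\<close>

lemma supported_N2b: "h \<in> N2b_lift \<Longrightarrow> supported {5, 11, 13, 15, 17, 19} h"
proof -
  have "supported {5, 11, 13, 15, 17, 19} (poly_subst p (Gser ^ 4) * (Gser\<^sup>2 * J))"
    if "supported {1, 5, 9} J \<or> supported {3, 7, 15} J" for p J
  proof (rule supported_poly_mult)
    show "supported {5, 11, 13, 15, 17, 19} (Gser\<^sup>2 * J)"
      using that
    proof
      assume "supported {1, 5, 9} J"
      then show ?thesis by (rule supported_mult_graded[OF _ graded_20_Gser_squared]) auto
    next
      assume "supported {3, 7, 15} J"
      then show ?thesis by (rule supported_mult_graded[OF _ graded_20_Gser_squared]) auto
    qed
  qed auto
  then show "h \<in> N2b_lift \<Longrightarrow> supported {5, 11, 13, 15, 17, 19} h"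
    using supported_J unfolding N2b_lift_def J11_def J13_def J17_def J19_def by (auto intro!: supported_add)
qed

lemma N1_plus_N2a:
  assumes "g \<in> N1" "h \<in> N2a_lift"
  shows "g + h \<in> Modd" "p_b (g + h) = 0"
proof -
  have s: "supported {1, 3, 5, 7, 9, 15} (g + h)"
    using supported_N1[OF assms(1)] supported_N2a[OF assms(2)]
    by (intro supported_add) (auto elim: supported_mono)
  then show "g + h \<in> Modd"
    using Mall_closed(1)[OF N1_in_Mall[OF assms(1)] N2a_in_Mall[OF assms(2)]]
    by (intro Modd_supportedI) (auto elim: supported_mono)
  show "p_b (g + h) = 0"
    unfolding p_b_eq_0_iff
  proof (intro allI impI)
    fix n :: nat assume "n mod 20 \<in> {11, 13, 17, 19}"
    then have "n mod 20 \<notin> {1, 3, 5, 7, 9, 15}" by (elim insertE) simp_all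
    then show "fps_nth (g + h) n = 0" using s unfolding supported_def by blast
  qed
qed

lemma N1_plus_N2b:
  assumes "g \<in> N1" "h \<in> N2b_lift"
  shows "g + h \<in> Modd" "p_a (g + h) = 0"
proof -
  have s: "supported {5, 11, 13, 15, 17, 19} (g + h)"
    using supported_N1[OF assms(1)] supported_N2b[OF assms(2)]
    by (intro supported_add) (auto elim: supported_mono)
  then show "g + h \<in> Modd"
    using Mall_closed(1)[OF N1_in_Mall[OF assms(1)] N2b_in_Mall[OF assms(2)]]
    by (intro Modd_supportedI) (auto elim: supported_mono)
  show "p_a (g + h) = 0"
    unfolding p_a_eq_0_iff
  proof (intro allI impI)
    fix n :: nat assume "n mod 20 \<in> {1, 3, 7, 9}"
    then have "n mod 20 \<notin> {5, 11, 13, 15, 17, 19}" by (elim insertE) simp_all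
    then show "fps_nth (g + h) n = 0" using s unfolding supported_def by blast
  qed
qed

text \<open>Kernels in the quotient by N1 appear as their preimages in M(odd), which is why N1 is
  added to the lifts of N2a and N2b.\<close>

theorem theorem2p17:
  shows "{f \<in> Modd. p_b f = 0} = {g + h | g h. g \<in> N1 \<and> h \<in> N2a_lift} \<and>
         {f \<in> Modd. p_a f = 0} = {g + h | g h. g \<in> N1 \<and> h \<in> N2b_lift}"
proof (intro conjI equalityI subsetI)
  fix f assume "f \<in> {f \<in> Modd. p_b f = 0}"
  then show "f \<in> {g + h | g h. g \<in> N1 \<and> h \<in> N2a_lift}" using kernel_p_b_subset by blast
next
  fix f assume "f \<in> {f \<in> Modd. p_a f = 0}"
  then show "f \<in> {g + h | g h. g \<in> N1 \<and> h \<in> N2b_lift}" using kernel_p_a_subset by blast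
next
  fix f assume "f \<in> {g + h | g h. g \<in> N1 \<and> h \<in> N2a_lift}"
  then show "f \<in> {f \<in> Modd. p_b f = 0}" using N1_plus_N2a by blast
next
  fix f assume "f \<in> {g + h | g h. g \<in> N1 \<and> h \<in> N2b_lift}"
  then show "f \<in> {f \<in> Modd. p_a f = 0}" using N1_plus_N2b by blast
qed

end
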